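(* Let $F$ be a non-Riemannian Randers metric with navigation data $(h,W)$ on an $n(\ge2)$-dimensional manifold $M$ and let $V$ be a $C^2$ vector field on $M$. If $F$ is of constant $S_{BH}$-curvature $\sigma$, then $(M,F,V)$ is an almost Ricci soliton with soliton scalar $\kappa$ if and only if one of the following statements holds. (1) $h$ is Einstein with Einstein scalar $\mu$, $W$ is a homothetic vector field of $h$ with dilation $-\sigma$ and $V$ is a homothetic vector field of $F$ with dilation $\frac12c$, where $\kappa=\mu+c-(n-1)\sigma^2$. In particular, both $\kappa$ and $\mu$ are constants when $n\ge3$. (2) $F$ is Einstein with Einstein scalar $\nu$ and $V$ is a homothetic vector field of $F$ with dilation $\frac12c$, where $\kappa=\nu+c$. In particular, both $\kappa$ and $\nu$ are constants when $n\ge3$.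
   Context: Navigation data: $h$ is a Riemannian metric, $h^2=h_{ij}(x)y^iy^j$, $W=W^i\partial_{x^i}$ is a vector field with $\|W\|_h<1$; the Randers metric with navigation data $(h,W)$ is $F=\frac{\sqrt{\lambda h^2+W_0^2}}{\lambda}-\frac{W_0}{\lambda}$, where $W_i=h_{ij}W^j$, $W_0=W_iy^i$, $\lambda=1-\|W\|_h^2$. $F$ is Riemannian iff $W=0$. Finsler notions: $g_{ij}=\frac12[F^2]_{y^iy^j}$; $G^i=\frac14 g^{il}\{[F^2]_{x^ky^l}y^k-[F^2]_{x^l}\}$; $R^i_{\ k}=2\frac{\partial G^i}{\partial x^k}-\frac{\partial^2G^i}{\partial x^j\partial y^k}y^j+2G^j\frac{\partial^2G^i}{\partial y^j\partial y^k}-\frac{\partial G^i}{\partial y^j}\frac{\partial G^j}{\partial y^k}$; $\mathrm{Ric}=R^i_{\ i}$. $F$ (resp. $h$) is Einstein with Einstein scalar $\nu=\nu(x)$ (resp. $\mu=\mu(x)$) if $\mathrm{Ric}=\nu F^2$ (resp. ${}^h\mathrm{Ric}=\mu h^2$), the scalars being functions on $M$. $S_{BH}$ is the S-curvature $S(x,y)=\frac{\partial G^i}{\partial y^i}-y^i\frac{\partial}{\partial x^i}(\log\sigma_{BH})$ for the Busemann-Hausdorff measure $dm_{BH}=\sigma_{BH}dx$, $\sigma_{BH}=\mathrm{Vol}(\mathbb B^n_1)/\mathrm{Vol}\{y\in\mathbb R^n: F(x,y)<1\}$. $F$ has constant $S_{BH}$-curvature $\sigma$ if $S_{BH}=(n+1)\sigma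 F$ with $\sigma$ constant. Complete lift: $\hat V=V^i\frac{\partial}{\partial x^i}+y^j\frac{\partial V^i}{\partial x^j}\frac{\partial}{\partial y^i}$; $\mathcal L_{\hat V}(\phi)=\hat V(\phi)$ for functions on $TM$. A vector field $V$ is homothetic for a metric $F$ (or $h$) with dilation $\tau$ if $\hat V(F)=2\tau F$ (resp. $\hat V(h)=2\tau h$) with $\tau$ constant. $(M,F,V)$ is an almost Ricci soliton with soliton scalar $\kappa=\kappa(x)$ if $2\mathrm{Ric}+\mathcal L_{\hat V}(F^2)=2\kappa F^2$ on $TM$.
   Formalization: The manifold M is assumed connected; on a disconnected M the claim fails, since V can be homothetic with different dilations on different components (and the Einstein scalars can differ from component to component). *)

theory Defs
  imports "HOL-Analysis.Analysis"
begin

text \<open>The regularity class \<open>C\<^sup>k\<close> is only used on open sets \<open>S\<close>.\<close>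

primrec Ck_on :: "nat \<Rightarrow> ('a::euclidean_space \<Rightarrow> 'b::real_normed_vector) \<Rightarrow> 'a set \<Rightarrow> bool" where
  "Ck_on 0 f S \<longleftrightarrow> continuous_on S f"
| "Ck_on (Suc k) f S \<longleftrightarrow>
     f differentiable_on S \<and> (\<forall>b\<in>Basis. Ck_on k (\<lambda>x. frechet_derivative f (at x) b) S)"

definition smooth_on :: "('a::euclidean_space \<Rightarrow> 'b::real_normed_vector) \<Rightarrow> 'a set \<Rightarrow> bool" where
  "smooth_on f S \<longleftrightarrow> (\<forall>k. Ck_on k f S)"

text \<open>A chart is a pair of its domain and its coordinate map; the values of the coordinate map
  outside the domain are irrelevant.\<close>

type_synonym ('m, 'n) chart = "'m set \<times> ('m \<Rightarrow> real ^ 'n)"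

definition is_chart :: "('m::topological_space, 'n::finite) chart \<Rightarrow> bool" where
  "is_chart c \<longleftrightarrow> open (fst c) \<and> open (snd c ` fst c) \<and>
     homeomorphism (fst c) (snd c ` fst c) (snd c) (the_inv_into (fst c) (snd c))"

definition transition :: "('m, 'n) chart \<Rightarrow> ('m, 'n) chart \<Rightarrow> real ^ 'n \<Rightarrow> real ^ 'n" where
  "transition c c' = snd c' \<circ> the_inv_into (fst c) (snd c)"

definition smooth_atlas :: "('m::topological_space, 'n::finite) chart set \<Rightarrow> bool" where
  "smooth_atlas A \<longleftrightarrow> (\<forall>c\<in>A. is_chart c) \<and> (\<Union>c\<in>A. fst c) = UNIV \<and>
     (\<forall>c\<in>A. \<forall>c'\<in>A. smooth_on (transition c c') (snd c ` (fst c \<inter> fst c')))"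

text \<open>The manifold is the whole type \<open>'m\<close>. Connectedness is part of the convention: it is what
  turns local constancy into constancy.\<close>

definition manifold_atlas ::
    "('m::{t2_space, second_countable_topology}, 'n::finite) chart set \<Rightarrow> bool" where
  "manifold_atlas A \<longleftrightarrow> smooth_atlas A \<and> connected (UNIV :: 'm set)"

text \<open>Objects on the manifold are given by their components in every chart of the atlas, as
  functions of the coordinates \<open>x = \<phi>(p)\<close> (and, for functions on the tangent bundle, of the
  fibre coordinates \<open>y\<close>); components in different charts are related by the usual transformation
  law. What is assigned to charts outside the atlas is irrelevant.\<close>

type_synonym ('m, 'n) vfield = "('m, 'n) chart \<Rightarrow> real ^ 'n \<Rightarrow> real ^ 'n"
type_synonym ('m, 'n) tensor2 = "('m, 'n) chart \<Rightarrow> real ^ 'n \<Rightarrow> real ^ 'n ^ 'n"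
type_synonym ('m, 'n) tmfun = "('m, 'n) chart \<Rightarrow> real ^ 'n \<Rightarrow> real ^ 'n \<Rightarrow> real"

definition vfield_transformation_law ::
    "('m, 'n::finite) chart set \<Rightarrow> ('m, 'n) vfield \<Rightarrow> bool" where
  "vfield_transformation_law A V \<longleftrightarrow> (\<forall>c\<in>A. \<forall>c'\<in>A. \<forall>p\<in>fst c \<inter> fst c'.
     V c' (snd c' p) = frechet_derivative (transition c c') (at (snd c p)) (V c (snd c p)))"

definition Ck_vector_field ::
    "nat \<Rightarrow> ('m, 'n::finite) chart set \<Rightarrow> ('m, 'n) vfield \<Rightarrow> bool" where
  "Ck_vector_field k A V \<longleftrightarrow>
     vfield_transformation_law A V \<and> (\<forall>c\<in>A. Ck_on k (V c) (snd c ` fst c))"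

definition smooth_vector_field :: "('m, 'n::finite) chart set \<Rightarrow> ('m, 'n) vfield \<Rightarrow> bool" where
  "smooth_vector_field A V \<longleftrightarrow> (\<forall>k. Ck_vector_field k A V)"

definition bil :: "real ^ 'n ^ 'n \<Rightarrow> real ^ 'n \<Rightarrow> real ^ 'n \<Rightarrow> real" where
  "bil H u v = (\<Sum>i\<in>UNIV. \<Sum>j\<in>UNIV. H $ i $ j * u $ i * v $ j)"

definition riemannian_metric :: "('m, 'n::finite) chart set \<Rightarrow> ('m, 'n) tensor2 \<Rightarrow> bool" where
  "riemannian_metric A h \<longleftrightarrow>
     (\<forall>c\<in>A. smooth_on (h c) (snd c ` fst c)) \<and>
     (\<forall>c\<in>A. \<forall>p\<in>fst c. transpose (h c (snd c p)) = h c (snd c p) \<and>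
        (\<forall>y. y \<noteq> 0 \<longrightarrow> bil (h c (snd c p)) y y > 0)) \<and>
     (\<forall>c\<in>A. \<forall>c'\<in>A. \<forall>p\<in>fst c \<inter> fst c'. \<forall>u v.
        bil (h c (snd c p)) u v =
        bil (h c' (snd c' p)) (frechet_derivative (transition c c') (at (snd c p)) u)
                              (frechet_derivative (transition c c') (at (snd c p)) v))"

text \<open>The norm function \<open>h = sqrt (h\<^sub>i\<^sub>j y\<^sup>i y\<^sup>j)\<close> on the tangent bundle, so that the
  Finslerian notions below apply to a Riemannian metric as well.\<close>

definition metric_norm :: "('m, 'n::finite) tensor2 \<Rightarrow> ('m, 'n) tmfun" where
  "metric_norm h c x y = sqrt (bil (h c x) y y)"

definition navigation_data ::
    "('m, 'n::finite) chart set \<Rightarrow> ('m, 'n) tensor2 \<Rightarrow> ('m, 'n) vfield \<Rightarrow> bool" where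
  "navigation_data A h W \<longleftrightarrow> riemannian_metric A h \<and> smooth_vector_field A W \<and>
     (\<forall>c\<in>A. \<forall>p\<in>fst c. metric_norm h c (snd c p) (W c (snd c p)) < 1)"

definition randers_metric ::
    "('m, 'n::finite) tensor2 \<Rightarrow> ('m, 'n) vfield \<Rightarrow> ('m, 'n) tmfun" where
  "randers_metric h W c x y =
     (let lam = 1 - (metric_norm h c x (W c x))\<^sup>2;
          W0 = bil (h c x) (W c x) y
      in sqrt (lam * (metric_norm h c x y)\<^sup>2 + W0\<^sup>2) / lam - W0 / lam)"

definition is_riemannian :: "('m, 'n::finite) chart set \<Rightarrow> ('m, 'n) tmfun \<Rightarrow> bool" where
  "is_riemannian A F \<longleftrightarrow> (\<exists>g. riemannian_metric A g \<and>
     (\<forall>c\<in>A. \<forall>p\<in>fst c. \<forall>y. F c (snd c p) y = metric_norm g c (snd c p) y))"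

type_synonym 'n locfun = "real ^ 'n \<Rightarrow> real ^ 'n \<Rightarrow> real"

definition dx :: "'n::finite \<Rightarrow> 'n locfun \<Rightarrow> 'n locfun" where
  "dx i f x y = frechet_derivative (\<lambda>x'. f x' y) (at x) (axis i 1)"

definition dy :: "'n::finite \<Rightarrow> 'n locfun \<Rightarrow> 'n locfun" where
  "dy i f x y = frechet_derivative (\<lambda>y'. f x y') (at y) (axis i 1)"

definition sq :: "'n locfun \<Rightarrow> 'n locfun" where
  "sq f x y = (f x y)\<^sup>2"

definition fundamental_tensor ::
    "'n::finite locfun \<Rightarrow> real ^ 'n \<Rightarrow> real ^ 'n \<Rightarrow> real ^ 'n ^ 'n" where
  "fundamental_tensor F x y = (\<chi> i j. 1/2 * dy j (dy i (sq F)) x y)"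

definition spray_coeff :: "'n::finite locfun \<Rightarrow> 'n \<Rightarrow> 'n locfun" where
  "spray_coeff F i x y = 1/4 * (\<Sum>l\<in>UNIV. matrix_inv (fundamental_tensor F x y) $ i $ l *
     ((\<Sum>k\<in>UNIV. dx k (dy l (sq F)) x y * y $ k) - dx l (sq F) x y))"

definition riemann_curv :: "'n::finite locfun \<Rightarrow> 'n \<Rightarrow> 'n \<Rightarrow> 'n locfun" where
  "riemann_curv F i k x y = (let G = spray_coeff F in
     2 * dx k (G i) x y
     - (\<Sum>j\<in>UNIV. dx j (dy k (G i)) x y * y $ j)
     + 2 * (\<Sum>j\<in>UNIV. G j x y * dy j (dy k (G i)) x y)
     - (\<Sum>j\<in>UNIV. dy j (G i) x y * dy k (G j) x y))"

definition Ric :: "'n::finite locfun \<Rightarrow> 'n locfun" where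
  "Ric F x y = (\<Sum>i\<in>UNIV. riemann_curv F i i x y)"

definition sigma_BH :: "'n::finite locfun \<Rightarrow> real ^ 'n \<Rightarrow> real" where
  "sigma_BH F x =
     measure lebesgue (ball (0 :: real ^ 'n) 1) / measure lebesgue {y :: real ^ 'n. F x y < 1}"

definition S_BH :: "'n::finite locfun \<Rightarrow> 'n locfun" where
  "S_BH F x y = (\<Sum>i\<in>UNIV. dy i (spray_coeff F i) x y)
     - (\<Sum>i\<in>UNIV. y $ i * frechet_derivative (\<lambda>x'. ln (sigma_BH F x')) (at x) (axis i 1))"

definition complete_lift :: "(real ^ 'n \<Rightarrow> real ^ 'n::finite) \<Rightarrow> 'n locfun \<Rightarrow> 'n locfun" where
  "complete_lift V f x y = (\<Sum>i\<in>UNIV. V x $ i * dx i f x y)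
     + (\<Sum>i\<in>UNIV. \<Sum>j\<in>UNIV.
          y $ j * frechet_derivative (\<lambda>x'. V x' $ i) (at x) (axis j 1) * dy i f x y)"

text \<open>A Finsler metric is smooth only away from the zero section, so all identities are required
  for \<open>y \<noteq> 0\<close>; at \<open>y = 0\<close> both sides of each vanish by homogeneity.\<close>

definition einstein ::
    "('m, 'n::finite) chart set \<Rightarrow> ('m, 'n) tmfun \<Rightarrow> ('m \<Rightarrow> real) \<Rightarrow> bool" where
  "einstein A F \<nu> \<longleftrightarrow> (\<forall>c\<in>A. \<forall>p\<in>fst c. \<forall>y. y \<noteq> 0 \<longrightarrow>
     Ric (F c) (snd c p) y = \<nu> p * (F c (snd c p) y)\<^sup>2)"

definition constant_S_BH ::
    "('m, 'n::finite) chart set \<Rightarrow> ('m, 'n) tmfun \<Rightarrow> real \<Rightarrow> bool" where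
  "constant_S_BH A F \<sigma> \<longleftrightarrow> (\<forall>c\<in>A. \<forall>p\<in>fst c. \<forall>y. y \<noteq> 0 \<longrightarrow>
     S_BH (F c) (snd c p) y = (real CARD('n) + 1) * \<sigma> * F c (snd c p) y)"

definition homothetic ::
    "('m, 'n::finite) chart set \<Rightarrow> ('m, 'n) tmfun \<Rightarrow> ('m, 'n) vfield \<Rightarrow> real \<Rightarrow> bool" where
  "homothetic A F V \<tau> \<longleftrightarrow> (\<forall>c\<in>A. \<forall>p\<in>fst c. \<forall>y. y \<noteq> 0 \<longrightarrow>
     complete_lift (V c) (F c) (snd c p) y = 2 * \<tau> * F c (snd c p) y)"

definition almost_ricci_soliton ::
    "('m, 'n::finite) chart set \<Rightarrow> ('m, 'n) tmfun \<Rightarrow> ('m, 'n) vfield \<Rightarrow> ('m \<Rightarrow> real) \<Rightarrow> bool"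
  where
  "almost_ricci_soliton A F V \<kappa> \<longleftrightarrow> (\<forall>c\<in>A. \<forall>p\<in>fst c. \<forall>y. y \<noteq> 0 \<longrightarrow>
     2 * Ric (F c) (snd c p) y + complete_lift (V c) (sq (F c)) (snd c p) y
       = 2 * \<kappa> p * (F c (snd c p) y)\<^sup>2)"

end

theory Submission
  imports Defs
begin

text \<open>In a chart write \<open>u = y - F W\<close>; then \<open>h(u, u) = F\<^sup>2\<close>, and every nonzero \<open>u\<close> arises from exactly
one \<open>y = u + |u| W\<close>. All identities are rewritten in terms of \<open>u\<close> and split into the parts that are
even and odd in \<open>u\<close>.

The S-curvature is \<open>\<theta>(y) - (n+1) h(u, \<nabla>\<^sub>uW) / (2F)\<close>, where the linear form \<open>\<theta>\<close> absorbs the volume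
density. If it equals \<open>(n+1) \<sigma> F\<close>, then the odd part forces \<open>\<theta> = 0\<close>, so that the volume never has to be
computed, and the even part says that \<open>W\<close> is homothetic with dilation \<open>-\<sigma>\<close>. For homothetic \<open>W\<close> one
finds \<open>Ric(y) = \<^sup>hRic(u) - (n-1) \<sigma>\<^sup>2 F\<^sup>2\<close>; hence \<open>F\<close> is Einstein iff \<open>h\<close> is, and the constancy of the
Einstein scalars is Schur's lemma for \<open>h\<close>.

The same splitting turns the soliton equation into \<open>L\<^sub>Vh = -P\<close> and \<open>h(u, W) P(u) = 2 |u|\<^sup>2 h(u, [V, W])\<close>
for a quadratic form \<open>P\<close>. Where \<open>W \<noteq> 0\<close> the irreducibility of \<open>|u|\<^sup>2\<close> gives \<open>P = 2 \<rho> h\<close> and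
\<open>[V, W] = \<rho> W\<close>, and comparing two expressions for the Lie derivative of \<open>h\<close> along \<open>[V, W]\<close> gives
\<open>d\<rho> = 0\<close>. The points with \<open>W \<noteq> 0\<close>
are dense, since a Killing field that vanishes on an open set vanishes identically and \<open>F\<close> is not
Riemannian.\<close>

section \<open>Functions of class \<open>C\<^sup>k\<close>\<close>

text \<open>The indicatrix of F is that of h translated by W, which is
  \<open>h(y - F W, y - F W) = F^2\<close> divided by F^2. Derivatives of F therefore come from
  implicit differentiation of this relation, and the factor F + h(u, W) that appears each time is
  the square root in the formula for F. The soliton scalar carries no regularity, so it is never
  differentiated; the conformal factor \<rho> is read off from \<open>L\<^sub>Vh\<close> instead and
  is C^1 because V is C^2. The two expressions behind d\<rho> = 0 are these. As a commutator of
  \<open>L\<^sub>V\<close> and \<open>L\<^sub>W\<close>, the Lie derivative of h along [V, W] is 2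
  W(\<rho>) h. Computed from [V, W] = \<rho> W, its value on (u, u) is -4 \<sigma> \<rho> h(u, u) +
  2 d\<rho>(u) h(W, u). A nonzero u orthogonal to W, which exists for n \<ge> 2, shows that the
  multiples of h agree, and then d\<rho>(u) h(W, u) = 0 for all u. Under constant S-curvature the
  Einstein conditions in the two alternatives correspond by \<nu> = \<mu> - (n-1)
  \<sigma>^2.\<close>

definition blinfun_derivative ::
    "('a::euclidean_space \<Rightarrow> 'b::real_normed_vector) \<Rightarrow> 'a \<Rightarrow> 'a \<Rightarrow>\<^sub>L 'b" where
  "blinfun_derivative f x = Blinfun (frechet_derivative f (at x))"

lemma has_derivative_blinfun_derivative:
  assumes "f differentiable (at x)"
  shows "(f has_derivative blinfun_apply (blinfun_derivative f x)) (at x)"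
proof -
  have "(f has_derivative frechet_derivative f (at x)) (at x)"
    using assms by (simp add: frechet_derivative_works)
  moreover from this have "bounded_linear (frechet_derivative f (at x))"
    by (rule has_derivative_bounded_linear)
  ultimately show ?thesis
    by (simp add: blinfun_derivative_def bounded_linear_Blinfun_apply)
qed

lemma frechet_derivative_eq:
  "(f has_derivative f') (at x) \<Longrightarrow> frechet_derivative f (at x) = f'"
  by (rule frechet_derivative_at[symmetric])

lemma blinfun_derivative_eqI:
  "(f has_derivative blinfun_apply f') (at x) \<Longrightarrow> blinfun_derivative f x = f'"
  by (simp add: blinfun_derivative_def frechet_derivative_eq blinfun_apply_inverse)

lemma has_derivative_comp_fst:
  assumes "(f has_derivative f') (at x)"
  shows "((\<lambda>p. f (fst p)) has_derivative (\<lambda>q. f' (fst q))) (at (x, y))"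
  using has_derivative_compose[OF has_derivative_fst[OF has_derivative_ident], of f f' "(x, y)"] assms by simp

lemma
  assumes "(f has_derivative D) (at (x, y))"
  shows has_derivative_slice_fst: "((\<lambda>x. f (x, y)) has_derivative (\<lambda>w. D (w, 0))) (at x)"
    and has_derivative_slice_snd: "((\<lambda>y. f (x, y)) has_derivative (\<lambda>w. D (0, w))) (at y)"
proof -
  have slices: "((\<lambda>x. (x, y)) has_derivative (\<lambda>w. (w, 0))) (at x)"
    "((\<lambda>y. (x, y)) has_derivative (\<lambda>w. (0, w))) (at y)"
    by (auto intro!: derivative_eq_intros)
  show "((\<lambda>x. f (x, y)) has_derivative (\<lambda>w. D (w, 0))) (at x)"
    by (rule has_derivative_compose[OF slices(1) assms])
  show "((\<lambda>y. f (x, y)) has_derivative (\<lambda>w. D (0, w))) (at y)"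
    by (rule has_derivative_compose[OF slices(2) assms])
qed

lemma Ck_on_Suc_has_derivative:
  assumes "Ck_on (Suc k) f S" "open S" "x \<in> S"
  shows "(f has_derivative blinfun_apply (blinfun_derivative f x)) (at x)"
  using assms by (intro has_derivative_blinfun_derivative) (simp add: differentiable_on_eq_differentiable_at)

text \<open>On an open set a derivative depends only on the values there; this carries a computed
  derivative over to \<open>frechet_derivative\<close>, in which \<open>Ck_on\<close> is
  phrased.\<close>

lemma Ck_on_cong:
  assumes "open S" "\<And>x. x \<in> S \<Longrightarrow> f x = g x" "Ck_on k f S"
  shows "Ck_on k g S"
  using assms(2,3)
proof (induction k arbitrary: f g)
  case 0
  then show ?case
    by (simp cong: continuous_on_cong)
next
  case (Suc k)
  have der: "(g has_derivative blinfun_apply (blinfun_derivative f x)) (at x)" if "x \<in> S" for x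
    using has_derivative_transform_within_open[OF Ck_on_Suc_has_derivative[OF Suc.prems(2) assms(1) that]
        assms(1) that] Suc.prems(1) by auto
  have eq: "frechet_derivative f (at x) b = frechet_derivative g (at x) b" if "x \<in> S" for x b
    using frechet_derivative_eq[OF der[OF that]]
      frechet_derivative_eq[OF Ck_on_Suc_has_derivative[OF Suc.prems(2) assms(1) that]] by simp
  have "g differentiable_on S"
    using der assms(1) by (auto simp: differentiable_on_eq_differentiable_at differentiable_def)
  moreover have "Ck_on k (\<lambda>x. frechet_derivative g (at x) b) S" if "b \<in> Basis" for b
  proof (rule Suc.IH)
    show "Ck_on k (\<lambda>x. frechet_derivative f (at x) b) S"
      using Suc.prems(2) that by simp
  qed (rule eq)
  ultimately show ?case
    by simp
qed

lemma Ck_on_SucI: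
  assumes "open S" "\<And>x. x \<in> S \<Longrightarrow> (f has_derivative f' x) (at x)"
    "\<And>b. b \<in> Basis \<Longrightarrow> Ck_on k (\<lambda>x. f' x b) S"
  shows "Ck_on (Suc k) f S"
proof -
  have "Ck_on k (\<lambda>x. frechet_derivative f (at x) b) S" if "b \<in> Basis" for b
    using assms(2) frechet_derivative_eq
    by (intro Ck_on_cong[OF assms(1) _ assms(3)[OF that]]) fastforce
  moreover have "f differentiable_on S"
    using assms(1,2) by (auto simp: differentiable_on_eq_differentiable_at differentiable_def)
  ultimately show ?thesis
    by simp
qed

lemma Ck_on_Suc_frechet_derivative:
  assumes "Ck_on (Suc k) f S" "b \<in> Basis" "open S"
  shows "Ck_on k (\<lambda>x. blinfun_apply (blinfun_derivative f x) b) S"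
proof (rule Ck_on_cong[OF assms(3)])
  show "frechet_derivative f (at x) b = blinfun_apply (blinfun_derivative f x) b" if "x \<in> S" for x
    using frechet_derivative_eq[OF Ck_on_Suc_has_derivative[OF assms(1,3) that]] by simp
qed (use assms in simp)

lemma Ck_on_SucD: "Ck_on (Suc k) f S \<Longrightarrow> Ck_on k f S"
  by (induction k arbitrary: f) (auto intro: differentiable_imp_continuous_on)

lemma Ck_on_mono: "Ck_on k f S \<Longrightarrow> j \<le> k \<Longrightarrow> Ck_on j f S"
proof (induction k)
  case (Suc k)
  then show ?case by (metis Ck_on_SucD le_SucE)
qed simp

lemma Ck_on_imp_continuous_on: "Ck_on k f S \<Longrightarrow> continuous_on S f"
  using Ck_on_mono[of k f S 0] by simp

lemma Ck_on_const [simp]: "open S \<Longrightarrow> Ck_on k (\<lambda>x. c) S"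
proof (induction k arbitrary: c)
  case (Suc k)
  then show ?case by (intro Ck_on_SucI[where f'="\<lambda>x v. 0"]) auto
qed simp

lemma Ck_on_bounded_linear:
  assumes "bounded_linear L" "open S" "Ck_on k f S"
  shows "Ck_on k (\<lambda>x. L (f x)) S"
  using assms(3)
proof (induction k arbitrary: f)
  case 0
  then show ?case
    using bounded_linear.continuous_on[OF assms(1)] by simp
next
  case (Suc k)
  show ?case
    using Suc.IH[OF Ck_on_Suc_frechet_derivative[OF Suc.prems _ assms(2)]] assms
    by (intro Ck_on_SucI[where f'="\<lambda>x v. L (blinfun_apply (blinfun_derivative f x) v)"])
      (auto intro: bounded_linear.has_derivative[OF assms(1)] Ck_on_Suc_has_derivative[OF Suc.prems])
qed

lemma Ck_on_add:
  assumes "open S" "Ck_on k f S" "Ck_on k g S"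
  shows "Ck_on k (\<lambda>x. f x + g x) S"
  using assms(2,3)
proof (induction k arbitrary: f g)
  case 0
  then show ?case by (simp add: continuous_on_add)
next
  case (Suc k)
  show ?case
    using Suc.IH[OF Ck_on_Suc_frechet_derivative[OF Suc.prems(1) _ assms(1)]
        Ck_on_Suc_frechet_derivative[OF Suc.prems(2) _ assms(1)]] assms
    by (intro Ck_on_SucI[where f'="\<lambda>x v. blinfun_apply (blinfun_derivative f x) v
          + blinfun_apply (blinfun_derivative g x) v"])
      (auto intro: has_derivative_add Ck_on_Suc_has_derivative[OF Suc.prems(1)]
        Ck_on_Suc_has_derivative[OF Suc.prems(2)])
qed

lemma Ck_on_sum:
  assumes "open S" "\<And>i. i \<in> I \<Longrightarrow> Ck_on k (f i) S"
  shows "Ck_on k (\<lambda>x. \<Sum>i\<in>I. f i x) S"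
  using assms by (induction I rule: infinite_finite_induct) (auto intro!: Ck_on_add)

lemma Ck_on_bilinear:
  assumes "bounded_bilinear B" "open S" "Ck_on k f S" "Ck_on k g S"
  shows "Ck_on k (\<lambda>x. B (f x) (g x)) S"
  using assms(3,4)
proof (induction k arbitrary: f g)
  case 0
  then show ?case
    using bounded_bilinear.continuous_on[OF assms(1)] by simp
next
  case (Suc k)
  have "Ck_on k (\<lambda>x. B (f x) (blinfun_apply (blinfun_derivative g x) b)
      + B (blinfun_apply (blinfun_derivative f x) b) (g x)) S" if "b \<in> Basis" for b
    using Suc.prems[THEN Ck_on_SucD] Suc.prems that assms(2)
    by (intro Ck_on_add Suc.IH Ck_on_Suc_frechet_derivative) auto
  then show ?case
    using assms
    by (intro Ck_on_SucI[where f'="\<lambda>x v. B (f x) (blinfun_apply (blinfun_derivative g x) v)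
        + B (blinfun_apply (blinfun_derivative f x) v) (g x)"])
      (auto intro: bounded_bilinear.FDERIV[OF assms(1)] Ck_on_Suc_has_derivative[OF Suc.prems(1)]
        Ck_on_Suc_has_derivative[OF Suc.prems(2)])
qed

lemma Ck_on_diff:
  assumes "open S" "Ck_on k f S" "Ck_on k g S"
  shows "Ck_on k (\<lambda>x. f x - g x) S"
  using Ck_on_add[OF assms(1,2) Ck_on_bounded_linear[OF bounded_linear_minus[OF bounded_linear_ident] assms(1,3)]]
  by simp

lemma Ck_on_prod:
  fixes f :: "'i \<Rightarrow> 'a::euclidean_space \<Rightarrow> real"
  assumes "open S" "\<And>i. i \<in> I \<Longrightarrow> Ck_on k (f i) S"
  shows "Ck_on k (\<lambda>x. \<Prod>i\<in>I. f i x) S"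
  using assms
  by (induction I rule: infinite_finite_induct) (auto intro!: Ck_on_bilinear[OF bounded_bilinear_mult])

lemma Ck_on_inverse:
  fixes f :: "'a::euclidean_space \<Rightarrow> real"
  assumes "open S" "Ck_on k f S" "\<And>x. x \<in> S \<Longrightarrow> f x \<noteq> 0"
  shows "Ck_on k (\<lambda>x. inverse (f x)) S"
  using assms(2)
proof (induction k)
  case 0
  then show ?case
    using assms(3) by (auto intro!: continuous_intros)
next
  case (Suc k)
  have IH: "Ck_on k (\<lambda>x. inverse (f x)) S"
    using Suc Ck_on_SucD by blast
  have "Ck_on k (\<lambda>x. - (inverse (f x) * blinfun_apply (blinfun_derivative f x) b * inverse (f x))) S"
    if "b \<in> Basis" for b
    by (intro Ck_on_bounded_linear[OF bounded_linear_minus[OF bounded_linear_ident]]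
        Ck_on_bilinear[OF bounded_bilinear_mult] IH assms(1)
        Ck_on_Suc_frechet_derivative[OF Suc.prems that])
  then show ?case
    using assms(1,3)
    by (intro Ck_on_SucI[where f'="\<lambda>x v. - (inverse (f x) * blinfun_apply (blinfun_derivative f x) v * inverse (f x))"])
      (auto intro!: Deriv.has_derivative_inverse Ck_on_Suc_has_derivative[OF Suc.prems])
qed

section \<open>Maps with values in operators and matrices\<close>

lemma blinfun_basis_expansion:
  fixes L :: "'a::euclidean_space \<Rightarrow>\<^sub>L 'b::real_normed_vector"
  shows "L = (\<Sum>b\<in>Basis. blinfun_scaleR_left (blinfun_apply L b) o\<^sub>L blinfun_inner_left b)"
proof (rule blinfun_eqI)
  fix v
  have "L v = L (\<Sum>b\<in>Basis. (v \<bullet> b) *\<^sub>R b)"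
    by (simp add: euclidean_representation)
  also have "\<dots> = (\<Sum>b\<in>Basis. (v \<bullet> b) *\<^sub>R L b)"
    by (simp add: blinfun.bilinear_simps)
  finally show "L v = blinfun_apply (\<Sum>b\<in>Basis. blinfun_scaleR_left (L b) o\<^sub>L blinfun_inner_left b) v"
    by (simp add: blinfun.bilinear_simps)
qed

text \<open>In finite dimension an operator is a finite combination built from its values on a
  basis, so regularity can be tested vector by vector.\<close>

lemma Ck_on_blinfunI:
  fixes L :: "'c::euclidean_space \<Rightarrow> 'a::euclidean_space \<Rightarrow>\<^sub>L 'b::real_normed_vector"
  assumes "open S" "\<And>b. b \<in> Basis \<Longrightarrow> Ck_on k (\<lambda>x. blinfun_apply (L x) b) S"
  shows "Ck_on k L S"
proof -
  have "Ck_on k (\<lambda>x. \<Sum>b\<in>Basis. blinfun_scaleR_left (blinfun_apply (L x) b) o\<^sub>L blinfun_inner_left b) S"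
    using assms by (intro Ck_on_sum Ck_on_bilinear[OF bounded_bilinear_blinfun_compose] Ck_on_const
        Ck_on_bounded_linear[OF bounded_linear_blinfun_scaleR_left]) auto
  then show ?thesis
    by (rule Ck_on_cong[rotated 2]) (use assms(1) in \<open>auto simp flip: blinfun_basis_expansion\<close>)
qed

text \<open>The bundled derivative is again a map into a normed space, so higher derivatives are
  obtained by iterating \<open>blinfun_derivative\<close>.\<close>

lemma Ck_on_blinfun_derivative:
  "open S \<Longrightarrow> Ck_on (Suc k) f S \<Longrightarrow> Ck_on k (blinfun_derivative f) S"
  by (intro Ck_on_blinfunI Ck_on_Suc_frechet_derivative)

lemma Ck_on_blinfun_apply:
  "open S \<Longrightarrow> Ck_on k L S \<Longrightarrow> Ck_on k f S \<Longrightarrow> Ck_on k (\<lambda>x. blinfun_apply (L x) (f x)) S"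
  by (rule Ck_on_bilinear[OF bounded_bilinear_blinfun_apply])

lemma Ck_on_vecI:
  fixes f :: "'a::euclidean_space \<Rightarrow> 'b::euclidean_space ^ 'n::finite"
  assumes "open S" "\<And>i. Ck_on k (\<lambda>x. f x $ i) S"
  shows "Ck_on k f S"
proof -
  have lin: "bounded_linear (axis i :: 'b \<Rightarrow> 'b ^ 'n)" for i
    by (intro linear_conv_bounded_linear[THEN iffD1] linearI) (auto simp: axis_def vec_eq_iff)
  have "Ck_on k (\<lambda>x. \<Sum>i\<in>UNIV. axis i (f x $ i)) S"
    using assms by (intro Ck_on_sum Ck_on_bounded_linear[OF lin])
  moreover have "(\<Sum>i\<in>UNIV. axis i (f x $ i)) = f x" for x
    by (simp add: vec_eq_iff axis_def if_distrib cong: if_cong)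
  ultimately show ?thesis by simp
qed

lemma Ck_on_vec_nth:
  fixes f :: "'a::euclidean_space \<Rightarrow> 'b::euclidean_space ^ 'n::finite"
  shows "open S \<Longrightarrow> Ck_on k f S \<Longrightarrow> Ck_on k (\<lambda>x. f x $ i) S"
  by (rule Ck_on_bounded_linear[OF bounded_linear_vec_nth])

lemma Ck_on_det:
  fixes M :: "'a::euclidean_space \<Rightarrow> real ^ 'n ^ 'n::finite"
  assumes "open S" "\<And>i j. Ck_on k (\<lambda>x. M x $ i $ j) S"
  shows "Ck_on k (\<lambda>x. det (M x)) S"
  unfolding det_def using assms
  by (intro Ck_on_sum Ck_on_bilinear[OF bounded_bilinear_mult] Ck_on_prod) auto

lemma
  fixes M :: "'a::semiring_1 ^ 'n ^ 'm"
  assumes "invertible M"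
  shows matrix_inv_right: "M ** matrix_inv M = mat 1"
    and matrix_inv_left: "matrix_inv M ** M = mat 1"
  using someI_ex[OF assms[unfolded invertible_def]] by (simp_all add: matrix_inv_def)

text \<open>Cramer's rule writes the entries of the inverse as quotients of determinants.\<close>

lemma Ck_on_matrix_inv:
  fixes M :: "'a::euclidean_space \<Rightarrow> real ^ 'n ^ 'n::finite"
  assumes "open S" "Ck_on k M S" "\<And>x. x \<in> S \<Longrightarrow> invertible (M x)"
  shows "Ck_on k (\<lambda>x. matrix_inv (M x)) S"
proof (intro Ck_on_vecI assms(1))
  fix i j
  have M: "Ck_on k (\<lambda>x. M x $ a $ b) S" for a b
    using assms by (intro Ck_on_vec_nth)
  have "Ck_on k (\<lambda>x. if b = i then axis j 1 $ a else M x $ a $ b) S" for a b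
    using M assms(1) by (cases "b = i") auto
  then have "Ck_on k (\<lambda>x. inverse (det (M x)) * det (\<chi> a b. if b = i then axis j 1 $ a else M x $ a $ b)) S"
    using assms M
    by (intro Ck_on_bilinear[OF bounded_bilinear_mult] Ck_on_inverse Ck_on_det)
      (simp_all flip: invertible_det_nz)
  then show "Ck_on k (\<lambda>x. matrix_inv (M x) $ i $ j) S"
  proof (rule Ck_on_cong[rotated 2])
    fix x assume x: "x \<in> S"
    have "M x *v (matrix_inv (M x) *v axis j 1) = axis j 1"
      using assms(3)[OF x] by (simp add: matrix_vector_mul_assoc matrix_inv_right)
    then have "matrix_inv (M x) *v axis j 1
        = (\<chi> k. det (\<chi> a b. if b = k then axis j 1 $ a else M x $ a $ b) / det (M x))"
      using cramer assms(3)[OF x] invertible_det_nz by blast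
    then have "(matrix_inv (M x) *v axis j 1) $ i
        = det (\<chi> a b. if b = i then axis j 1 $ a else M x $ a $ b) / det (M x)"
      by simp
    then show "inverse (det (M x)) * det (\<chi> a b. if b = i then axis j 1 $ a else M x $ a $ b)
        = matrix_inv (M x) $ i $ j"
      by (simp add: matrix_vector_mul_component axis_def inner_axis row_def field_simps
          matrix_vector_mult_def sum.delta if_distrib cong: if_cong)
  qed (rule assms(1))
qed

text \<open>The mean value inequality in the direction u, applied to the difference in the direction
  v after its expected linear part has been subtracted. Differentiability of \<open>f'\<close> at
  the single point x makes the derivative of what is left small.\<close>

lemma second_difference_bound:
  fixes f :: "'a::euclidean_space \<Rightarrow> 'b::real_normed_vector"
  assumes "open S" "x \<in> S" "\<And>z. z \<in> S \<Longrightarrow> (f has_derivative blinfun_apply (f' z)) (at z)"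
    and "(f' has_derivative f'') (at x)" "e > 0"
  shows "\<exists>d>0. \<forall>t. 0 < t \<and> t < d \<longrightarrow>
    norm (f (x + t *\<^sub>R u + t *\<^sub>R v) - f (x + t *\<^sub>R u) - f (x + t *\<^sub>R v) + f x - t\<^sup>2 *\<^sub>R blinfun_apply (f'' v) u)
      \<le> e * t\<^sup>2"
proof -
  \<comment> \<open>Two remainders of size (e / K) t (|u| + |v|), multiplied by |u|, must sum to at
    most e t; the added ones keep K positive.\<close>
  define K where "K = (2 * (norm u + norm v) + 1) * (norm u + 1)"
  have K: "K > 0"
    by (auto simp: K_def intro!: mult_pos_pos add_nonneg_pos)
  obtain d1 where d1: "d1 > 0" "ball x d1 \<subseteq> S"
    using assms(1,2) open_contains_ball by blast
  obtain d2 where d2: "d2 > 0"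
    "\<And>z. norm (z - x) < d2 \<Longrightarrow> norm (f' z - f' x - f'' (z - x)) \<le> (e / K) * norm (z - x)"
    using assms(4) \<open>e > 0\<close> K unfolding has_derivative_at_alt by (meson divide_pos_pos)
  interpret f'': bounded_linear f''
    using assms(4) by (rule has_derivative_bounded_linear)
  define d where "d = min d1 d2 / (norm u + norm v + 1)"
  have nuv: "norm u + norm v + 1 > 0"
    by (simp add: add_nonneg_pos)
  show ?thesis
  proof (intro exI[of _ d] conjI allI impI)
    show "d > 0"
      using d1 d2 nuv by (simp add: d_def)
    fix t :: real assume t: "0 < t \<and> t < d"
    have small: "norm (s *\<^sub>R u + r *\<^sub>R v) \<le> t * (norm u + norm v)" "norm (s *\<^sub>R u + r *\<^sub>R v) < min d1 d2"
      if "0 \<le> s" "s \<le> t" "0 \<le> r" "r \<le> t" for s r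
    proof -
      have "norm (s *\<^sub>R u + r *\<^sub>R v) \<le> s * norm u + r * norm v"
        using norm_triangle_ineq[of "s *\<^sub>R u" "r *\<^sub>R v"] that by simp
      also have "\<dots> \<le> t * (norm u + norm v)"
        using that by (simp add: distrib_left add_mono mult_right_mono)
      finally show 1: "norm (s *\<^sub>R u + r *\<^sub>R v) \<le> t * (norm u + norm v)" .
      also have "\<dots> < t * (norm u + norm v + 1)"
        using t by simp
      also have "\<dots> < min d1 d2"
        using t nuv by (simp add: d_def pos_less_divide_eq)
      finally show "norm (s *\<^sub>R u + r *\<^sub>R v) < min d1 d2" .
    qed
    define g where "g s = f (x + s *\<^sub>R u + t *\<^sub>R v) - f (x + s *\<^sub>R u) - (s * t) *\<^sub>R blinfun_apply (f'' v) u" for s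
    have inS: "x + s *\<^sub>R u + r *\<^sub>R v \<in> S" if "0 \<le> s" "s \<le> t" "0 \<le> r" "r \<le> t" for s r
      using small(2)[OF that] d1(2) by (auto simp: dist_norm norm_minus_commute add.assoc subset_eq
          norm_minus_cancel[of "s *\<^sub>R u + r *\<^sub>R v", symmetric])
    have g': "(g has_derivative (\<lambda>h. h *\<^sub>R (f' (x + s *\<^sub>R u + t *\<^sub>R v) u - f' (x + s *\<^sub>R u) u - t *\<^sub>R f'' v u)))
        (at s within {0..t})" if "s \<in> {0..t}" for s
    proof -
      have 1: "((\<lambda>s. f (x + s *\<^sub>R u + t *\<^sub>R v)) has_derivative (\<lambda>h. f' (x + s *\<^sub>R u + t *\<^sub>R v) (h *\<^sub>R u)))
          (at s within {0..t})"
        using inS[of s t] that t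
        by (intro has_derivative_compose[OF _ assms(3)]) (auto intro!: derivative_eq_intros)
      have 2: "((\<lambda>s. f (x + s *\<^sub>R u)) has_derivative (\<lambda>h. f' (x + s *\<^sub>R u) (h *\<^sub>R u)))
          (at s within {0..t})"
        using inS[of s 0] that t
        by (intro has_derivative_compose[OF _ assms(3)]) (auto intro!: derivative_eq_intros)
      show ?thesis
        unfolding g_def
        by (rule derivative_eq_intros 1 2 refl)+
          (auto simp: blinfun.bilinear_simps scaleR_right_diff_distrib mult.commute)
    qed
    have bound: "onorm (\<lambda>h. h *\<^sub>R (f' (x + s *\<^sub>R u + t *\<^sub>R v) u - f' (x + s *\<^sub>R u) u - t *\<^sub>R f'' v u)) \<le> e * t"
      if "s \<in> {0..t}" for s
    proof -
      define z1 where "z1 = s *\<^sub>R u + t *\<^sub>R v"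
      define z2 where "z2 = s *\<^sub>R u + 0 *\<^sub>R v"
      have n1: "norm (f' (x + z1) - f' x - f'' z1) \<le> (e / K) * (t * (norm u + norm v))"
      proof (rule order_trans)
        show "norm (f' (x + z1) - f' x - f'' z1) \<le> (e / K) * norm z1"
          using d2(2)[of "x + z1"] small(2)[of s t] that t by (simp add: z1_def)
      qed (use small(1)[of s t] that t \<open>e > 0\<close> K in \<open>auto simp: z1_def intro!: mult_left_mono divide_right_mono\<close>)
      have n2: "norm (f' (x + z2) - f' x - f'' z2) \<le> (e / K) * (t * (norm u + norm v))"
      proof (rule order_trans)
        show "norm (f' (x + z2) - f' x - f'' z2) \<le> (e / K) * norm z2"
          using d2(2)[of "x + z2"] small(2)[of s 0] that t by (simp add: z2_def)
      qed (use small(1)[of s 0] that t \<open>e > 0\<close> K in \<open>auto simp: z2_def intro!: mult_left_mono divide_right_mono\<close>)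
      have "f' (x + s *\<^sub>R u + t *\<^sub>R v) u - f' (x + s *\<^sub>R u) u - t *\<^sub>R f'' v u
          = ((f' (x + z1) - f' x - f'' z1) - (f' (x + z2) - f' x - f'' z2)) u"
        by (simp add: z1_def z2_def blinfun.bilinear_simps f''.add f''.scaleR algebra_simps)
      also have "norm \<dots> \<le> (norm (f' (x + z1) - f' x - f'' z1) + norm (f' (x + z2) - f' x - f'' z2)) * norm u"
        by (rule order_trans[OF norm_blinfun]) (intro mult_right_mono norm_triangle_ineq4 norm_ge_zero)
      also have "\<dots> \<le> (e / K) * (t * (2 * (norm u + norm v))) * norm u"
      proof (rule mult_right_mono)
        show "norm (f' (x + z1) - f' x - f'' z1) + norm (f' (x + z2) - f' x - f'' z2)
            \<le> (e / K) * (t * (2 * (norm u + norm v)))"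
          using add_mono[OF n1 n2] by (simp only: mult_2 distrib_left)
      qed simp
      also have "\<dots> = e * t * (2 * (norm u + norm v) * norm u / K)"
        by (simp add: field_simps)
      also have "\<dots> \<le> e * t * 1"
      proof (intro mult_left_mono)
        have "2 * (norm u + norm v) * norm u \<le> K"
          unfolding K_def by (intro mult_mono) auto
        then show "2 * (norm u + norm v) * norm u / K \<le> 1"
          using K by (simp add: divide_le_eq)
      qed (use t \<open>e > 0\<close> in auto)
      finally have *: "norm (f' (x + s *\<^sub>R u + t *\<^sub>R v) u - f' (x + s *\<^sub>R u) u - t *\<^sub>R f'' v u) \<le> e * t"
        by simp
      show ?thesis
        using * t \<open>e > 0\<close> by (intro onorm_bound) (auto simp: mult.commute mult_left_mono)
    qed
    have "norm (g t - g 0) \<le> e * t * norm (t - 0)"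
      using t by (intro differentiable_bound[OF _ g' bound]) auto
    then show "norm (f (x + t *\<^sub>R u + t *\<^sub>R v) - f (x + t *\<^sub>R u) - f (x + t *\<^sub>R v) + f x
        - t\<^sup>2 *\<^sub>R blinfun_apply (f'' v) u) \<le> e * t\<^sup>2"
      using t by (simp add: g_def power2_eq_square algebra_simps)
  qed
qed

text \<open>The second difference is symmetric in u and v, so both mixed values are approximated by
  the same quantity.\<close>

lemma second_derivative_symmetric:
  fixes f :: "'a::euclidean_space \<Rightarrow> 'b::real_normed_vector"
  assumes "open S" "x \<in> S" "\<And>z. z \<in> S \<Longrightarrow> (f has_derivative blinfun_apply (f' z)) (at z)"
    and "(f' has_derivative f'') (at x)"
  shows "blinfun_apply (f'' v) u = blinfun_apply (f'' u) v"
proof (rule ccontr)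
  assume "f'' v u \<noteq> f'' u v"
  \<comment> \<open>A third of the gap: the two errors add up to 2 e, while the gap is 3 e.\<close>
  define e where "e = norm (f'' v u - f'' u v) / 3"
  have e: "e > 0"
    using \<open>f'' v u \<noteq> f'' u v\<close> by (simp add: e_def)
  obtain d1 where d1: "d1 > 0" "\<And>t. 0 < t \<Longrightarrow> t < d1 \<Longrightarrow>
     norm (f (x + t *\<^sub>R u + t *\<^sub>R v) - f (x + t *\<^sub>R u) - f (x + t *\<^sub>R v) + f x - t\<^sup>2 *\<^sub>R f'' v u) \<le> e * t\<^sup>2"
    using second_difference_bound[OF assms e, of u v] by blast
  obtain d2 where d2: "d2 > 0" "\<And>t. 0 < t \<Longrightarrow> t < d2 \<Longrightarrow>
     norm (f (x + t *\<^sub>R v + t *\<^sub>R u) - f (x + t *\<^sub>R v) - f (x + t *\<^sub>R u) + f x - t\<^sup>2 *\<^sub>R f'' u v) \<le> e * t\<^sup>2"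
    using second_difference_bound[OF assms e, of v u] by blast
  define t where "t = min d1 d2 / 2"
  have t: "0 < t" "t < d1" "t < d2"
    using d1(1) d2(1) by (auto simp: t_def)
  define X where "X = f (x + t *\<^sub>R u + t *\<^sub>R v) - f (x + t *\<^sub>R u) - f (x + t *\<^sub>R v) + f x"
  have 1: "norm (X - t\<^sup>2 *\<^sub>R f'' v u) \<le> e * t\<^sup>2"
    using d1(2) t by (simp add: X_def)
  have 2: "norm (X - t\<^sup>2 *\<^sub>R f'' u v) \<le> e * t\<^sup>2"
  proof -
    have "X = f (x + t *\<^sub>R v + t *\<^sub>R u) - f (x + t *\<^sub>R v) - f (x + t *\<^sub>R u) + f x"
      unfolding X_def by (simp add: add.assoc add.commute[of "t *\<^sub>R v"] algebra_simps)
    then show ?thesis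
      using d2(2) t by simp
  qed
  have "norm (t\<^sup>2 *\<^sub>R (f'' v u - f'' u v)) = norm ((X - t\<^sup>2 *\<^sub>R f'' u v) - (X - t\<^sup>2 *\<^sub>R f'' v u))"
    by (simp add: scaleR_right_diff_distrib)
  also have "\<dots> \<le> e * t\<^sup>2 + e * t\<^sup>2"
    using norm_triangle_ineq4 1 2 by (smt (verit))
  finally have "t\<^sup>2 * norm (f'' v u - f'' u v) \<le> t\<^sup>2 * (2 * e)"
    by (simp add: mult.commute mult.left_commute flip: scaleR_right_diff_distrib)
  then have "norm (f'' v u - f'' u v) \<le> 2 * e"
    using t by simp
  then show False
    using e by (simp add: e_def)
qed

lemma blinfun_derivative_symmetric:
  assumes "open S" "x \<in> S" "Ck_on 2 f S"
  shows "blinfun_derivative (blinfun_derivative f) x u v = blinfun_derivative (blinfun_derivative f) x v u"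
proof (rule second_derivative_symmetric[OF assms(1,2)])
  have C: "Ck_on (Suc (Suc 0)) f S"
    using assms(3) by (simp add: numeral_2_eq_2)
  show "(f has_derivative blinfun_apply (blinfun_derivative f z)) (at z)" if "z \<in> S" for z
    using Ck_on_Suc_has_derivative[OF C assms(1) that] .
  show "(blinfun_derivative f has_derivative blinfun_apply (blinfun_derivative (blinfun_derivative f) x)) (at x)"
    using Ck_on_Suc_has_derivative[OF Ck_on_blinfun_derivative[OF assms(1) C] assms(1,2)] .
qed

section \<open>Traces and covariant differentiation on the tangent bundle\<close>

text \<open>Taken for arbitrary maps, so that it is additive and homogeneous without side
  conditions; on linear maps it is the usual trace.\<close>

definition tr :: "(real ^ 'n \<Rightarrow> real ^ 'n) \<Rightarrow> real" where
  "tr f = (\<Sum>i\<in>UNIV. f (axis i 1) $ i)"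

lemma vec_expansion: "(v :: real ^ 'n) = (\<Sum>i\<in>UNIV. v $ i *\<^sub>R axis i 1)"
  using basis_expansion[of v] by (simp add: scalar_mult_eq_scaleR)

lemma linear_vec_expansion:
  fixes f :: "real ^ 'n \<Rightarrow> 'b::real_vector"
  assumes "linear f"
  shows "(\<Sum>i\<in>UNIV. v $ i *\<^sub>R f (axis i 1)) = f v"
  by (subst (2) vec_expansion) (simp add: linear_sum[OF assms] linear_cmul[OF assms])

lemma linear_eq_on_axis:
  fixes f g :: "real ^ 'n \<Rightarrow> 'b::real_vector"
  assumes "linear f" "linear g" "\<And>i. f (axis i 1) = g (axis i 1)"
  shows "f v = g v"
  using linear_vec_expansion[OF assms(1), of v] linear_vec_expansion[OF assms(2), of v] assms(3) by simp

lemma linear_blinfun [simp]: "linear (blinfun_apply L)"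
  using blinfun.bounded_linear_right bounded_linear.linear by blast

lemma tr_add: "tr (\<lambda>v. f v + g v) = tr f + tr g"
  and tr_diff: "tr (\<lambda>v. f v - g v) = tr f - tr g"
  and tr_minus: "tr (\<lambda>v. - f v) = - tr f"
  and tr_scaleR: "tr (\<lambda>v. c *\<^sub>R f v) = c * tr f"
  and tr_zero: "tr (\<lambda>v. 0) = 0"
  by (simp_all add: tr_def sum.distrib sum_subtractf sum_distrib_left sum_negf)

lemmas tr_simps = tr_add tr_diff tr_minus tr_scaleR tr_zero

lemma tr_id: "tr (\<lambda>v :: real ^ 'n. v) = real CARD('n)"
  by (simp add: tr_def)

lemma tr_rank1:
  assumes "linear f"
  shows "tr (\<lambda>v. f v *\<^sub>R p) = f p"
  using linear_vec_expansion[OF assms, of p] by (simp add: tr_def mult.commute)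

lemma tr_commute:
  fixes f g :: "real ^ 'n \<Rightarrow> real ^ 'n"
  assumes "linear f" "linear g"
  shows "tr (\<lambda>v. f (g v)) = tr (\<lambda>v. g (f v))"
proof -
  have *: "tr (\<lambda>v. f (g v)) = (\<Sum>i\<in>UNIV. \<Sum>j\<in>UNIV. g (axis i 1) $ j * f (axis j 1) $ i)"
    if "linear f" for f g :: "real ^ 'n \<Rightarrow> real ^ 'n"
  proof -
    have "f z $ i = (\<Sum>j\<in>UNIV. z $ j * f (axis j 1) $ i)" for z i
      using arg_cong[OF linear_vec_expansion[OF that, of z], of "\<lambda>v. v $ i"] by simp
    from this[of "g (axis i 1)" i for i] show ?thesis
      by (simp only: tr_def)
  qed
  show ?thesis
    unfolding *[OF assms(1)] *[OF assms(2)]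
    by (subst sum.swap) (simp add: mult.commute)
qed

text \<open>\<Gamma> is a parameter, pinned down as the Levi-Civita connection by
  \<open>\<Gamma>_sym\<close> (no torsion) and \<open>h_deriv\<close> (compatibility with h).
  Curried bounded bilinear maps take the place of indexed components. The second Bianchi identity
  uses two derivatives of \<Gamma>.\<close>

locale riemannian_chart =
  fixes U :: "(real ^ 'n::finite) set"
    and h :: "real ^ 'n \<Rightarrow> (real ^ 'n) \<Rightarrow>\<^sub>L (real ^ 'n) \<Rightarrow>\<^sub>L real"
    and \<Gamma> :: "real ^ 'n \<Rightarrow> (real ^ 'n) \<Rightarrow>\<^sub>L (real ^ 'n) \<Rightarrow>\<^sub>L (real ^ 'n)"
  assumes open_U: "open U"
    and h_sym: "x \<in> U \<Longrightarrow> h x u v = h x v u"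
    and h_pos: "x \<in> U \<Longrightarrow> v \<noteq> 0 \<Longrightarrow> h x v v > 0"
    and h_C2: "Ck_on 2 h U"
    and \<Gamma>_C2: "Ck_on 2 \<Gamma> U"
    and \<Gamma>_sym: "x \<in> U \<Longrightarrow> \<Gamma> x u v = \<Gamma> x v u"
    and h_deriv: "x \<in> U \<Longrightarrow> blinfun_derivative h x w u v = h x (\<Gamma> x w u) v + h x u (\<Gamma> x w v)"
begin

abbreviation "h1 \<equiv> blinfun_derivative h"
abbreviation "\<Gamma>1 \<equiv> blinfun_derivative \<Gamma>"

lemma h_has_derivative: "x \<in> U \<Longrightarrow> (h has_derivative blinfun_apply (h1 x)) (at x)"
  using Ck_on_Suc_has_derivative[of 1 h U] h_C2 open_U by (simp add: numeral_2_eq_2)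

lemma \<Gamma>_has_derivative: "x \<in> U \<Longrightarrow> (\<Gamma> has_derivative blinfun_apply (\<Gamma>1 x)) (at x)"
  using Ck_on_Suc_has_derivative[of 1 \<Gamma> U] \<Gamma>_C2 open_U by (simp add: numeral_2_eq_2)

lemma h_zeroD: "x \<in> U \<Longrightarrow> h x v v = 0 \<Longrightarrow> v = 0"
  using h_pos by fastforce

lemma h_nonneg: "x \<in> U \<Longrightarrow> h x v v \<ge> 0"
  using h_pos[of x v] by (cases "v = 0") (auto simp: blinfun.bilinear_simps)

lemma h_eqI:
  assumes "x \<in> U" "\<And>v. h x u v = h x w v"
  shows "u = w"
  using h_zeroD[OF assms(1), of "u - w"] assms(2) by (simp add: blinfun.bilinear_simps)

lemma h_riesz:
  fixes f :: "real ^ 'n \<Rightarrow> real"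
  assumes "x \<in> U" "linear f"
  shows "\<exists>!z. \<forall>v. h x z v = f v"
proof -
  define L where "L z = (\<chi> i. h x z (axis i 1))" for z
  have lin: "linear L"
    by (rule linearI) (auto simp: L_def vec_eq_iff blinfun.bilinear_simps)
  have L_eq: "h x z v = f v" if "L z = (\<chi> i. f (axis i 1))" for z v
    by (rule linear_eq_on_axis[OF linear_blinfun assms(2)]) (use that in \<open>auto simp: L_def vec_eq_iff\<close>)
  have "inj L"
  proof (rule linear_injective_0[OF lin, THEN iffD2, rule_format])
    fix z assume "L z = 0"
    then have "h x z v = 0" for v
      using linear_eq_on_axis[OF linear_blinfun linear_zero, of "h x z" v]
      by (simp add: L_def vec_eq_iff)
    then show "z = 0"
      using h_zeroD[OF assms(1)] by blast
  qed
  then have "surj L"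
    using lin linear_injective_imp_surjective by blast
  then obtain z where "L z = (\<chi> i. f (axis i 1))"
    by (metis surjD)
  then have "\<forall>v. h x z v = f v"
    using L_eq by blast
  then show ?thesis
    using h_eqI[OF assms(1)] by (metis (no_types, lifting))
qed

definition sharp :: "real ^ 'n \<Rightarrow> (real ^ 'n \<Rightarrow> real) \<Rightarrow> real ^ 'n" where
  "sharp x f = (THE z. \<forall>v. h x z v = f v)"

lemma h_sharp: "x \<in> U \<Longrightarrow> linear f \<Longrightarrow> h x (sharp x f) v = f v"
  using theI'[OF h_riesz] unfolding sharp_def by blast

text \<open>The i-th row of the inverse matrix of h. Pairing \<open>axis i 1\<close> with
  \<open>coax x i\<close> and summing over i is contraction with the inverse metric, without a
  choice of orthonormal frame.\<close>

definition coax :: "real ^ 'n \<Rightarrow> 'n \<Rightarrow> real ^ 'n" where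
  "coax x i = sharp x (\<lambda>v. v $ i)"

lemma h_coax: "x \<in> U \<Longrightarrow> h x (coax x i) v = v $ i"
  by (simp add: coax_def h_sharp linear_iff)

lemma coax_sym: "x \<in> U \<Longrightarrow> coax x i $ k = coax x k $ i"
  using h_coax h_sym by metis

lemma tr_coax: "x \<in> U \<Longrightarrow> tr f = (\<Sum>i\<in>UNIV. h x (coax x i) (f (axis i 1)))"
  by (simp add: tr_def h_coax)

text \<open>The inverse metric is symmetric, so the two slots of a contraction may be
  exchanged.\<close>

lemma contract_sym:
  fixes \<beta> :: "real ^ 'n \<Rightarrow> real ^ 'n \<Rightarrow> 'b::real_vector"
  assumes "x \<in> U" "\<And>u. linear (\<beta> u)" "\<And>v. linear (\<lambda>u. \<beta> u v)"
  shows "(\<Sum>i\<in>UNIV. \<beta> (coax x i) (axis i 1)) = (\<Sum>i\<in>UNIV. \<beta> (axis i 1) (coax x i))"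
proof -
  have "(\<Sum>i\<in>UNIV. \<beta> (coax x i) (axis i 1))
      = (\<Sum>i\<in>UNIV. \<Sum>k\<in>UNIV. coax x i $ k *\<^sub>R \<beta> (axis k 1) (axis i 1))"
    using linear_vec_expansion[OF assms(3)] by simp
  also have "\<dots> = (\<Sum>k\<in>UNIV. \<Sum>i\<in>UNIV. coax x k $ i *\<^sub>R \<beta> (axis k 1) (axis i 1))"
    by (subst sum.swap) (simp add: coax_sym[OF assms(1)])
  also have "\<dots> = (\<Sum>k\<in>UNIV. \<beta> (axis k 1) (coax x k))"
    using linear_vec_expansion[OF assms(2)] by simp
  finally show ?thesis .
qed

text \<open>Both traces are contractions of the same bilinear form with the inverse metric. With g =
  - f this makes the trace of a skew map vanish.\<close>

lemma tr_adjoint: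
  assumes "x \<in> U" "linear f" "linear g" "\<And>u v. h x (f u) v = h x u (g v)"
  shows "tr f = tr g"
proof -
  have "tr f = (\<Sum>i\<in>UNIV. h x (f (axis i 1)) (coax x i))"
    using assms(1) by (simp add: tr_coax h_sym)
  also have "\<dots> = (\<Sum>i\<in>UNIV. h x (axis i 1) (g (coax x i)))"
    by (simp add: assms(4))
  also have "\<dots> = (\<Sum>i\<in>UNIV. h x (coax x i) (g (axis i 1)))"
    by (rule contract_sym[OF assms(1), symmetric])
      (auto intro!: linearI simp: blinfun.bilinear_simps linear_add[OF assms(3)] linear_cmul[OF assms(3)])
  finally show ?thesis
    using assms(1) by (simp add: tr_coax)
qed

text \<open>A function on the tangent bundle is differentiated along \<open>(w, \<eta>)\<close>; in terms of \<open>w\<close> and the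
  vertical part \<open>\<eta> + \<Gamma>(w, y)\<close> of that direction no Christoffel symbols remain in the product rules.\<close>

definition cov_s :: "(real ^ 'n \<Rightarrow> real ^ 'n \<Rightarrow> real) \<Rightarrow> (real ^ 'n \<Rightarrow> real ^ 'n \<Rightarrow> real) \<Rightarrow>
    real ^ 'n \<Rightarrow> real ^ 'n \<Rightarrow> bool" where
  "cov_s f f' x y \<longleftrightarrow>
    ((\<lambda>p. f (fst p) (snd p)) has_derivative (\<lambda>q. f' (fst q) (snd q + \<Gamma> x (fst q) y))) (at (x, y))"

definition cov_v :: "(real ^ 'n \<Rightarrow> real ^ 'n \<Rightarrow> real ^ 'n) \<Rightarrow> (real ^ 'n \<Rightarrow> real ^ 'n \<Rightarrow> real ^ 'n) \<Rightarrow>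
    real ^ 'n \<Rightarrow> real ^ 'n \<Rightarrow> bool" where
  "cov_v Z Z' x y \<longleftrightarrow> ((\<lambda>p. Z (fst p) (snd p)) has_derivative
    (\<lambda>q. Z' (fst q) (snd q + \<Gamma> x (fst q) y) - \<Gamma> x (fst q) (Z x y))) (at (x, y))"

lemma cov_s_has_derivative_fst:
  assumes "cov_s f f' x y"
  shows "((\<lambda>x. f x y) has_derivative (\<lambda>w. f' w (\<Gamma> x w y))) (at x)"
  using has_derivative_slice_fst[OF assms[unfolded cov_s_def]] by simp

lemma cov_s_has_derivative_snd:
  assumes "cov_s f f' x y"
  shows "((\<lambda>y. f x y) has_derivative (\<lambda>e. f' 0 e)) (at y)"
  using has_derivative_slice_snd[OF assms[unfolded cov_s_def]] by simp

lemma cov_v_has_derivative_snd: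
  assumes "cov_v f f' x y"
  shows "((\<lambda>y. f x y) has_derivative (\<lambda>e. f' 0 e)) (at y)"
  using has_derivative_slice_snd[OF assms[unfolded cov_v_def]] by simp

lemma cov_v_has_derivative_fst:
  assumes "cov_v f f' x y"
  shows "((\<lambda>x. f x y) has_derivative (\<lambda>w. f' w (\<Gamma> x w y) - \<Gamma> x w (f x y))) (at x)"
  using has_derivative_slice_fst[OF assms[unfolded cov_v_def]] by simp

lemma dx_cov_s: "cov_s f f' x y \<Longrightarrow> dx i f x y = f' (axis i 1) (\<Gamma> x (axis i 1) y)"
  unfolding dx_def by (subst frechet_derivative_eq[OF cov_s_has_derivative_fst]) auto

lemma dy_cov_s: "cov_s f f' x y \<Longrightarrow> dy i f x y = f' 0 (axis i 1)"
  unfolding dy_def by (subst frechet_derivative_eq[OF cov_s_has_derivative_snd]) auto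

lemma cov_s_linear:
  assumes "cov_s f f' x y"
  shows "linear (\<lambda>q. f' (fst q) (snd q))"
proof -
  have "bounded_linear (\<lambda>q. f' (fst q) (snd q + \<Gamma> x (fst q) y))"
    using assms unfolding cov_s_def by (rule has_derivative_bounded_linear)
  then have "linear (\<lambda>q. f' (fst q) (snd q + \<Gamma> x (fst q) y))"
    by (rule bounded_linear.linear)
  moreover have "linear (\<lambda>q :: (real ^ 'n) \<times> (real ^ 'n). (fst q, snd q - \<Gamma> x (fst q) y))"
    by (rule linearI) (auto simp: blinfun.bilinear_simps algebra_simps)
  ultimately have "linear ((\<lambda>q. f' (fst q) (snd q + \<Gamma> x (fst q) y)) \<circ> (\<lambda>q. (fst q, snd q - \<Gamma> x (fst q) y)))"
    by (intro linear_compose)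
  then show ?thesis
    by (simp add: o_def)
qed

lemma cov_s_cong:
  assumes "cov_s f f' x y" "x \<in> U" "y \<noteq> 0"
    and "\<And>x y. x \<in> U \<Longrightarrow> y \<noteq> 0 \<Longrightarrow> f x y = g x y"
  shows "cov_s g f' x y"
  using assms(1) unfolding cov_s_def
proof (rule has_derivative_transform_within_open)
  show "open (U \<times> (- {0 :: real ^ 'n}))"
    using open_U by (intro open_Times) auto
  show "(x, y) \<in> U \<times> - {0}"
    using assms(2,3) by simp
  show "f (fst p) (snd p) = g (fst p) (snd p)" if "p \<in> U \<times> - {0}" for p
    using that by (cases p) (simp add: assms(4))
qed

lemma cov_v_cong:
  assumes "cov_v f f' x y" "x \<in> U" "y \<noteq> 0"
    and "\<And>x y. x \<in> U \<Longrightarrow> y \<noteq> 0 \<Longrightarrow> f x y = g x y"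
  shows "cov_v g f' x y"
  using assms(1) unfolding cov_v_def assms(4)[OF assms(2,3)]
proof (rule has_derivative_transform_within_open)
  show "open (U \<times> (- {0 :: real ^ 'n}))"
    using open_U by (intro open_Times) auto
  show "(x, y) \<in> U \<times> - {0}"
    using assms(2,3) by simp
  show "f (fst p) (snd p) = g (fst p) (snd p)" if "p \<in> U \<times> - {0}" for p
    using that by (cases p) (simp add: assms(4))
qed

lemma cov_s_eq_rhs:
  assumes "cov_s f f' x y" "\<And>w e. f' w e = g' w e"
  shows "cov_s f g' x y"
  using assms by (simp add: cov_s_def)

lemma cov_v_eq_rhs:
  assumes "cov_v f f' x y" "\<And>w e. f' w e = g' w e"
  shows "cov_v f g' x y"
  using assms by (simp add: cov_v_def)

named_theorems cov_intros

lemma cov_v_y [cov_intros]: "cov_v (\<lambda>x y. y) (\<lambda>w e. e) x y"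
  unfolding cov_v_def by (auto intro!: derivative_eq_intros)

lemma cov_v_const [cov_intros]: "cov_v (\<lambda>x y. c) (\<lambda>w e. \<Gamma> x w c) x y"
  unfolding cov_v_def by (auto intro!: derivative_eq_intros)

lemma cov_s_const [cov_intros]: "cov_s (\<lambda>x y. c) (\<lambda>w e. 0) x y"
  unfolding cov_s_def by (auto intro!: derivative_eq_intros)

text \<open>The Christoffel terms of \<open>h_deriv\<close> cancel those subtracted in
  \<open>cov_v\<close>; this is where compatibility of the connection with h pays off.\<close>

lemma cov_s_h [cov_intros]:
  assumes "x \<in> U" "cov_v Y Y' x y" "cov_v Z Z' x y"
  shows "cov_s (\<lambda>x y. h x (Y x y) (Z x y)) (\<lambda>w e. h x (Y' w e) (Z x y) + h x (Y x y) (Z' w e)) x y"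
proof -
  have "((\<lambda>p :: (real ^ 'n) \<times> (real ^ 'n). h (fst p)) has_derivative (\<lambda>q. h1 x (fst q))) (at (x, y))"
    by (rule has_derivative_comp_fst[OF h_has_derivative[OF assms(1)]])
  then show ?thesis
    using assms unfolding cov_s_def cov_v_def
    by (auto intro!: derivative_eq_intros simp: blinfun.bilinear_simps h_deriv fun_eq_iff)
qed

lemma cov_v_scaleR [cov_intros]:
  assumes "cov_s f f' x y" "cov_v Z Z' x y"
  shows "cov_v (\<lambda>x y. f x y *\<^sub>R Z x y) (\<lambda>w e. f' w e *\<^sub>R Z x y + f x y *\<^sub>R Z' w e) x y"
  using assms unfolding cov_s_def cov_v_def
  by (auto intro!: derivative_eq_intros simp: blinfun.bilinear_simps fun_eq_iff algebra_simps)

lemma cov_v_add [cov_intros]: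
  assumes "cov_v Y Y' x y" "cov_v Z Z' x y"
  shows "cov_v (\<lambda>x y. Y x y + Z x y) (\<lambda>w e. Y' w e + Z' w e) x y"
  using assms unfolding cov_v_def
  by (auto intro!: derivative_eq_intros simp: blinfun.bilinear_simps fun_eq_iff algebra_simps)

lemma cov_v_diff [cov_intros]:
  assumes "cov_v Y Y' x y" "cov_v Z Z' x y"
  shows "cov_v (\<lambda>x y. Y x y - Z x y) (\<lambda>w e. Y' w e - Z' w e) x y"
  using assms unfolding cov_v_def
  by (auto intro!: derivative_eq_intros simp: blinfun.bilinear_simps fun_eq_iff algebra_simps)

lemma cov_s_add [cov_intros]:
  assumes "cov_s f f' x y" "cov_s g g' x y"
  shows "cov_s (\<lambda>x y. f x y + g x y) (\<lambda>w e. f' w e + g' w e) x y"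
  using assms unfolding cov_s_def by (auto intro!: derivative_eq_intros)

lemma cov_s_diff [cov_intros]:
  assumes "cov_s f f' x y" "cov_s g g' x y"
  shows "cov_s (\<lambda>x y. f x y - g x y) (\<lambda>w e. f' w e - g' w e) x y"
  using assms unfolding cov_s_def by (auto intro!: derivative_eq_intros)

lemma cov_s_mult [cov_intros]:
  assumes "cov_s f f' x y" "cov_s g g' x y"
  shows "cov_s (\<lambda>x y. f x y * g x y) (\<lambda>w e. f' w e * g x y + f x y * g' w e) x y"
  using assms unfolding cov_s_def by (auto intro!: derivative_eq_intros simp: algebra_simps)

lemma cov_s_divide [cov_intros]:
  assumes "cov_s f f' x y" "cov_s g g' x y" "g x y \<noteq> 0"
  shows "cov_s (\<lambda>x y. f x y / g x y) (\<lambda>w e. (f' w e * g x y - f x y * g' w e) / (g x y * g x y)) x y"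
  using assms unfolding cov_s_def by (auto intro!: derivative_eq_intros)

lemma cov_s_sqrt:
  assumes "cov_s f f' x y" "f x y > 0"
  shows "cov_s (\<lambda>x y. sqrt (f x y)) (\<lambda>w e. f' w e / (2 * sqrt (f x y))) x y"
  using assms unfolding cov_s_def by (auto intro!: derivative_eq_intros simp: field_simps)

text \<open>The bracket is the covariant derivative of the endomorphism field B in the direction w,
  applied to Z.\<close>

lemma cov_v_endo:
  assumes "(B has_derivative blinfun_apply B1) (at x)" "cov_v Z Z' x y"
  shows "cov_v (\<lambda>x y. blinfun_apply (B x) (Z x y))
    (\<lambda>w e. (B1 w (Z x y) + \<Gamma> x w (B x (Z x y)) - B x (\<Gamma> x w (Z x y))) + B x (Z' w e)) x y"
proof -
  have "((\<lambda>p :: (real ^ 'n) \<times> (real ^ 'n). B (fst p)) has_derivative (\<lambda>q. B1 (fst q))) (at (x, y))"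
    by (rule has_derivative_comp_fst[OF assms(1)])
  then show ?thesis
    using assms unfolding cov_v_def
    by (auto intro!: derivative_eq_intros simp: blinfun.bilinear_simps fun_eq_iff algebra_simps)
qed

end

section \<open>Randers metrics from navigation data: derivatives and geodesic spray\<close>

text \<open>\<open>B x w\<close> is the covariant derivative of W in the direction w.\<close>

locale randers_chart = riemannian_chart U h \<Gamma>
  for U :: "(real ^ 'n::finite) set"
    and h :: "real ^ 'n \<Rightarrow> (real ^ 'n) \<Rightarrow>\<^sub>L (real ^ 'n) \<Rightarrow>\<^sub>L real"
    and \<Gamma> :: "real ^ 'n \<Rightarrow> (real ^ 'n) \<Rightarrow>\<^sub>L (real ^ 'n) \<Rightarrow>\<^sub>L (real ^ 'n)" +
  fixes W :: "real ^ 'n \<Rightarrow> real ^ 'n" and B :: "real ^ 'n \<Rightarrow> (real ^ 'n) \<Rightarrow>\<^sub>L (real ^ 'n)"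
  assumes W_has_derivative: "x \<in> U \<Longrightarrow> (W has_derivative (\<lambda>w. B x w - \<Gamma> x w (W x))) (at x)"
    and W_small: "x \<in> U \<Longrightarrow> h x (W x) (W x) < 1"
    and B_C1: "Ck_on 1 B U"
begin

section \<open>Zermelo navigation: F, the shifted vector and their first derivatives\<close>

definition lam :: "real ^ 'n \<Rightarrow> real" where "lam x = 1 - h x (W x) (W x)"

definition root :: "real ^ 'n \<Rightarrow> real ^ 'n \<Rightarrow> real" where
  "root x y = sqrt (lam x * h x y y + (h x (W x) y)\<^sup>2)"

definition F :: "real ^ 'n \<Rightarrow> real ^ 'n \<Rightarrow> real" where
  "F x y = (root x y - h x (W x) y) / lam x"

text \<open>The vector called u in the overview.\<close>

definition yt :: "real ^ 'n \<Rightarrow> real ^ 'n \<Rightarrow> real ^ 'n" where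
  "yt x y = y - F x y *\<^sub>R W x"

lemma lam_pos: "x \<in> U \<Longrightarrow> lam x > 0"
  using W_small by (simp add: lam_def)

lemma root_arg_pos: "x \<in> U \<Longrightarrow> y \<noteq> 0 \<Longrightarrow> lam x * h x y y + (h x (W x) y)\<^sup>2 > 0"
  using lam_pos[of x] h_pos[of x y] by (intro add_pos_nonneg) auto

lemma root_pos: "x \<in> U \<Longrightarrow> y \<noteq> 0 \<Longrightarrow> root x y > 0"
  using root_arg_pos by (simp add: root_def)

lemma root_sq: "x \<in> U \<Longrightarrow> y \<noteq> 0 \<Longrightarrow> root x y * root x y = lam x * h x y y + (h x (W x) y)\<^sup>2"
  using root_arg_pos[of x y] by (simp add: root_def)

lemma lam_F: "x \<in> U \<Longrightarrow> lam x * F x y = root x y - h x (W x) y"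
  using lam_pos[of x] by (simp add: F_def)

lemma F_pos:
  assumes "x \<in> U" "y \<noteq> 0"
  shows "F x y > 0"
proof -
  have "\<bar>h x (W x) y\<bar> < root x y"
    unfolding root_def using lam_pos[OF assms(1)] h_pos[OF assms] by (intro real_less_rsqrt) simp
  then show ?thesis
    using lam_pos[OF assms(1)] by (simp add: F_def)
qed

text \<open>This is \<open>h(y - F W, y - F W) = F^2\<close> expanded; F is its positive
  root.\<close>

lemma F_quadratic:
  assumes "x \<in> U" "y \<noteq> 0"
  shows "lam x * (F x y)\<^sup>2 + 2 * F x y * h x (W x) y = h x y y"
proof -
  have "lam x * (lam x * (F x y)\<^sup>2 + 2 * F x y * h x (W x) y)
      = (lam x * F x y)\<^sup>2 + 2 * (lam x * F x y) * h x (W x) y"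
    by (simp add: power2_eq_square algebra_simps)
  also have "\<dots> = lam x * h x y y"
    using root_sq[OF assms] unfolding lam_F[OF assms(1)] by (simp add: power2_eq_square algebra_simps)
  finally show ?thesis
    using lam_pos[OF assms(1)] by simp
qed

lemma h_yt_yt:
  assumes "x \<in> U" "y \<noteq> 0"
  shows "h x (yt x y) (yt x y) = (F x y)\<^sup>2"
  using F_quadratic[OF assms] h_sym[OF assms(1), of y "W x"]
  by (simp add: yt_def blinfun.bilinear_simps lam_def power2_eq_square algebra_simps)

lemma root_eq:
  assumes "x \<in> U"
  shows "root x y = F x y + h x (yt x y) (W x)"
  using lam_F[OF assms, of y] h_sym[OF assms, of y "W x"]
  by (simp add: yt_def blinfun.bilinear_simps lam_def algebra_simps)

text \<open>The inverse of \<open>yt\<close> on nonzero vectors. Under the square root stands (s +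
  b)^2; Cauchy-Schwarz and |W| < 1 make s + b positive, so \<open>root\<close> is s + b and F comes
  out as s.\<close>

lemma F_indicatrix:
  assumes "x \<in> U" "u \<noteq> 0" "y = u + sqrt (h x u u) *\<^sub>R W x"
  shows "y \<noteq> 0" "F x y = sqrt (h x u u)" "yt x y = u"
proof -
  define s where "s = sqrt (h x u u)"
  have s: "s > 0" "s * s = h x u u"
    using h_pos[OF assms(1,2)] by (simp_all add: s_def)
  define k where "k = h x (W x) (W x)"
  have k: "0 \<le> k" "k < 1"
    using h_nonneg[OF assms(1)] W_small[OF assms(1)] by (simp_all add: k_def)
  define b where "b = h x (W x) u"
  have y: "y = u + s *\<^sub>R W x"
    using assms(3) by (simp add: s_def)
  \<comment> \<open>Cauchy-Schwarz from the residual of the projection of u onto W; for W = 0 the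
    quotient b / k is 0 by convention.\<close>
  have "0 \<le> h x (u - (b / k) *\<^sub>R W x) (u - (b / k) *\<^sub>R W x)"
    by (rule h_nonneg[OF assms(1)])
  also have "\<dots> = s * s - b * b / k"
    using s(2) h_sym[OF assms(1), of u "W x"]
    by (cases "k = 0") (simp_all add: blinfun.bilinear_simps b_def k_def field_simps)
  finally have "b\<^sup>2 \<le> k * s\<^sup>2"
  proof (cases "k = 0")
    case True
    then have "W x = 0"
      using h_zeroD[OF assms(1)] by (simp add: k_def)
    then show ?thesis by (simp add: b_def k_def)
  next
    case False
    assume "0 \<le> s * s - b * b / k"
    then show ?thesis
      using False k by (simp add: field_simps power2_eq_square)
  qed
  also have "k * s\<^sup>2 < s\<^sup>2"
    using s k by simp
  finally have bs: "\<bar>b\<bar> < s"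
    using s(1) power2_less_imp_less[of "\<bar>b\<bar>" s] by simp
  have W0: "h x (W x) y = b + s * k"
    by (simp add: y blinfun.bilinear_simps b_def k_def)
  have N: "h x y y = s * s + 2 * s * b + s * s * k"
    using s(2) h_sym[OF assms(1), of u "W x"]
    by (simp add: y blinfun.bilinear_simps b_def k_def algebra_simps)
  have "lam x * h x y y + (h x (W x) y)\<^sup>2 = (s + b)\<^sup>2"
    unfolding W0 N lam_def by (simp add: k_def[symmetric] power2_eq_square algebra_simps)
  then have "root x y = s + b"
    using bs by (simp add: root_def)
  then show Fs: "F x y = sqrt (h x u u)"
    using k unfolding F_def W0 lam_def s_def[symmetric] k_def[symmetric] by (simp add: field_simps)
  then show "yt x y = u"
    by (simp add: yt_def y s_def)
  show "y \<noteq> 0"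
  proof
    assume "y = 0"
    then have "u = - (s *\<^sub>R W x)"
      unfolding y by (simp add: eq_neg_iff_add_eq_0)
    then have "b = - s * k"
      by (simp add: b_def k_def blinfun.bilinear_simps)
    moreover have "s * s = s * s * k"
      using s(2) by (simp add: \<open>u = - (s *\<^sub>R W x)\<close> k_def blinfun.bilinear_simps)
    ultimately show False
      using s k by simp
  qed
qed

text \<open>Differentiating h(u, u) = F^2 with u = y - F W gives F F' = h(u, e - F' W - F B w);
  solving for F' produces the denominator F + h(u, W), which is \<open>root\<close>.\<close>

definition Fd :: "real ^ 'n \<Rightarrow> real ^ 'n \<Rightarrow> real ^ 'n \<Rightarrow> real ^ 'n \<Rightarrow> real" where
  "Fd x y w e = (h x (yt x y) e - F x y * h x (yt x y) (B x w)) / root x y"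

lemma cov_W [cov_intros]:
  assumes "x \<in> U"
  shows "cov_v (\<lambda>x y. W x) (\<lambda>w e. B x w) x y"
  unfolding cov_v_def by (rule has_derivative_comp_fst[OF W_has_derivative[OF assms]])

text \<open>The explicit formula yields differentiability; its derivative takes the implicit form of
  \<open>Fd\<close> once \<open>root\<close> and h(y, y) are expressed through F, \<open>lam\<close>
  and h(W, y).\<close>

lemma cov_F [cov_intros]:
  assumes "x \<in> U" "y \<noteq> 0"
  shows "cov_s F (Fd x y) x y"
proof -
  have lam: "cov_s (\<lambda>x y. lam x) (\<lambda>w e. - 2 * h x (W x) (B x w)) x y"
    unfolding lam_def
    by (rule cov_s_eq_rhs, (rule cov_intros assms)+) (simp add: h_sym[OF assms(1)])
  have sq: "cov_s (\<lambda>x y. (h x (W x) y)\<^sup>2) (\<lambda>w e. 2 * h x (W x) y * (h x (B x w) y + h x (W x) e)) x y"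
    unfolding power2_eq_square
    by (rule cov_s_eq_rhs, (rule cov_intros assms)+) (simp add: algebra_simps)
  have root: "cov_s root (\<lambda>w e. (- 2 * h x (W x) (B x w) * h x y y + lam x * (h x e y + h x y e)
        + 2 * h x (W x) y * (h x (B x w) y + h x (W x) e)) / (2 * root x y)) x y"
    unfolding root_def by (rule cov_s_sqrt) (rule cov_intros assms lam sq root_arg_pos)+
  have lnz: "lam x \<noteq> 0" and rnz: "root x y \<noteq> 0"
    using lam_pos root_pos assms by fastforce+
  show ?thesis
    unfolding F_def
  proof (rule cov_s_eq_rhs, (rule cov_intros assms lam root lnz)+)
    fix w e
    define a where "a = h x (W x) (B x w)"
    define b where "b = h x (B x w) y"
    define c where "c = h x y e"
    define d where "d = h x (W x) e"
    define N where "N = h x y y"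
    define k where "k = h x (W x) y"
    define f where "f = F x y"
    define l where "l = lam x"
    define R where "R = root x y"
    have rel: "l * f = R - k" "l * f\<^sup>2 + 2 * f * k = N"
      using lam_F[OF assms(1), of y] F_quadratic[OF assms]
      by (simp_all add: l_def f_def R_def k_def N_def)
    have nz: "l \<noteq> 0" "R \<noteq> 0"
      using lnz rnz by (simp_all add: l_def R_def)
    have sy: "h x (yt x y) e = c - f * d" "h x (yt x y) (B x w) = b - f * a" "h x e y = c"
      using h_sym[OF assms(1)]
      by (simp_all add: yt_def blinfun.bilinear_simps a_def b_def c_def d_def f_def)
    have R: "R = l * f + k" and N: "N = l * f\<^sup>2 + 2 * f * k"
      using rel by simp_all
    have "(((- 2 * a * N + l * (c + c) + 2 * k * (b + d)) / (2 * R) - (b + d)) * l - (R - k) * (- 2 * a)) / (l * l)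
        = (c - f * d - f * (b - f * a)) / R"
      using nz unfolding N
      by (simp add: field_simps) (simp add: R power2_eq_square algebra_simps)
    then show "(((- 2 * h x (W x) (B x w) * h x y y + lam x * (h x e y + h x y e)
        + 2 * h x (W x) y * (h x (B x w) y + h x (W x) e)) / (2 * root x y)
        - (h x (B x w) y + h x (W x) e)) * lam x - (root x y - h x (W x) y) * (- 2 * h x (W x) (B x w)))
        / (lam x * lam x) = Fd x y w e"
      unfolding Fd_def sy by (simp add: a_def b_def c_def d_def f_def l_def R_def N_def k_def h_sym[OF assms(1), of e y])
  qed
qed

lemma cov_yt [cov_intros]:
  assumes "x \<in> U" "y \<noteq> 0"
  shows "cov_v yt (\<lambda>w e. e - Fd x y w e *\<^sub>R W x - F x y *\<^sub>R B x w) x y"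
  unfolding yt_def by (rule cov_v_eq_rhs, (rule cov_intros assms)+) simp

lemma cov_root [cov_intros]:
  assumes "x \<in> U" "y \<noteq> 0"
  shows "cov_s root (\<lambda>w e. Fd x y w e + (h x (e - Fd x y w e *\<^sub>R W x - F x y *\<^sub>R B x w) (W x)
    + h x (yt x y) (B x w))) x y"
  by (rule cov_s_cong[OF _ assms root_eq[symmetric]]) (rule cov_intros assms | assumption)+

section \<open>The fundamental tensor and the geodesic spray\<close>

definition xi :: "real ^ 'n \<Rightarrow> real ^ 'n \<Rightarrow> real ^ 'n \<Rightarrow> real" where
  "xi v x y = F x y * h x (yt x y) v / root x y"

text \<open>\<open>xi v\<close> is half the fibre derivative of F^2 in the direction v, that is, the
  Legendre transform of y. This is its derivative by the quotient rule, where
  \<open>e - Fd x y w e *\<^sub>R W x - F x y *\<^sub>R B x w\<close> is the derivative of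
  \<open>yt\<close>.\<close>

definition xid :: "real ^ 'n \<Rightarrow> real ^ 'n \<Rightarrow> real ^ 'n \<Rightarrow> real ^ 'n \<Rightarrow> real ^ 'n \<Rightarrow> real" where
  "xid v x y w e = ((Fd x y w e * h x (yt x y) v + F x y * (h x (e - Fd x y w e *\<^sub>R W x - F x y *\<^sub>R B x w) v
      + h x (yt x y) (\<Gamma> x w v))) * root x y
    - F x y * h x (yt x y) v * (Fd x y w e + (h x (e - Fd x y w e *\<^sub>R W x - F x y *\<^sub>R B x w) (W x)
      + h x (yt x y) (B x w)))) / (root x y * root x y)"

lemma cov_xi:
  assumes "x \<in> U" "y \<noteq> 0"
  shows "cov_s (xi v) (xid v x y) x y"
proof -
  have "root x y \<noteq> 0"
    using root_pos[OF assms] by simp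
  then show ?thesis
    unfolding xi_def xid_def by (intro cov_s_eq_rhs[OF cov_s_divide]) (rule cov_intros assms refl | assumption)+
qed

lemma cov_sq_F:
  assumes "x \<in> U" "y \<noteq> 0"
  shows "cov_s (sq F) (\<lambda>w e. 2 * F x y * Fd x y w e) x y"
  unfolding sq_def power2_eq_square
  by (rule cov_s_eq_rhs, (rule cov_intros assms)+) (simp add: algebra_simps)

lemma dy_sq_F:
  assumes "x \<in> U" "y \<noteq> 0"
  shows "dy l (sq F) x y = 2 * xi (axis l 1) x y"
  using dy_cov_s[OF cov_sq_F[OF assms]] by (simp add: xi_def Fd_def)

lemma cov_dy_sq_F:
  assumes "x \<in> U" "y \<noteq> 0"
  shows "cov_s (dy l (sq F)) (\<lambda>w e. 2 * xid (axis l 1) x y w e) x y"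
proof -
  have "cov_s (\<lambda>x y. 2 * xi (axis l 1) x y) (\<lambda>w e. 2 * xid (axis l 1) x y w e) x y"
    by (rule cov_s_eq_rhs, (rule cov_intros cov_xi assms)+) simp
  then show ?thesis
    by (rule cov_s_cong[OF _ assms]) (simp add: dy_sq_F)
qed

lemma linear_xid:
  assumes "x \<in> U" "y \<noteq> 0"
  shows "linear (\<lambda>q. xid v x y (fst q) (snd q))"
  using cov_s_linear[OF cov_xi[OF assms]] .

lemma xid_add:
  assumes "x \<in> U" "y \<noteq> 0"
  shows "xid v x y (w + w') (e + e') = xid v x y w e + xid v x y w' e'"
  using linear_add[OF linear_xid[OF assms], of v "(w, e)" "(w', e')"] by simp

lemma xid_scale:
  assumes "x \<in> U" "y \<noteq> 0"
  shows "xid v x y (c *\<^sub>R w) (c *\<^sub>R e) = c * xid v x y w e"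
  using linear_cmul[OF linear_xid[OF assms], of v c "(w, e)"] by simp

lemma fundamental_tensor_F:
  assumes "x \<in> U" "y \<noteq> 0"
  shows "(fundamental_tensor F x y *v v) $ l = xid (axis l 1) x y 0 v"
proof -
  have "linear (xid (axis l 1) x y 0)"
    using xid_add[OF assms, of "axis l 1" 0 0] xid_scale[OF assms, of "axis l 1" _ 0]
    by (intro linearI) simp_all
  then have "xid (axis l 1) x y 0 v = (\<Sum>j\<in>UNIV. v $ j * xid (axis l 1) x y 0 (axis j 1))"
    using linear_vec_expansion by fastforce
  then show ?thesis
    by (simp add: fundamental_tensor_def matrix_vector_mult_def dy_cov_s[OF cov_dy_sq_F[OF assms]] mult.commute)
qed

text \<open>Only the kernel has to be examined. Under h the covector g(v, .) corresponds to a
  combination z of u and the fibre derivative q of u; z = 0 makes q = s u, and the relations between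
  v, q and F then force s = 0.\<close>

lemma invertible_fundamental_tensor:
  assumes "x \<in> U" "y \<noteq> 0"
  shows "invertible (fundamental_tensor F x y)"
proof -
  let ?u = "yt x y" and ?R = "root x y" and ?f = "F x y"
  have R: "?R > 0" and f: "?f > 0"
    using root_pos F_pos assms by blast+
  have "v = 0" if v: "fundamental_tensor F x y *v v = 0" for v
  proof -
    define t where "t = Fd x y 0 v"
    define q where "q = v - t *\<^sub>R W x"
    \<comment> \<open>The derivative of the quotient F / \<open>root\<close> in the fibre direction
      v.\<close>
    define \<alpha> where "\<alpha> = (t * ?R - ?f * (t + h x q (W x))) / (?R * ?R)"
    define z where "z = \<alpha> *\<^sub>R ?u + (?f / ?R) *\<^sub>R q"
    have "h x z w = xid w x y 0 v" for w
      using R by (simp add: z_def \<alpha>_def q_def t_def xid_def blinfun.bilinear_simps field_simps)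
    then have "h x z (axis l 1) = 0" for l
      using fundamental_tensor_F[OF assms, of v l] v by simp
    then have "h x z z = 0"
      using linear_eq_on_axis[OF linear_blinfun linear_zero, of "h x z" z] by simp
    then have "z = 0"
      using h_zeroD[OF assms(1)] by blast
    define s where "s = - \<alpha> * ?R / ?f"
    have "(?R / ?f) *\<^sub>R z = 0"
      using \<open>z = 0\<close> by simp
    then have qs: "q = s *\<^sub>R ?u"
      using f R by (simp add: z_def s_def scaleR_add_right mult.commute add_eq_0_iff)
    have hv: "h x ?u v = t * ?R"
      using R by (simp add: t_def Fd_def blinfun.bilinear_simps)
    have "v = q + t *\<^sub>R W x"
      by (simp add: q_def)
    then have "h x ?u v = s * (?f)\<^sup>2 + t * h x ?u (W x)"
      using h_yt_yt[OF assms] by (simp add: qs blinfun.bilinear_simps)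
    then have "t * ?f = s * ?f * ?f"
      using hv root_eq[OF assms(1), of y] by (simp add: algebra_simps power2_eq_square)
    then have ts: "t = s * ?f"
      using f by simp
    have "t + h x q (W x) = s * ?R"
      using root_eq[OF assms(1), of y] by (simp add: ts qs blinfun.bilinear_simps algebra_simps)
    then have "\<alpha> = 0"
      by (simp add: \<alpha>_def ts)
    then have "s = 0"
      by (simp add: s_def)
    then show "v = 0"
      using \<open>v = q + t *\<^sub>R W x\<close> by (simp add: qs ts)
  qed
  then have "inj ((*v) (fundamental_tensor F x y))"
    by (intro linear_injective_0[OF matrix_vector_mul_linear, THEN iffD2]) blast
  then show ?thesis
    using matrix_left_invertible_injective invertible_left_inverse by blast
qed

text \<open>The inverse of the fundamental tensor is never computed: the candidate is shown to solve
  the linear system. The hypothesis is the Euler-Lagrange equation of F^2 in covariant form, -2 Q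
  being the vertical part of the geodesic spray.\<close>

lemma spray_coeff_eq:
  assumes "x \<in> U" "y \<noteq> 0"
    and "\<And>v. xid v x y y (- 2 *\<^sub>R Q) = F x y * Fd x y v (\<Gamma> x v y)"
  shows "spray_coeff F i x y = ((1/2) *\<^sub>R \<Gamma> x y y + Q) $ i"
proof -
  let ?G = "(1/2) *\<^sub>R \<Gamma> x y y + Q" and ?g = "fundamental_tensor F x y"
  have g: "(?g *v ?G) $ l = 1/4 * ((\<Sum>k\<in>UNIV. dx k (dy l (sq F)) x y * y $ k) - dx l (sq F) x y)" for l
  proof -
    let ?v = "axis l 1 :: real ^ 'n"
    have "linear (\<lambda>w. xid ?v x y w (\<Gamma> x w y))"
      using xid_add[OF assms(1,2), of ?v] xid_scale[OF assms(1,2), of ?v]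
      by (intro linearI) (simp_all add: blinfun.bilinear_simps)
    note ex = linear_vec_expansion[OF this, of y]
    have "(\<Sum>k\<in>UNIV. dx k (dy l (sq F)) x y * y $ k)
        = (\<Sum>k\<in>UNIV. 2 * (y $ k *\<^sub>R xid ?v x y (axis k 1) (\<Gamma> x (axis k 1) y)))"
      by (intro sum.cong) (simp_all add: dx_cov_s[OF cov_dy_sq_F[OF assms(1,2)]])
    then have "(\<Sum>k\<in>UNIV. dx k (dy l (sq F)) x y * y $ k) = 2 * xid ?v x y y (\<Gamma> x y y)"
      by (simp only: ex flip: sum_distrib_left)
    moreover have "dx l (sq F) x y = 2 * xid ?v x y y (- 2 *\<^sub>R Q)"
      using assms(3) by (simp add: dx_cov_s[OF cov_sq_F[OF assms(1,2)]])
    moreover have "xid ?v x y y (\<Gamma> x y y) - xid ?v x y y (- 2 *\<^sub>R Q) = 2 * xid ?v x y 0 ?G"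
    proof -
      have "xid ?v x y y (\<Gamma> x y y) = xid ?v x y (y + 0) (- 2 *\<^sub>R Q + 2 *\<^sub>R ?G)"
        by (simp add: scaleR_add_right)
      also have "\<dots> = xid ?v x y y (- 2 *\<^sub>R Q) + xid ?v x y (2 *\<^sub>R 0) (2 *\<^sub>R ?G)"
        by (subst xid_add[OF assms(1,2)]) simp
      finally show ?thesis
        by (simp add: xid_scale[OF assms(1,2)] del: scaleR_zero_right)
    qed
    ultimately show ?thesis
      by (simp add: fundamental_tensor_F[OF assms(1,2)])
  qed
  have "(matrix_inv ?g *v (?g *v ?G)) $ i = (\<Sum>l\<in>UNIV. matrix_inv ?g $ i $ l * (?g *v ?G) $ l)"
    by (simp only: matrix_vector_mult_def[of "matrix_inv ?g"] vec_lambda_beta)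
  then have "spray_coeff F i x y = (matrix_inv ?g *v (?g *v ?G)) $ i"
    unfolding spray_coeff_def by (simp only: g sum_distrib_left mult.left_commute)
  also have "\<dots> = ?G $ i"
    using matrix_inv_left[OF invertible_fundamental_tensor[OF assms(1,2)]]
    by (simp add: matrix_vector_mul_assoc)
  finally show ?thesis .
qed

text \<open>With this Q the function F is constant along the spray, so u changes there by p, a
  multiple of u minus F times the adjoint of B at u. In the Euler-Lagrange equation the multiple of
  u cancels against the derivative of \<open>root\<close>.\<close>

lemma spray_identity:
  assumes "x \<in> U" "y \<noteq> 0"
    and BT: "\<And>v. h x bt v = h x (yt x y) (B x v)"
    and r: "r = h x (yt x y) (B x (yt x y))"
    and Q: "- 2 *\<^sub>R Q = F x y *\<^sub>R (B x y - bt) + (r / F x y) *\<^sub>R yt x y"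
  shows "Fd x y y (- 2 *\<^sub>R Q) = 0"
    and "xid v x y y (- 2 *\<^sub>R Q) = F x y * Fd x y v (\<Gamma> x v y)"
proof -
  let ?u = "yt x y" and ?R = "root x y" and ?f = "F x y" and ?e = "- 2 *\<^sub>R Q"
  have R: "?R > 0" and f: "?f > 0"
    using root_pos F_pos assms by blast+
  define p where "p = ?e - ?f *\<^sub>R B x y"
  have p: "p = (r / ?f) *\<^sub>R ?u - ?f *\<^sub>R bt"
    unfolding p_def Q by (simp add: scaleR_diff_right)
  have hu: "h x ?u bt = r"
    using BT[of ?u] r h_sym[OF assms(1)] by metis
  have "h x ?u p = 0"
    using f by (simp add: p blinfun.bilinear_simps hu h_yt_yt[OF assms(1,2)] power2_eq_square)
  then show F0: "Fd x y y ?e = 0"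
    by (simp add: Fd_def p_def blinfun.bilinear_simps)
  have pW: "h x p (W x) + h x ?u (B x y) = (r / ?f) * ?R"
  proof -
    have "h x ?u (B x y) = r + ?f * h x ?u (B x (W x))"
      by (simp add: r blinfun.bilinear_simps yt_def[of x y])
    then show ?thesis
      using f by (simp add: p blinfun.bilinear_simps BT root_eq[OF assms(1), of y] field_simps)
  qed
  have uv: "xid v x y y ?e = (?f * (h x p v + h x ?u (\<Gamma> x y v)) * ?R - ?f * h x ?u v * ((r / ?f) * ?R)) / (?R * ?R)"
    using F0 pW by (simp add: xid_def p_def)
  also have "\<dots> = ?f * (h x ?u (\<Gamma> x y v) - ?f * h x ?u (B x v)) / ?R"
    using R f by (simp add: p blinfun.bilinear_simps BT field_simps)
  also have "\<dots> = ?f * Fd x y v (\<Gamma> x v y)"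
    using \<Gamma>_sym[OF assms(1)] by (simp add: Fd_def)
  finally show "xid v x y y ?e = ?f * Fd x y v (\<Gamma> x v y)" .
qed

end

section \<open>Constant S-curvature\<close>

lemma tr_blinfun_add: "tr (blinfun_apply (f + g)) = tr f + tr g"
  and tr_blinfun_scaleR: "tr (blinfun_apply (c *\<^sub>R f)) = c * tr f"
  by (simp_all add: tr_def blinfun.bilinear_simps sum.distrib sum_distrib_left)

context randers_chart
begin

definition adj :: "real ^ 'n \<Rightarrow> (real ^ 'n) \<Rightarrow>\<^sub>L (real ^ 'n)" where
  "adj x = Blinfun (\<lambda>u. sharp x (\<lambda>v. h x u (B x v)))"

lemma h_adj:
  assumes "x \<in> U"
  shows "h x (adj x u) v = h x u (B x v)"
proof -
  have lin: "linear (\<lambda>v. h x u (B x v))" for u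
    by (intro linearI) (simp_all add: blinfun.bilinear_simps)
  define s where "s u = sharp x (\<lambda>v. h x u (B x v))" for u
  have s: "h x (s u) v = h x u (B x v)" for u v
    unfolding s_def by (rule h_sharp[OF assms lin])
  have "bounded_linear s"
    unfolding linear_conv_bounded_linear[symmetric]
    by (intro linearI; rule h_eqI[OF assms]) (simp_all add: s blinfun.bilinear_simps)
  then show ?thesis
    by (simp add: adj_def bounded_linear_Blinfun_apply s flip: s_def)
qed

lemma tr_adj: "x \<in> U \<Longrightarrow> tr (adj x) = tr (B x)"
  using tr_adjoint[of x "adj x" "B x"] h_adj by simp

text \<open>Half the Lie derivative of h along W, evaluated on (u, u).\<close>

definition shear :: "real ^ 'n \<Rightarrow> real ^ 'n \<Rightarrow> real" where
  "shear x u = h x u (B x u)"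

text \<open>The geodesic coefficients of F minus those of h, solved from the equation in
  \<open>spray_identity\<close>.\<close>

definition Q :: "real ^ 'n \<Rightarrow> real ^ 'n \<Rightarrow> real ^ 'n" where
  "Q x y = (1/2) *\<^sub>R (F x y *\<^sub>R (adj x (yt x y) - B x y) - (shear x (yt x y) / F x y) *\<^sub>R yt x y)"

lemma spray_coeff_F:
  assumes "x \<in> U" "y \<noteq> 0"
  shows "spray_coeff F i x y = ((1/2) *\<^sub>R \<Gamma> x y y + Q x y) $ i"
proof (rule spray_coeff_eq[OF assms])
  show "xid v x y y (- 2 *\<^sub>R Q x y) = F x y * Fd x y v (\<Gamma> x v y)" for v
  proof (rule spray_identity(2)[OF assms, of "adj x (yt x y)" "shear x (yt x y)"])
    show "- 2 *\<^sub>R Q x y = F x y *\<^sub>R (B x y - adj x (yt x y)) + (shear x (yt x y) / F x y) *\<^sub>R yt x y"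
      by (simp add: Q_def scaleR_diff_right)
  qed (simp_all add: h_adj assms shear_def)
qed

text \<open>Geodesics of F have constant speed.\<close>

lemma spray_F_zero:
  assumes "x \<in> U" "y \<noteq> 0"
  shows "Fd x y y (- 2 *\<^sub>R Q x y) = 0"
proof (rule spray_identity(1)[OF assms, of "adj x (yt x y)" "shear x (yt x y)"])
  show "- 2 *\<^sub>R Q x y = F x y *\<^sub>R (B x y - adj x (yt x y)) + (shear x (yt x y) / F x y) *\<^sub>R yt x y"
    by (simp add: Q_def scaleR_diff_right)
qed (simp_all add: h_adj assms shear_def)

lemma dy_component:
  assumes "x \<in> U" "y \<noteq> 0" "(Z has_derivative Z') (at y)"
    and "\<And>y. y \<noteq> 0 \<Longrightarrow> f x y = Z y $ i"
  shows "dy j f x y = Z' (axis j 1) $ i"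
proof -
  have "((\<lambda>y. Z y $ i) has_derivative (\<lambda>e. Z' e $ i)) (at y)"
    using bounded_linear.has_derivative[OF bounded_linear_vec_nth assms(3)] .
  then have "((\<lambda>y. f x y) has_derivative (\<lambda>e. Z' e $ i)) (at y)"
    by (rule has_derivative_transform_within_open[of _ _ _ _ "- {0}"])
      (use assms in \<open>auto simp: open_Compl\<close>)
  then show ?thesis
    unfolding dy_def by (subst frechet_derivative_eq) auto
qed

text \<open>Besides \<Gamma>, the fibre derivative of the spray contains a multiple of
  \<open>adj - B\<close>, which is traceless, -r / (2 F) times the identity, which accounts for n,
  and rank one maps, which account for the remaining 1.\<close>

lemma divergence_spray:
  assumes "x \<in> U" "y \<noteq> 0"
  shows "(\<Sum>i\<in>UNIV. dy i (spray_coeff F i) x y)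
    = tr (\<Gamma> x y) - (real CARD('n) + 1) * shear x (yt x y) / (2 * F x y)"
proof -
  let ?u = "yt x y" and ?R = "root x y" and ?f = "F x y"
  define r where "r = shear x ?u"
  have R: "?R > 0" and f: "?f > 0"
    using root_pos F_pos assms by blast+
  define \<phi> where "\<phi> e = h x ?u e / ?R" for e
  define ud where "ud e = e - \<phi> e *\<^sub>R W x" for e
  have F': "(F x has_derivative \<phi>) (at y)"
    using cov_s_has_derivative_snd[OF cov_F[OF assms]] by (simp add: \<phi>_def[abs_def] Fd_def)
  have u': "(yt x has_derivative ud) (at y)"
    using cov_v_has_derivative_snd[OF cov_yt[OF assms]] by (simp add: ud_def[abs_def] \<phi>_def Fd_def)
  define \<psi> where "\<psi> e = ((h x (ud e) (B x ?u) + h x ?u (B x (ud e))) * ?f - r * \<phi> e) / (?f * ?f)" for e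
  define N where "N e = \<Gamma> x y e + (1/2) *\<^sub>R (\<phi> e *\<^sub>R (adj x ?u - B x y - ?f *\<^sub>R adj x (W x) + (r / ?f) *\<^sub>R W x)
      + ?f *\<^sub>R (adj x e - B x e) - \<psi> e *\<^sub>R ?u - (r / ?f) *\<^sub>R e)" for e
  have "((\<lambda>y. (1/2) *\<^sub>R \<Gamma> x y y + Q x y) has_derivative N) (at y)"
    unfolding Q_def shear_def
    using f by (auto intro!: derivative_eq_intros F' u' simp: fun_eq_iff)
      (simp add: N_def \<psi>_def r_def shear_def \<Gamma>_sym[OF assms(1)] ud_def blinfun.bilinear_simps algebra_simps
        flip: scaleR_add_left)
  then have "dy i (spray_coeff F i) x y = N (axis i 1) $ i" for i
    using spray_coeff_F[OF assms(1)] by (intro dy_component[OF assms])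
  then have "(\<Sum>i\<in>UNIV. dy i (spray_coeff F i) x y) = tr N"
    by (simp add: tr_def)
  also have "\<dots> = tr (\<Gamma> x y) + (1/2) * (\<phi> (adj x ?u - B x y - ?f *\<^sub>R adj x (W x) + (r / ?f) *\<^sub>R W x)
      - \<psi> ?u - (r / ?f) * real CARD('n))"
  proof -
    have "linear \<phi>"
      by (rule linearI) (simp_all add: \<phi>_def blinfun.bilinear_simps add_divide_distrib)
    moreover have "linear \<psi>"
      using f R by (intro linearI)
        (simp_all add: \<psi>_def ud_def \<phi>_def blinfun.bilinear_simps field_simps)
    ultimately show ?thesis
      unfolding N_def by (simp add: tr_simps tr_rank1 tr_id tr_adj[OF assms(1)])
  qed
  also have "\<dots> = tr (\<Gamma> x y) - (real CARD('n) + 1) * r / (2 * ?f)"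
  proof -
    define a where "a = h x ?u (B x (W x))"
    define b where "b = h x (W x) (B x ?u)"
    have *: "h x ?u (adj x ?u) = r" "h x ?u (adj x (W x)) = b" "h x ?u (B x ?u) = r"
      "h x ?u (B x y) = r + ?f * a"
      using h_adj[OF assms(1)] h_sym[OF assms(1)]
      by (simp_all add: r_def shear_def b_def a_def)
        (simp add: yt_def[of x y] blinfun.bilinear_simps)
    have hW: "h x ?u (W x) = ?R - ?f"
      using root_eq[OF assms(1), of y] by simp
    have psi: "\<psi> ?u = ((2 * r - (?f * ?f / ?R) * (b + a)) * ?f - r * (?f * ?f / ?R)) / (?f * ?f)"
      by (simp add: \<psi>_def ud_def \<phi>_def blinfun.bilinear_simps h_yt_yt[OF assms] * power2_eq_square
          algebra_simps add_divide_distrib flip: a_def b_def)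
    have phi: "\<phi> (adj x ?u - B x y - ?f *\<^sub>R adj x (W x) + (r / ?f) *\<^sub>R W x)
        = (r - (r + ?f * a) - ?f * b + (r / ?f) * (?R - ?f)) / ?R"
      by (simp add: \<phi>_def blinfun.bilinear_simps * hW)
    show ?thesis
      unfolding psi phi using R f by (simp add: field_simps)
  qed
  finally show ?thesis
    by (simp add: r_def)
qed

lemma homothetic_of_constant_S_BH:
  assumes "x \<in> U" "\<And>y. y \<noteq> 0 \<Longrightarrow> S_BH F x y = (real CARD('n) + 1) * \<sigma> * F x y"
  shows "h x (B x u) v + h x u (B x v) = - 4 * \<sigma> * h x u v"
proof -
  let ?n = "real CARD('n) + 1"
  \<comment> \<open>Linear in y, whatever numbers the derivative of the density returns.\<close>
  define \<theta> where "\<theta> y = tr (\<Gamma> x y) - (\<Sum>i\<in>UNIV. y $ i *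
      frechet_derivative (\<lambda>x'. ln (sigma_BH F x')) (at x) (axis i 1))" for y :: "real ^ 'n"
  have \<theta>_lin: "\<theta> (u + v) = \<theta> u + \<theta> v" "\<theta> (c *\<^sub>R u) = c * \<theta> u" for u v c
    by (simp_all add: \<theta>_def blinfun.bilinear_simps tr_blinfun_add tr_blinfun_scaleR algebra_simps sum.distrib sum_distrib_left)
  have eq: "\<theta> u + sqrt (h x u u) * \<theta> (W x) - ?n * shear x u / (2 * sqrt (h x u u)) = ?n * \<sigma> * sqrt (h x u u)"
    if "u \<noteq> 0" for u
  proof -
    define y where "y = u + sqrt (h x u u) *\<^sub>R W x"
    note y = F_indicatrix[OF assms(1) that y_def]
    have "\<theta> y - ?n * shear x u / (2 * sqrt (h x u u)) = ?n * \<sigma> * sqrt (h x u u)"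
      using assms(2)[OF y(1)] divergence_spray[OF assms(1) y(1)] unfolding y(2,3)
      by (simp add: S_BH_def \<theta>_def)
    then show ?thesis
      by (simp only: y_def \<theta>_lin)
  qed
  have shear: "shear x u = - 2 * \<sigma> * h x u u" for u
  proof (cases "u = 0")
    case False
    define s where "s = sqrt (h x u u)"
    have s: "s > 0" "s * s = h x u u"
      using h_pos[OF assms(1) False] by (simp_all add: s_def)
    have zero: "\<theta> u = 0" if "u \<noteq> 0" for u
      using eq[OF that] eq[of "- u"] \<theta>_lin(2)[of "-1" u] that
      by (simp add: shear_def blinfun.bilinear_simps)
    have "\<theta> (W x) = 0"
      using zero[of "W x"] \<theta>_lin(2)[of 0 0] by (cases "W x = 0") auto
    then have "?n * (shear x u + 2 * \<sigma> * (s * s)) = 0"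
      using eq[OF False] zero[OF False] s(1) unfolding s_def[symmetric]
      by (simp add: field_simps)
    then show ?thesis
      using s(2) by (simp add: add_eq_0_iff)
  qed (simp add: shear_def blinfun.bilinear_simps)
  show ?thesis
    using shear[of "u + v"] shear[of u] shear[of v] h_sym[OF assms(1), of v "B x u"] h_sym[OF assms(1), of v u]
    by (simp add: shear_def blinfun.bilinear_simps algebra_simps)
qed

end

section \<open>Curvature and homothetic navigation fields\<close>

lemma has_derivative_blinfun_apply2:
  assumes "(L has_derivative L') (at x)"
  shows "((\<lambda>x. blinfun_apply (blinfun_apply (L x) u) v) has_derivative (\<lambda>w. blinfun_apply (blinfun_apply (L' w) u) v)) (at x)"
  by (auto intro!: derivative_eq_intros assms simp: blinfun.bilinear_simps)

lemma has_derivative_eq_on_open: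
  assumes "(f has_derivative f') (at x)" "(g has_derivative g') (at x)" "open S" "x \<in> S"
    and "\<And>z. z \<in> S \<Longrightarrow> f z = g z"
  shows "f' v = g' v"
proof -
  have "(g has_derivative f') (at x)"
    by (rule has_derivative_transform_within_open[OF assms(1,3,4)]) (rule assms(5))
  then show ?thesis
    using assms(2) has_derivative_unique by metis
qed

context riemannian_chart
begin

text \<open>The curvature operator R(u, v) z of h.\<close>

definition \<Omega> :: "real ^ 'n \<Rightarrow> real ^ 'n \<Rightarrow> real ^ 'n \<Rightarrow> real ^ 'n \<Rightarrow> real ^ 'n" where
  "\<Omega> x u v z = \<Gamma>1 x u v z - \<Gamma>1 x v u z + \<Gamma> x u (\<Gamma> x v z) - \<Gamma> x v (\<Gamma> x u z)"

lemma h1_has_derivative: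
  assumes "x \<in> U"
  shows "(h1 has_derivative blinfun_apply (blinfun_derivative h1 x)) (at x)"
  using Ck_on_Suc_has_derivative[of 0 h1 U x] Ck_on_blinfun_derivative[of U 1 h] h_C2 open_U assms
  by (simp add: numeral_2_eq_2)

lemma \<Gamma>1_symmetric:
  assumes "x \<in> U"
  shows "\<Gamma>1 x w u v = \<Gamma>1 x w v u"
  by (rule has_derivative_eq_on_open[OF has_derivative_blinfun_apply2[OF \<Gamma>_has_derivative]
        has_derivative_blinfun_apply2[OF \<Gamma>_has_derivative] open_U]) (use assms \<Gamma>_sym in auto)

text \<open>Differentiate the compatibility of \<Gamma> with h once more: the second derivative of h
  is symmetric in its two directions, and antisymmetrizing the right hand side gives the
  claim.\<close>

lemma \<Omega>_skew_h:
  assumes "x \<in> U"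
  shows "h x (\<Omega> x a b u) v = - h x u (\<Omega> x a b v)"
proof -
  have 1: "blinfun_derivative h1 x z w u v = h x (\<Gamma> x z (\<Gamma> x w u)) v + h x (\<Gamma> x w u) (\<Gamma> x z v)
      + h x (\<Gamma>1 x z w u) v + (h x (\<Gamma> x z u) (\<Gamma> x w v) + h x u (\<Gamma> x z (\<Gamma> x w v)) + h x u (\<Gamma>1 x z w v))"
    for z w
  proof -
    note d = h_has_derivative[OF assms] \<Gamma>_has_derivative[OF assms]
    have "((\<lambda>x. h1 x w u v) has_derivative (\<lambda>z. blinfun_derivative h1 x z w u v)) (at x)"
      by (auto intro!: derivative_eq_intros h1_has_derivative[OF assms] simp: blinfun.bilinear_simps)
    moreover have "((\<lambda>x. h x (\<Gamma> x w u) v + h x u (\<Gamma> x w v)) has_derivative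
        (\<lambda>z. h1 x z (\<Gamma> x w u) v + h x (\<Gamma>1 x z w u) v + (h1 x z u (\<Gamma> x w v) + h x u (\<Gamma>1 x z w v)))) (at x)"
      by (auto intro!: derivative_eq_intros d simp: blinfun.bilinear_simps fun_eq_iff)
    ultimately show ?thesis
      using has_derivative_eq_on_open[OF _ _ open_U assms h_deriv] by (fastforce simp: h_deriv[OF assms])
  qed
  have "blinfun_derivative h1 x a b u v = blinfun_derivative h1 x b a u v"
    using blinfun_derivative_symmetric[OF open_U assms h_C2] by metis
  then show ?thesis
    unfolding 1 \<Omega>_def by (simp add: blinfun.bilinear_simps algebra_simps)
qed

lemma linear_\<Omega>: "linear (\<Omega> x a b)" "linear (\<lambda>a. \<Omega> x a b z)" "linear (\<lambda>b. \<Omega> x a b z)"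
  by (auto intro!: linearI simp: \<Omega>_def blinfun.bilinear_simps algebra_simps)

lemma tr_\<Omega>:
  assumes "x \<in> U"
  shows "tr (\<Omega> x a b) = 0"
proof -
  have "tr (\<Omega> x a b) = tr (\<lambda>v. - \<Omega> x a b v)"
    by (rule tr_adjoint[OF assms linear_\<Omega>(1) linear_compose_neg[OF linear_\<Omega>(1)]])
      (simp add: \<Omega>_skew_h[OF assms] blinfun.bilinear_simps)
  then show ?thesis
    by (simp add: tr_minus)
qed

text \<open>The Ricci tensor: the trace of v \<mapsto> R(v, y) z with its four coordinate terms
  traced one by one, as \<open>tr_\<Omega>_left\<close> confirms.\<close>

definition Rc :: "real ^ 'n \<Rightarrow> real ^ 'n \<Rightarrow> real ^ 'n \<Rightarrow> real" where
  "Rc x y z = tr (\<lambda>v. \<Gamma>1 x v y z) - tr (\<Gamma>1 x y z) + tr (\<Gamma> x (\<Gamma> x y z)) - tr (\<lambda>v. \<Gamma> x y (\<Gamma> x z v))"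

text \<open>The term that is not visibly symmetric is \<open>tr (\<Gamma>1 x y z)\<close>, and its
  antisymmetric part is the trace of the skew map \<open>\<Omega> x y z\<close>.\<close>

lemma Rc_sym:
  assumes "x \<in> U"
  shows "Rc x y z = Rc x z y"
proof -
  have "tr (\<Omega> x y z) = tr (\<Gamma>1 x y z) - tr (\<Gamma>1 x z y)
      + tr (\<lambda>v. \<Gamma> x y (\<Gamma> x z v)) - tr (\<lambda>v. \<Gamma> x z (\<Gamma> x y v))"
    unfolding \<Omega>_def by (simp only: tr_simps)
  moreover have "tr (\<lambda>v. \<Gamma> x y (\<Gamma> x z v)) = tr (\<lambda>v. \<Gamma> x z (\<Gamma> x y v))"
    by (rule tr_commute) simp_all
  ultimately have "tr (\<Gamma>1 x y z) = tr (\<Gamma>1 x z y)"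
    using tr_\<Omega>[OF assms] by simp
  moreover have "\<Gamma>1 x v y z = \<Gamma>1 x v z y" for v
    by (rule \<Gamma>1_symmetric[OF assms])
  ultimately show ?thesis
    unfolding Rc_def using tr_commute[of "\<Gamma> x y" "\<Gamma> x z"] \<Gamma>_sym[OF assms, of y z] by simp
qed

lemma Rc_add: "Rc x (y + y') z = Rc x y z + Rc x y' z"
  and Rc_scale: "Rc x (c *\<^sub>R y) z = c * Rc x y z"
  by (simp_all add: Rc_def blinfun.bilinear_simps tr_simps tr_blinfun_add tr_blinfun_scaleR algebra_simps)

text \<open>The right hand side is the shape in which the Ricci terms arise from the traces of
  \<open>qd\<close>; with c = F and w = W they complete the square at u.\<close>

lemma Rc_diff_square:
  assumes "x \<in> U"
  shows "Rc x (y - c *\<^sub>R w) (y - c *\<^sub>R w) = Rc x y y - 2 * c * Rc x (y - (c / 2) *\<^sub>R w) w"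
proof -
  have l: "Rc x (a - c *\<^sub>R b) z = Rc x a z - c * Rc x b z" for a b z c
    using Rc_add[of x a "(- c) *\<^sub>R b" z] Rc_scale[of x "- c" b z] by simp
  have r: "Rc x z (a - c *\<^sub>R b) = Rc x z a - c * Rc x z b" for a b z
    using l Rc_sym[OF assms] by metis
  show ?thesis
    unfolding l r using Rc_sym[OF assms, of w y] by (simp add: algebra_simps)
qed

lemma tr_\<Gamma>_left: "x \<in> U \<Longrightarrow> tr (\<lambda>v. \<Gamma> x v z) = tr (\<Gamma> x z)"
  by (rule arg_cong[of _ _ tr], rule ext, rule \<Gamma>_sym)


end

text \<open>\<open>homothety\<close> says that the Lie derivative of h along W is -4 \<sigma> h. The
  dilation -\<sigma> refers to the norm, which the complete lift of W multiplies by -2 \<sigma>;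
  squaring doubles the factor.\<close>

locale randers_homothetic = randers_chart U h \<Gamma> W B
  for U :: "(real ^ 'n::finite) set"
    and h :: "real ^ 'n \<Rightarrow> (real ^ 'n) \<Rightarrow>\<^sub>L (real ^ 'n) \<Rightarrow>\<^sub>L real"
    and \<Gamma> :: "real ^ 'n \<Rightarrow> (real ^ 'n) \<Rightarrow>\<^sub>L (real ^ 'n) \<Rightarrow>\<^sub>L (real ^ 'n)"
    and W B +
  fixes \<sigma> :: real
  assumes W_C2: "Ck_on 2 W U"
    and homothety: "x \<in> U \<Longrightarrow> h x (B x u) v + h x u (B x v) = - 4 * \<sigma> * h x u v"
begin

abbreviation "B1 \<equiv> blinfun_derivative B"

text \<open>The skew part of the covariant derivative of W; the symmetric part is -2 \<sigma> times
  the identity.\<close>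

definition A :: "real ^ 'n \<Rightarrow> (real ^ 'n) \<Rightarrow>\<^sub>L (real ^ 'n)" where
  "A x = B x + (2 * \<sigma>) *\<^sub>R id_blinfun"

lemma A_apply: "A x u = B x u + (2 * \<sigma>) *\<^sub>R u"
  by (simp add: A_def blinfun.bilinear_simps)

lemma A_skew: "x \<in> U \<Longrightarrow> h x (A x u) v = - h x u (A x v)"
  using homothety[of x u v] by (simp add: A_apply blinfun.bilinear_simps algebra_simps)

lemma A_skew0: "x \<in> U \<Longrightarrow> h x u (A x u) = 0"
  using A_skew[of x u u] h_sym[of x u "A x u"] by simp

lemma tr_A:
  assumes "x \<in> U"
  shows "tr (A x) = 0"
proof -
  have "tr (A x) = tr (\<lambda>v. - A x v)"
    by (rule tr_adjoint[OF assms linear_blinfun linear_compose_neg[OF linear_blinfun]])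
      (simp add: A_skew[OF assms] blinfun.bilinear_simps)
  then show ?thesis
    by (simp add: tr_minus)
qed

lemma tr_B: "x \<in> U \<Longrightarrow> tr (B x) = - 2 * \<sigma> * real CARD('n)"
  using tr_A[of x] by (simp add: A_def tr_blinfun_add tr_blinfun_scaleR tr_id)

lemma B_has_derivative: "x \<in> U \<Longrightarrow> (B has_derivative blinfun_apply (B1 x)) (at x)"
  using Ck_on_Suc_has_derivative[of 0 B U] B_C1 open_U by simp

lemma A_has_derivative: "x \<in> U \<Longrightarrow> (A has_derivative blinfun_apply (B1 x)) (at x)"
  unfolding A_def by (auto intro!: derivative_eq_intros B_has_derivative)

abbreviation "W1 \<equiv> blinfun_derivative W"

lemma W1_eq:
  assumes "x \<in> U"
  shows "W1 x v = B x v - \<Gamma> x v (W x)"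
proof -
  have "W differentiable (at x)"
    using W_has_derivative[OF assms] by (auto simp: differentiable_def)
  from has_derivative_unique[OF has_derivative_blinfun_derivative[OF this] W_has_derivative[OF assms]]
  show ?thesis
    by (simp add: fun_eq_iff)
qed

text \<open>The second covariant derivative of W.\<close>

definition nabB :: "real ^ 'n \<Rightarrow> real ^ 'n \<Rightarrow> real ^ 'n \<Rightarrow> real ^ 'n" where
  "nabB x w z = B1 x w z + \<Gamma> x w (B x z) - B x (\<Gamma> x w z)"

text \<open>The symmetry of the second derivative of W, with the first derivative expressed by B and
  \<Gamma>; in covariant terms it is the Ricci identity for W.\<close>

lemma B1_commute:
  assumes "x \<in> U"
  shows "B1 x u v - \<Gamma>1 x u v (W x) - \<Gamma> x v (B x u - \<Gamma> x u (W x))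
    = B1 x v u - \<Gamma>1 x v u (W x) - \<Gamma> x u (B x v - \<Gamma> x v (W x))"
proof -
  have "Ck_on 1 (blinfun_derivative W) U"
    using Ck_on_blinfun_derivative[of U 1 W] W_C2 open_U by (simp add: numeral_2_eq_2)
  then have d: "(blinfun_derivative W has_derivative blinfun_apply (blinfun_derivative (blinfun_derivative W) x)) (at x)"
    using Ck_on_Suc_has_derivative[of 0 "blinfun_derivative W" U] open_U assms by simp
  have eq: "blinfun_derivative (blinfun_derivative W) x u v
      = B1 x u v - \<Gamma>1 x u v (W x) - \<Gamma> x v (B x u - \<Gamma> x u (W x))" for u v
  proof -
    have "((\<lambda>x. blinfun_derivative W x v) has_derivative (\<lambda>u. blinfun_derivative (blinfun_derivative W) x u v)) (at x)"
      by (auto intro!: derivative_eq_intros d)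
    moreover have "((\<lambda>x. B x v - \<Gamma> x v (W x)) has_derivative
        (\<lambda>u. B1 x u v - \<Gamma>1 x u v (W x) - \<Gamma> x v (B x u - \<Gamma> x u (W x)))) (at x)"
      by (auto intro!: derivative_eq_intros B_has_derivative[OF assms] \<Gamma>_has_derivative[OF assms]
          W_has_derivative[OF assms] simp: blinfun.bilinear_simps fun_eq_iff)
    ultimately show ?thesis
      by (rule has_derivative_eq_on_open[OF _ _ open_U assms W1_eq])
  qed
  show ?thesis
    using blinfun_derivative_symmetric[OF open_U assms W_C2, of u v] unfolding eq .
qed

lemma tr_B1:
  assumes "x \<in> U"
  shows "tr (B1 x z) = 0"
proof -
  have "((\<lambda>x. tr (B x)) has_derivative (\<lambda>z. tr (B1 x z))) (at x)"
    unfolding tr_def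
    by (auto intro!: derivative_eq_intros bounded_linear.has_derivative[OF bounded_linear_vec_nth]
        B_has_derivative[OF assms])
  then show ?thesis
    by (rule has_derivative_eq_on_open[OF _ has_derivative_const open_U assms tr_B])
qed

text \<open>The commutation formula for the second covariant derivatives of \<open>W\<close>, contracted; the
  divergence of \<open>W\<close> is constant.\<close>

lemma tr_nabB:
  assumes "x \<in> U"
  shows "tr (\<lambda>v. nabB x v z) = Rc x z (W x)"
proof -
  have 1: "nabB x v z = B1 x z v + \<Gamma>1 x v z (W x) - \<Gamma>1 x z (W x) v + \<Gamma> x z (B x v) - \<Gamma> x z (\<Gamma> x (W x) v)
      - \<Gamma> x (B x z) v + \<Gamma> x (\<Gamma> x z (W x)) v + \<Gamma> x (B x z) v - B x (\<Gamma> x z v)" for v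
    unfolding nabB_def using B1_commute[OF assms, of v z] \<Gamma>_sym[OF assms, of v] \<Gamma>1_symmetric[OF assms, of z v]
    by (simp add: blinfun.bilinear_simps algebra_simps)
  show ?thesis
    unfolding 1 using tr_commute[of "\<Gamma> x z" "B x"]
    by (simp add: tr_simps Rc_def tr_B1[OF assms])
qed

text \<open>Homothety turns the adjoint of B into -4 \<sigma> - B and the shear of u into -2
  \<sigma> F^2, so the quotient by F disappears.\<close>

lemma Q_homothetic:
  assumes "x \<in> U" "y \<noteq> 0"
  shows "Q x y = \<sigma> *\<^sub>R (F x y *\<^sub>R y) - F x y *\<^sub>R A x y + (1/2) *\<^sub>R ((F x y * F x y) *\<^sub>R A x (W x))"
proof -
  have f: "F x y > 0"
    using F_pos[OF assms] .
  have adj: "adj x u = - (4 * \<sigma>) *\<^sub>R u - B x u" for u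
    by (rule h_eqI[OF assms(1)])
      (use homothety[OF assms(1)] in \<open>simp add: h_adj[OF assms(1)] blinfun.bilinear_simps algebra_simps\<close>)
  have shear: "shear x (yt x y) = - 2 * \<sigma> * (F x y * F x y)"
    using homothety[OF assms(1), of "yt x y" "yt x y"] h_sym[OF assms(1), of "B x (yt x y)"]
      h_yt_yt[OF assms] by (simp add: shear_def power2_eq_square)
  show ?thesis
    unfolding Q_def shear adj using f
    by (simp add: A_apply yt_def blinfun.bilinear_simps vec_eq_iff) (simp add: field_simps)
qed

definition qd :: "real ^ 'n \<Rightarrow> real ^ 'n \<Rightarrow> real ^ 'n \<Rightarrow> real ^ 'n \<Rightarrow> real ^ 'n" where
  "qd x y w e = Fd x y w e *\<^sub>R (\<sigma> *\<^sub>R y - A x (yt x y)) + F x y *\<^sub>R (\<sigma> *\<^sub>R e - A x e)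
    - F x y *\<^sub>R nabB x w (y - (F x y / 2) *\<^sub>R W x) + (1/2) *\<^sub>R ((F x y * F x y) *\<^sub>R A x (B x w))"

lemma cov_A [cov_intros]:
  assumes "x \<in> U" "cov_v Z Z' x y"
  shows "cov_v (\<lambda>x y. A x (Z x y)) (\<lambda>w e. nabB x w (Z x y) + A x (Z' w e)) x y"
  by (rule cov_v_eq_rhs[OF cov_v_endo[OF A_has_derivative assms(2)]])
    (use assms in \<open>auto simp: nabB_def A_apply blinfun.bilinear_simps algebra_simps\<close>)

lemma cov_Q:
  assumes "x \<in> U" "y \<noteq> 0"
  shows "cov_v Q (qd x y) x y"
proof -
  have *: "cov_v (\<lambda>x y. \<sigma> *\<^sub>R (F x y *\<^sub>R y) - F x y *\<^sub>R A x y + (1/2) *\<^sub>R ((F x y * F x y) *\<^sub>R A x (W x)))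
      (qd x y) x y"
    by (rule cov_v_eq_rhs, (rule cov_intros assms)+)
      (simp add: qd_def nabB_def yt_def[of x y] blinfun.bilinear_simps vec_eq_iff, simp add: field_simps)
  show ?thesis
    by (rule cov_v_cong[OF * assms]) (simp add: Q_homothetic)
qed

end

section \<open>The Ricci curvature\<close>

lemma tr_compose:
  fixes f :: "real ^ 'n \<Rightarrow> real ^ 'n"
  assumes "linear f"
  shows "tr (\<lambda>v. f (f v)) = (\<Sum>i\<in>UNIV. \<Sum>j\<in>UNIV. f (axis j 1) $ i * f (axis i 1) $ j)"
proof -
  have "f z $ i = (\<Sum>j\<in>UNIV. z $ j * f (axis j 1) $ i)" for z i
    using arg_cong[OF linear_vec_expansion[OF assms, of z], of "\<lambda>v. v $ i"] by simp
  from this[of "f (axis i 1)" i for i] show ?thesis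
    by (simp only: tr_def mult.commute)
qed

text \<open>The second derivatives in the curvature of a spray combine into one derivative along the
  spray direction (y, -2 G).\<close>

lemma sum_partials:
  fixes D :: "(real ^ 'n) \<times> (real ^ 'n) \<Rightarrow> real"
  assumes "linear D"
  shows "(\<Sum>j\<in>UNIV. D (axis j 1, 0) * y $ j) - 2 * (\<Sum>j\<in>UNIV. g $ j * D (0, axis j 1)) = D (y, - 2 *\<^sub>R g)"
proof -
  have "linear (\<lambda>v. (v, 0) :: (real ^ 'n) \<times> (real ^ 'n))" "linear (\<lambda>v. (0, v) :: (real ^ 'n) \<times> (real ^ 'n))"
    by (auto intro!: linearI)
  from this[THEN linear_compose[OF _ assms]]
  have "linear (\<lambda>v. D (v, 0))" "linear (\<lambda>v. D (0, v))"
    by (simp_all add: o_def)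
  from this[THEN linear_vec_expansion]
  have "(\<Sum>j\<in>UNIV. D (axis j 1, 0) * y $ j) = D (y, 0)" "(\<Sum>j\<in>UNIV. g $ j * D (0, axis j 1)) = D (0, g)"
    by (auto simp: mult.commute)
  moreover have "D (y, - 2 *\<^sub>R g) = D ((y, 0) + (- 2) *\<^sub>R (0, g))"
    by simp
  ultimately show ?thesis
    using linear_add[OF assms, of "(y, 0)" "(-2) *\<^sub>R (0, g)"] linear_cmul[OF assms, of "-2" "(0, g)"] by simp
qed

context randers_homothetic
begin

definition G :: "real ^ 'n \<Rightarrow> real ^ 'n \<Rightarrow> real ^ 'n" where
  "G x y = (1/2) *\<^sub>R \<Gamma> x y y + Q x y"

text \<open>The nonlinear connection of F, that is, the fibre derivative of the geodesic
  coefficients.\<close>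

definition N :: "real ^ 'n \<Rightarrow> real ^ 'n \<Rightarrow> real ^ 'n \<Rightarrow> real ^ 'n" where
  "N x y e = \<Gamma> x y e + qd x y 0 e"

lemma nabB_zero: "nabB x 0 z = 0"
  by (simp add: nabB_def blinfun.bilinear_simps)

lemma Fd_add: "Fd x y (w + w') (e + e') = Fd x y w e + Fd x y w' e'"
  and Fd_scale: "Fd x y (c *\<^sub>R w) (c *\<^sub>R e) = c * Fd x y w e"
  by (simp_all add: Fd_def blinfun.bilinear_simps algebra_simps diff_divide_distrib add_divide_distrib)

lemma qd_split: "qd x y w e = qd x y w 0 + qd x y 0 e"
  using Fd_add[of x y w 0 0 e]
  by (simp add: qd_def nabB_zero blinfun.bilinear_simps algebra_simps)

lemma linear_qd0: "linear (qd x y 0)"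
  using Fd_add[of x y 0 0] Fd_scale[of x y _ 0]
  by (intro linearI) (simp_all add: qd_def nabB_zero blinfun.bilinear_simps algebra_simps)

lemma linear_N: "linear (N x y)"
  using linear_add[OF linear_qd0] linear_cmul[OF linear_qd0]
  by (intro linearI) (simp_all add: N_def blinfun.bilinear_simps algebra_simps)

lemma G_has_derivative_snd:
  assumes "x \<in> U" "y \<noteq> 0"
  shows "(G x has_derivative N x y) (at y)"
  unfolding G_def[abs_def] using cov_v_has_derivative_snd[OF cov_Q[OF assms]]
  by (auto intro!: derivative_eq_intros simp: fun_eq_iff N_def \<Gamma>_sym[OF assms(1)])

lemma dy_spray:
  assumes "x \<in> U" "y \<noteq> 0"
  shows "dy j (spray_coeff F i) x y = N x y (axis j 1) $ i"
  by (rule dy_component[OF assms G_has_derivative_snd[OF assms]])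
    (simp add: spray_coeff_F[OF assms(1)] G_def)

lemma dx_spray:
  assumes "x \<in> U" "y \<noteq> 0"
  shows "dx j (spray_coeff F i) x y = ((1/2) *\<^sub>R \<Gamma>1 x (axis j 1) y y
    + (qd x y (axis j 1) (\<Gamma> x (axis j 1) y) - \<Gamma> x (axis j 1) (Q x y))) $ i"
proof -
  have "((\<lambda>x. G x y) has_derivative
      (\<lambda>w. (1/2) *\<^sub>R \<Gamma>1 x w y y + (qd x y w (\<Gamma> x w y) - \<Gamma> x w (Q x y)))) (at x)"
    unfolding G_def
    by (rule has_derivative_add[OF has_derivative_scaleR_right[OF has_derivative_blinfun_apply2[OF \<Gamma>_has_derivative[OF assms(1)]]]
          cov_v_has_derivative_fst[OF cov_Q[OF assms]]])
  then have "((\<lambda>x. G x y $ i) has_derivative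
      (\<lambda>w. ((1/2) *\<^sub>R \<Gamma>1 x w y y + (qd x y w (\<Gamma> x w y) - \<Gamma> x w (Q x y))) $ i)) (at x)"
    by (rule bounded_linear.has_derivative[OF bounded_linear_vec_nth])
  then have "((\<lambda>x. spray_coeff F i x y) has_derivative
      (\<lambda>w. ((1/2) *\<^sub>R \<Gamma>1 x w y y + (qd x y w (\<Gamma> x w y) - \<Gamma> x w (Q x y))) $ i)) (at x)"
    by (rule has_derivative_transform_within_open[OF _ open_U assms(1)])
      (simp add: spray_coeff_F[OF _ assms(2)] G_def)
  then show ?thesis
    unfolding dx_def by (subst frechet_derivative_eq) auto
qed

text \<open>Existence is enough: derivatives of N enter the Ricci curvature through its trace, whose
  value in \<open>tr_N\<close> can be differentiated directly.\<close>

lemma N_component_differentiable: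
  assumes "x \<in> U" "y \<noteq> 0"
  shows "\<exists>D. ((\<lambda>p. N (fst p) (snd p) c $ i) has_derivative D) (at (x, y))"
proof -
  have "root x y \<noteq> 0"
    using root_pos[OF assms] by simp
  then have "\<exists>Z'. cov_v (\<lambda>x y. (h x (yt x y) c / root x y) *\<^sub>R (\<sigma> *\<^sub>R y - A x (yt x y))
      + F x y *\<^sub>R (\<sigma> *\<^sub>R c - A x c)) Z' x y"
    by (intro exI) (rule cov_intros assms | assumption)+
  then obtain Z' where "cov_v (\<lambda>x y. (h x (yt x y) c / root x y) *\<^sub>R (\<sigma> *\<^sub>R y - A x (yt x y))
      + F x y *\<^sub>R (\<sigma> *\<^sub>R c - A x c)) Z' x y" ..
  then have "cov_v (\<lambda>x y. qd x y 0 c) Z' x y"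
    by (rule cov_v_cong[OF _ assms]) (simp add: qd_def nabB_zero Fd_def)
  then obtain D where D: "((\<lambda>p. qd (fst p) (snd p) 0 c) has_derivative D) (at (x, y))"
    unfolding cov_v_def by blast
  have \<Gamma>': "((\<lambda>p :: (real ^ 'n) \<times> (real ^ 'n). \<Gamma> (fst p)) has_derivative (\<lambda>q. \<Gamma>1 x (fst q))) (at (x, y))"
    by (rule has_derivative_comp_fst[OF \<Gamma>_has_derivative[OF assms(1)]])
  have "\<exists>D. ((\<lambda>p. N (fst p) (snd p) c) has_derivative D) (at (x, y))"
    unfolding N_def by (rule exI) (rule derivative_intros \<Gamma>' D)+
  then show ?thesis
    using bounded_linear.has_derivative[OF bounded_linear_vec_nth] by blast
qed

lemma tr_N:
  assumes "x \<in> U" "y \<noteq> 0"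
  shows "(\<Sum>i\<in>UNIV. N x y (axis i 1) $ i) = tr (\<Gamma> x y) + (real CARD('n) + 1) * \<sigma> * F x y"
proof -
  have "shear x (yt x y) = - 2 * \<sigma> * (F x y)\<^sup>2"
    using homothety[OF assms(1), of "yt x y" "yt x y"] h_sym[OF assms(1), of "B x (yt x y)"]
      h_yt_yt[OF assms] by (simp add: shear_def)
  then have "(real CARD('n) + 1) * shear x (yt x y) / (2 * F x y) = - ((real CARD('n) + 1) * \<sigma> * F x y)"
    using F_pos[OF assms] by (simp add: power2_eq_square)
  then show ?thesis
    using divergence_spray[OF assms] by (simp add: dy_spray[OF assms])
qed

text \<open>Trace and derivative along the spray are interchanged. The trace of N is that of
  \<Gamma> plus a multiple of F, and F is constant along the spray.\<close>

lemma sum_dx_dy_spray: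
  assumes "x \<in> U" "y \<noteq> 0"
  shows "(\<Sum>i\<in>UNIV. (\<Sum>j\<in>UNIV. dx j (dy i (spray_coeff F i)) x y * y $ j)
      - 2 * (\<Sum>j\<in>UNIV. G x y $ j * dy j (dy i (spray_coeff F i)) x y))
    = tr (\<Gamma>1 x y y) + tr (\<Gamma> x (- 2 *\<^sub>R G x y))"
proof -
  obtain D where D: "\<And>i. ((\<lambda>p. N (fst p) (snd p) (axis i 1) $ i) has_derivative D i) (at (x, y))"
    using choice[of "\<lambda>i D. ((\<lambda>p. N (fst p) (snd p) (axis i 1) $ i) has_derivative D) (at (x, y))"]
      N_component_differentiable[OF assms] by auto
  have op: "open (U \<times> (- {0 :: real ^ 'n}))" "(x, y) \<in> U \<times> (- {0})"
    using open_U assms by (auto intro: open_Times)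
  have D': "((\<lambda>p. dy i (spray_coeff F i) (fst p) (snd p)) has_derivative D i) (at (x, y))" for i
    by (rule has_derivative_transform_within_open[OF D op]) (simp add: dy_spray mem_Times_iff)
  from has_derivative_slice_fst[OF D'] have "dx j (dy i (spray_coeff F i)) x y = D i (axis j 1, 0)" for i j
    unfolding dx_def by (subst frechet_derivative_eq) auto
  moreover from has_derivative_slice_snd[OF D'] have "dy j (dy i (spray_coeff F i)) x y = D i (0, axis j 1)" for i j
    unfolding dy_def by (subst frechet_derivative_eq) auto
  moreover have "linear (D i)" for i
    using D has_derivative_linear by blast
  ultimately have 1: "(\<Sum>i\<in>UNIV. (\<Sum>j\<in>UNIV. dx j (dy i (spray_coeff F i)) x y * y $ j)
      - 2 * (\<Sum>j\<in>UNIV. G x y $ j * dy j (dy i (spray_coeff F i)) x y))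
    = (\<Sum>i\<in>UNIV. D i (y, - 2 *\<^sub>R G x y))"
    by (simp add: sum_partials)
  have S: "((\<lambda>p. \<Sum>i\<in>UNIV. N (fst p) (snd p) (axis i 1) $ i) has_derivative (\<lambda>q. \<Sum>i\<in>UNIV. D i q)) (at (x, y))"
    by (intro has_derivative_sum D)
  have \<Gamma>': "((\<lambda>p :: (real ^ 'n) \<times> (real ^ 'n). \<Gamma> (fst p)) has_derivative (\<lambda>q. \<Gamma>1 x (fst q))) (at (x, y))"
    by (rule has_derivative_comp_fst[OF \<Gamma>_has_derivative[OF assms(1)]])
  have "((\<lambda>p. tr (\<Gamma> (fst p) (snd p)) + (real CARD('n) + 1) * \<sigma> * F (fst p) (snd p)) has_derivative
      (\<lambda>q. tr (\<Gamma>1 x (fst q) y) + tr (\<Gamma> x (snd q))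
        + (real CARD('n) + 1) * \<sigma> * Fd x y (fst q) (snd q + \<Gamma> x (fst q) y))) (at (x, y))"
    unfolding tr_def using cov_F[OF assms, unfolded cov_s_def]
    by (auto intro!: derivative_eq_intros \<Gamma>' bounded_linear.has_derivative[OF bounded_linear_vec_nth]
        simp: fun_eq_iff blinfun.bilinear_simps sum.distrib)
  from has_derivative_eq_on_open[OF S this op, of "(y, - 2 *\<^sub>R G x y)"]
  have "(\<Sum>i\<in>UNIV. D i (y, - 2 *\<^sub>R G x y)) = tr (\<Gamma>1 x y y) + tr (\<Gamma> x (- 2 *\<^sub>R G x y))
      + (real CARD('n) + 1) * \<sigma> * Fd x y y (- 2 *\<^sub>R G x y + \<Gamma> x y y)"
    by (simp add: tr_N mem_Times_iff)
  also have "- 2 *\<^sub>R G x y + \<Gamma> x y y = - 2 *\<^sub>R Q x y"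
    by (simp add: G_def scaleR_add_right)
  finally show ?thesis
    unfolding 1 by (simp add: spray_F_zero[OF assms] del: scaleR_minus_left)
qed

text \<open>The Christoffel terms assemble into the Ricci tensor of h and leave traces of the
  derivative of Q; the divergence of Q contributes nothing because F is constant along the
  spray.\<close>

lemma Ric_F_traces:
  assumes "x \<in> U" "y \<noteq> 0"
  shows "Ric F x y = Rc x y y + 2 * tr (\<lambda>w. qd x y w 0) - tr (\<lambda>v. qd x y 0 (qd x y 0 v))"
proof -
  have "Ric F x y = (\<Sum>i\<in>UNIV. 2 * dx i (spray_coeff F i) x y)
    - (\<Sum>i\<in>UNIV. (\<Sum>j\<in>UNIV. dx j (dy i (spray_coeff F i)) x y * y $ j)
      - 2 * (\<Sum>j\<in>UNIV. G x y $ j * dy j (dy i (spray_coeff F i)) x y))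
    - (\<Sum>i\<in>UNIV. \<Sum>j\<in>UNIV. dy j (spray_coeff F i) x y * dy i (spray_coeff F j) x y)"
    by (simp add: Ric_def riemann_curv_def Let_def sum.distrib sum_subtractf spray_coeff_F[OF assms] G_def)
  also have "(\<Sum>i\<in>UNIV. \<Sum>j\<in>UNIV. dy j (spray_coeff F i) x y * dy i (spray_coeff F j) x y)
      = tr (\<lambda>v. N x y (N x y v))"
    by (simp add: tr_compose[OF linear_N] dy_spray[OF assms])
  also have "tr (\<lambda>v. N x y (N x y v)) = tr (\<lambda>v. \<Gamma> x y (\<Gamma> x y v)) + 2 * tr (\<lambda>v. qd x y 0 (\<Gamma> x y v))
      + tr (\<lambda>v. qd x y 0 (qd x y 0 v))"
    using tr_commute[OF linear_blinfun linear_qd0, of "\<Gamma> x y" x y]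
    by (simp add: N_def linear_add[OF linear_qd0] blinfun.bilinear_simps tr_simps)
  also have "(\<Sum>i\<in>UNIV. 2 * dx i (spray_coeff F i) x y) = tr (\<lambda>w. \<Gamma>1 x w y y)
      + 2 * tr (\<lambda>w. qd x y w 0) + 2 * tr (\<lambda>w. qd x y 0 (\<Gamma> x y w)) - 2 * tr (\<Gamma> x (Q x y))"
  proof -
    have "(\<Sum>i\<in>UNIV. 2 * dx i (spray_coeff F i) x y) = 2 * tr (\<lambda>w. (1/2) *\<^sub>R \<Gamma>1 x w y y
        + (qd x y w (\<Gamma> x w y) - \<Gamma> x w (Q x y)))"
      by (simp only: tr_def dx_spray[OF assms] sum_distrib_left)
    also have "\<dots> = 2 * tr (\<lambda>w. (1/2) *\<^sub>R \<Gamma>1 x w y y + ((qd x y w 0 + qd x y 0 (\<Gamma> x y w)) - \<Gamma> x w (Q x y)))"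
      using qd_split[of x y] \<Gamma>_sym[OF assms(1), of _ y] by metis
    finally show ?thesis
      by (simp only: tr_simps tr_\<Gamma>_left[OF assms(1)]) (simp add: algebra_simps)
  qed
  also note sum_dx_dy_spray[OF assms]
  also have "tr (\<Gamma> x (- 2 *\<^sub>R G x y)) = - tr (\<Gamma> x (\<Gamma> x y y)) - 2 * tr (\<Gamma> x (Q x y))"
    by (simp add: tr_blinfun_scaleR tr_blinfun_add G_def blinfun.add_right blinfun.scaleR_right
        blinfun.minus_right scaleR_add_right)
      (simp add: tr_def blinfun.bilinear_simps sum_negf sum.distrib sum_distrib_left sum_subtractf)
  finally show ?thesis
    by (simp add: Rc_def)
qed

text \<open>The fibre derivative of Q is a rank one map plus F times E, so the traces reduce to
  values of \<phi>. The trace of A A and the value \<phi>(A p) cancel between the two traces; since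
  \<phi>(p) = \<sigma> F, the coefficient of \<sigma>^2 F^2 is 4 - 1 - 2 - n.\<close>

theorem Ric_F:
  assumes "x \<in> U" "y \<noteq> 0"
  shows "Ric F x y = Rc x (yt x y) (yt x y) - (real CARD('n) - 1) * \<sigma>\<^sup>2 * (F x y)\<^sup>2"
proof -
  let ?u = "yt x y" and ?R = "root x y" and ?f = "F x y"
  have R: "?R > 0" and f: "?f > 0"
    using root_pos F_pos assms by blast+
  define p where "p = \<sigma> *\<^sub>R y - A x ?u"
  define \<phi> where "\<phi> e = h x ?u e / ?R" for e
  have \<phi>_lin: "linear \<phi>"
    by (rule linearI) (simp_all add: \<phi>_def blinfun.bilinear_simps add_divide_distrib)
  note \<phi>_simps = linear_add[OF \<phi>_lin] linear_diff[OF \<phi>_lin] linear_cmul[OF \<phi>_lin] linear_neg[OF \<phi>_lin]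
  have "h x ?u y = h x ?u ?u + ?f * h x ?u (W x)"
    by (simp add: yt_def[of x y] blinfun.bilinear_simps)
  also have "\<dots> = ?f * ?R"
    using h_yt_yt[OF assms] root_eq[OF assms(1), of y] by (simp add: power2_eq_square algebra_simps)
  finally have "\<phi> y = ?f"
    using R by (simp add: \<phi>_def)
  moreover have "\<phi> (A x ?u) = 0"
    by (simp add: \<phi>_def A_skew0[OF assms(1)])
  ultimately have \<phi>p: "\<phi> p = \<sigma> * ?f"
    by (simp add: p_def \<phi>_simps)
  define E where "E v = \<sigma> *\<^sub>R v - A x v" for v
  have E_lin: "linear E"
    by (rule linearI) (simp_all add: E_def blinfun.bilinear_simps algebra_simps)
  have qv: "qd x y 0 v = \<phi> v *\<^sub>R p + ?f *\<^sub>R E v" for v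
    by (simp add: qd_def p_def \<phi>_def E_def Fd_def nabB_zero)
  have "tr (\<lambda>v. qd x y 0 (qd x y 0 v)) = tr (\<lambda>v. (\<phi> v * \<phi> p) *\<^sub>R p + (?f * \<phi> (E v)) *\<^sub>R p
      + (?f * \<phi> v) *\<^sub>R E p + (?f * ?f) *\<^sub>R E (E v))"
    unfolding qv by (simp add: \<phi>_simps linear_add[OF E_lin] linear_cmul[OF E_lin] algebra_simps)
  also have "\<dots> = \<phi> p * \<phi> p + 2 * ?f * \<phi> (E p) + ?f * ?f * tr (\<lambda>v. E (E v))"
  proof -
    have "linear (\<lambda>v. \<phi> v * \<phi> p)" "linear (\<lambda>v. ?f * \<phi> (E v))" "linear (\<lambda>v. ?f * \<phi> v)"
      by (auto intro!: linearI simp: \<phi>_simps linear_add[OF E_lin] linear_cmul[OF E_lin] algebra_simps)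
    then show ?thesis
      by (simp add: tr_simps tr_rank1)
  qed
  also have "tr (\<lambda>v. E (E v)) = \<sigma> * \<sigma> * real CARD('n) + tr (\<lambda>v. A x (A x v))"
  proof -
    have "E (E v) = ((\<sigma> * \<sigma>) *\<^sub>R v - \<sigma> *\<^sub>R A x v) - (\<sigma> *\<^sub>R A x v - A x (A x v))" for v
      by (simp add: E_def blinfun.bilinear_simps scaleR_diff_right)
    then show ?thesis
      by (simp only: tr_simps tr_id tr_A[OF assms(1)])
  qed
  finally have t2: "tr (\<lambda>v. qd x y 0 (qd x y 0 v)) = \<phi> p * \<phi> p + 2 * ?f * \<phi> (E p)
      + ?f * ?f * (\<sigma> * \<sigma> * real CARD('n) + tr (\<lambda>v. A x (A x v)))" .
  have AB: "B x w = A x w - (2 * \<sigma>) *\<^sub>R w" for w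
    by (simp add: A_apply)
  have qh: "qd x y w 0 = (2 * \<sigma> * ?f * \<phi> w - ?f * \<phi> (A x w)) *\<^sub>R p
      - ?f *\<^sub>R nabB x w (y - (?f / 2) *\<^sub>R W x)
      + (1/2) *\<^sub>R ((?f * ?f) *\<^sub>R (A x (A x w) - (2 * \<sigma>) *\<^sub>R A x w))" for w
  proof -
    have "Fd x y w 0 = 2 * \<sigma> * ?f * \<phi> w - ?f * \<phi> (A x w)"
      using R by (simp add: Fd_def \<phi>_def AB blinfun.bilinear_simps field_simps)
    then show ?thesis
      by (simp add: qd_def p_def AB[of w] blinfun.bilinear_simps)
  qed
  have t1: "tr (\<lambda>w. qd x y w 0) = 2 * \<sigma> * ?f * \<phi> p - ?f * \<phi> (A x p)
      - ?f * Rc x (y - (?f / 2) *\<^sub>R W x) (W x) + (1/2) * (?f * ?f * tr (\<lambda>w. A x (A x w)))"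
  proof -
    have "linear (\<lambda>w. 2 * \<sigma> * ?f * \<phi> w - ?f * \<phi> (A x w))"
      by (rule linearI) (simp_all add: \<phi>_simps blinfun.bilinear_simps algebra_simps)
    then show ?thesis
      unfolding qh by (simp only: tr_simps tr_rank1 tr_nabB[OF assms(1)] tr_A[OF assms(1)]) simp
  qed
  have "Ric F x y = Rc x y y - 2 * ?f * Rc x (y - (?f / 2) *\<^sub>R W x) (W x)
      - (real CARD('n) - 1) * \<sigma>\<^sup>2 * ?f\<^sup>2"
    unfolding Ric_F_traces[OF assms] t1 t2 by (simp add: E_def \<phi>_simps \<phi>p algebra_simps power2_eq_square)
  then show ?thesis
    using Rc_diff_square[OF assms(1), of y ?f "W x"] by (simp add: yt_def)
qed

end

section \<open>Schur's lemma\<close>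

context riemannian_chart
begin

abbreviation "\<Gamma>2 \<equiv> blinfun_derivative \<Gamma>1"

lemma \<Gamma>1_has_derivative:
  assumes "x \<in> U"
  shows "(\<Gamma>1 has_derivative blinfun_apply (\<Gamma>2 x)) (at x)"
  using Ck_on_Suc_has_derivative[of 0 \<Gamma>1 U x] Ck_on_blinfun_derivative[of U 1 \<Gamma>] \<Gamma>_C2 open_U assms
  by (simp add: numeral_2_eq_2)

lemma \<Gamma>2_symmetric: "x \<in> U \<Longrightarrow> \<Gamma>2 x u v = \<Gamma>2 x v u"
  using blinfun_derivative_symmetric[OF open_U _ \<Gamma>_C2] .

definition d\<Omega> where
  "d\<Omega> x w a b z = \<Gamma>2 x w a b z - \<Gamma>2 x w b a z
    + (\<Gamma>1 x w a (\<Gamma> x b z) + \<Gamma> x a (\<Gamma>1 x w b z)) - (\<Gamma>1 x w b (\<Gamma> x a z) + \<Gamma> x b (\<Gamma>1 x w a z))"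

lemma \<Omega>_has_derivative:
  assumes "x \<in> U"
  shows "((\<lambda>x. \<Omega> x a b z) has_derivative (\<lambda>w. d\<Omega> x w a b z)) (at x)"
  unfolding \<Omega>_def d\<Omega>_def
  by (auto intro!: derivative_eq_intros \<Gamma>_has_derivative[OF assms] \<Gamma>1_has_derivative[OF assms]
      simp: blinfun.bilinear_simps fun_eq_iff)

definition nab\<Omega> where
  "nab\<Omega> x w a b z = d\<Omega> x w a b z + \<Gamma> x w (\<Omega> x a b z) - \<Omega> x a b (\<Gamma> x w z)
    - \<Omega> x (\<Gamma> x w a) b z - \<Omega> x a (\<Gamma> x w b) z"

lemma \<Omega>_skew: "\<Omega> x b a z = - \<Omega> x a b z"
  by (simp add: \<Omega>_def)

lemma nab\<Omega>_skew: "nab\<Omega> x w b a z = - nab\<Omega> x w a b z"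
  unfolding nab\<Omega>_def using \<Omega>_skew[of x b a] \<Omega>_skew[of x "\<Gamma> x w b" a] \<Omega>_skew[of x b "\<Gamma> x w a"]
  by (simp add: d\<Omega>_def blinfun.bilinear_simps algebra_simps)

lemma linear_nab\<Omega>: "linear (\<lambda>a. nab\<Omega> x w a b z)"
  by (rule linearI) (simp_all add: nab\<Omega>_def d\<Omega>_def \<Omega>_def blinfun.bilinear_simps algebra_simps)

text \<open>In the cyclic sum the corrections with \<Gamma> inserted into \<Omega> cancel because
  \<Gamma> is symmetric and \<Omega> skew; the second derivatives of \<Gamma> cancel by their own
  symmetry.\<close>

lemma second_bianchi:
  assumes "x \<in> U"
  shows "nab\<Omega> x w a b z + nab\<Omega> x a b w z + nab\<Omega> x b w a z = 0"
proof -
  have s: "\<Gamma> x a w = \<Gamma> x w a" "\<Gamma> x b w = \<Gamma> x w b" "\<Gamma> x b a = \<Gamma> x a b"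
    "\<Gamma>2 x a w = \<Gamma>2 x w a" "\<Gamma>2 x b w = \<Gamma>2 x w b" "\<Gamma>2 x b a = \<Gamma>2 x a b"
    using \<Gamma>_sym[OF assms] \<Gamma>2_symmetric[OF assms] by auto
  have "\<Omega> x (\<Gamma> x w a) b z + \<Omega> x a (\<Gamma> x w b) z + (\<Omega> x (\<Gamma> x a b) w z + \<Omega> x b (\<Gamma> x a w) z)
      + (\<Omega> x (\<Gamma> x b w) a z + \<Omega> x w (\<Gamma> x b a) z) = 0" (is "?S = 0")
    unfolding s using \<Omega>_skew[of x b "\<Gamma> x w a"] \<Omega>_skew[of x a "\<Gamma> x w b"] \<Omega>_skew[of x w "\<Gamma> x a b"] by simp
  moreover have "(d\<Omega> x w a b z + \<Gamma> x w (\<Omega> x a b z) - \<Omega> x a b (\<Gamma> x w z))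
    + (d\<Omega> x a b w z + \<Gamma> x a (\<Omega> x b w z) - \<Omega> x b w (\<Gamma> x a z))
    + (d\<Omega> x b w a z + \<Gamma> x b (\<Omega> x w a z) - \<Omega> x w a (\<Gamma> x b z)) = 0" (is "?T = 0")
    unfolding d\<Omega>_def \<Omega>_def s(4-6) by (simp add: blinfun.bilinear_simps)
  moreover have "nab\<Omega> x w a b z + nab\<Omega> x a b w z + nab\<Omega> x b w a z = ?T - ?S"
    unfolding nab\<Omega>_def by (simp add: algebra_simps)
  ultimately show ?thesis
    by (simp only: diff_zero)
qed

lemma nab\<Omega>_skew_h:
  assumes "x \<in> U"
  shows "h x (nab\<Omega> x w a b u) v = - h x u (nab\<Omega> x w a b v)"
proof -
  note d = h_has_derivative[OF assms] \<Omega>_has_derivative[OF assms]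
  have 1: "((\<lambda>x. h x (\<Omega> x a b u) v) has_derivative (\<lambda>w. h1 x w (\<Omega> x a b u) v + h x (d\<Omega> x w a b u) v)) (at x)" for u v
    by (auto intro!: derivative_eq_intros d simp: blinfun.bilinear_simps fun_eq_iff)
  have 2: "((\<lambda>x. - h x u (\<Omega> x a b v)) has_derivative (\<lambda>w. - (h1 x w u (\<Omega> x a b v) + h x u (d\<Omega> x w a b v)))) (at x)"
    by (auto intro!: derivative_eq_intros d simp: blinfun.bilinear_simps fun_eq_iff)
  have "h1 x w (\<Omega> x a b u) v + h x (d\<Omega> x w a b u) v = - (h1 x w u (\<Omega> x a b v) + h x u (d\<Omega> x w a b v))"
    by (rule has_derivative_eq_on_open[OF 1 2 open_U assms \<Omega>_skew_h])
  then show ?thesis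
    unfolding nab\<Omega>_def h_deriv[OF assms]
    using \<Omega>_skew_h[OF assms, of a b "\<Gamma> x w u" v] \<Omega>_skew_h[OF assms, of a b u "\<Gamma> x w v"]
      \<Omega>_skew_h[OF assms, of "\<Gamma> x w a" b u v] \<Omega>_skew_h[OF assms, of a "\<Gamma> x w b" u v]
    by (simp add: blinfun.bilinear_simps)
qed

lemma tr_\<Omega>_left:
  assumes "x \<in> U"
  shows "tr (\<lambda>u. \<Omega> x u b z) = Rc x b z"
proof -
  have "\<Omega> x u b z = \<Gamma>1 x u b z - \<Gamma>1 x b z u + \<Gamma> x u (\<Gamma> x b z) - \<Gamma> x b (\<Gamma> x z u)" for u
    using \<Gamma>1_symmetric[OF assms, of b u z] \<Gamma>_sym[OF assms, of u z] by (simp add: \<Omega>_def)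
  then show ?thesis
    by (simp add: tr_simps Rc_def tr_\<Gamma>_left[OF assms])
qed

lemma sum_h_coax:
  assumes "x \<in> U" "linear f"
  shows "(\<Sum>i\<in>UNIV. h x v (axis i 1) *\<^sub>R f (coax x i)) = f v"
proof -
  have "(\<Sum>i\<in>UNIV. h x v (axis i 1) *\<^sub>R coax x i) = v"
  proof (rule h_eqI[OF assms(1)])
    fix w
    have "h x (\<Sum>i\<in>UNIV. h x v (axis i 1) *\<^sub>R coax x i) w = (\<Sum>i\<in>UNIV. w $ i *\<^sub>R h x v (axis i 1))"
      by (simp add: blinfun.bilinear_simps h_coax[OF assms(1)] mult.commute)
    also have "\<dots> = h x v w"
      by (rule linear_vec_expansion) simp
    finally show "h x (\<Sum>i\<in>UNIV. h x v (axis i 1) *\<^sub>R coax x i) w = h x v w" .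
  qed
  from arg_cong[OF this, of f] show ?thesis
    by (simp add: linear_sum[OF assms(2)] linear_cmul[OF assms(2)])
qed

text \<open>The second Bianchi identity contracted twice: the first contraction is
  \<open>cyc\<close>, the second turns it into (1 + 1 - n) d\<mu> = 0.\<close>

theorem schur:
  assumes "CARD('n) \<ge> 3" "\<And>x y. x \<in> U \<Longrightarrow> Rc x y y = \<mu> x * h x y y" "x \<in> U"
  shows "(\<mu> has_derivative (\<lambda>_. 0)) (at x)"
proof -
  have Rc: "Rc x y z = \<mu> x * h x y z" if "x \<in> U" for x y z
  proof -
    have "Rc x z (y + z) = Rc x z y + Rc x z z" "Rc x y (y + z) = Rc x y y + Rc x y z"
      using Rc_add Rc_sym[OF that] by metis+
    then show ?thesis
      using assms(2)[OF that, of "y + z"] assms(2)[OF that, of y] assms(2)[OF that, of z]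
        Rc_sym[OF that, of z y] h_sym[OF that, of z y]
      by (simp add: Rc_add blinfun.bilinear_simps algebra_simps)
  qed
  define e :: "real ^ 'n" where "e = axis undefined 1"
  have "e \<noteq> 0"
    by (simp add: e_def)
  have tr': "((\<lambda>x. tr (\<lambda>u. \<Omega> x u b z)) has_derivative (\<lambda>w. tr (\<lambda>u. d\<Omega> x w u b z))) (at x)" for b z
    unfolding tr_def
    by (intro has_derivative_sum bounded_linear.has_derivative[OF bounded_linear_vec_nth] \<Omega>_has_derivative assms(3))
  have h': "((\<lambda>x. h x b z) has_derivative (\<lambda>w. h1 x w b z)) (at x)" for b z
    by (rule has_derivative_blinfun_apply2[OF h_has_derivative[OF assms(3)]])
  \<comment> \<open>No regularity of \<mu> is given; it is differentiable as the quotient of the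
    Ricci tensor and h at the fixed vector e.\<close>
  have "\<exists>D. ((\<lambda>x. tr (\<lambda>u. \<Omega> x u e e) / h x e e) has_derivative D) (at x)"
    using h_pos[OF assms(3) \<open>e \<noteq> 0\<close>] by (intro exI) (rule derivative_intros tr' h' | simp)+
  then obtain m where "((\<lambda>x. tr (\<lambda>u. \<Omega> x u e e) / h x e e) has_derivative m) (at x)" ..
  then have m: "(\<mu> has_derivative m) (at x)"
    by (rule has_derivative_transform_within_open[OF _ open_U assms(3)])
      (use h_pos[OF _ \<open>e \<noteq> 0\<close>] in \<open>fastforce simp: tr_\<Omega>_left Rc\<close>)
  have m_lin: "linear m"
    using m has_derivative_linear by blast
  have tr_nab: "tr (\<lambda>u. nab\<Omega> x w u b z) = m w * h x b z" for w b z
  proof -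
    have "((\<lambda>x. \<mu> x * h x b z) has_derivative (\<lambda>w. \<mu> x * h1 x w b z + m w * h x b z)) (at x)"
      by (rule has_derivative_mult[OF m h'])
    from has_derivative_eq_on_open[OF tr' this open_U assms(3)]
    have "tr (\<lambda>u. d\<Omega> x w u b z) = \<mu> x * h1 x w b z + m w * h x b z"
      by (simp add: tr_\<Omega>_left Rc)
    moreover have "tr (\<lambda>u. \<Gamma> x w (\<Omega> x u b z)) = tr (\<lambda>u. \<Omega> x (\<Gamma> x w u) b z)"
      by (rule tr_commute[OF linear_blinfun linear_\<Omega>(2)])
    ultimately show ?thesis
      unfolding nab\<Omega>_def
      by (simp add: tr_simps tr_\<Omega>_left[OF assms(3)] Rc[OF assms(3)] h_deriv[OF assms(3)] algebra_simps)
  qed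
  have "m v = 0" for v
  proof -
    have cyc: "m w * h x v z + tr (\<lambda>u. nab\<Omega> x u v w z) - m v * h x w z = 0" for w z
    proof -
      have "nab\<Omega> x w u v z + nab\<Omega> x u v w z - nab\<Omega> x v u w z = 0" for u
        using second_bianchi[OF assms(3), of w u v z] nab\<Omega>_skew[of x v w u z] by simp
      then have "tr (\<lambda>u. nab\<Omega> x w u v z + nab\<Omega> x u v w z - nab\<Omega> x v u w z) = 0"
        by (simp add: tr_zero)
      then show ?thesis
        by (simp add: tr_simps tr_nab)
    qed
    have "(\<Sum>i\<in>UNIV. m (coax x i) * h x v (axis i 1)) + (\<Sum>i\<in>UNIV. tr (\<lambda>u. nab\<Omega> x u v (coax x i) (axis i 1)))
        - m v * (\<Sum>i\<in>UNIV. h x (coax x i) (axis i 1))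
        = (\<Sum>i\<in>UNIV. m (coax x i) * h x v (axis i 1) + tr (\<lambda>u. nab\<Omega> x u v (coax x i) (axis i 1))
          - m v * h x (coax x i) (axis i 1))"
      by (simp add: sum.distrib sum_subtractf sum_distrib_left)
    also have "\<dots> = 0"
      unfolding cyc by simp
    also have "(\<Sum>i\<in>UNIV. m (coax x i) * h x v (axis i 1)) = m v"
      using sum_h_coax[OF assms(3) m_lin, of v] by (simp add: mult.commute)
    also have "(\<Sum>i\<in>UNIV. h x (coax x i) (axis i 1)) = real CARD('n)"
      by (simp add: h_coax[OF assms(3)])
    \<comment> \<open>Skewness in both pairs of slots moves the contraction over i into the slot
      traced by \<open>tr_nab\<close>, so the middle term is d\<mu>(v) as well.\<close>
    also have "(\<Sum>i\<in>UNIV. tr (\<lambda>u. nab\<Omega> x u v (coax x i) (axis i 1)))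
        = (\<Sum>i\<in>UNIV. \<Sum>k\<in>UNIV. h x (axis i 1) (nab\<Omega> x (axis k 1) (coax x i) v (coax x k)))"
    proof (intro sum.cong refl)
      fix i
      have "h x (coax x k) (nab\<Omega> x (axis k 1) v (coax x i) (axis i 1))
          = h x (axis i 1) (nab\<Omega> x (axis k 1) (coax x i) v (coax x k))" for k
        using nab\<Omega>_skew_h[OF assms(3), of "axis k 1" v "coax x i" "coax x k" "axis i 1"]
          nab\<Omega>_skew[of x "axis k 1" "coax x i" v "coax x k"] h_sym[OF assms(3)]
        by (simp add: blinfun.bilinear_simps)
      then show "tr (\<lambda>u. nab\<Omega> x u v (coax x i) (axis i 1))
          = (\<Sum>k\<in>UNIV. h x (axis i 1) (nab\<Omega> x (axis k 1) (coax x i) v (coax x k)))"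
        by (simp add: tr_coax[OF assms(3)])
    qed
    also have "\<dots> = (\<Sum>k\<in>UNIV. \<Sum>i\<in>UNIV. h x (axis i 1) (nab\<Omega> x (axis k 1) (coax x i) v (coax x k)))"
      by (rule sum.swap)
    also have "\<dots> = (\<Sum>k\<in>UNIV. \<Sum>i\<in>UNIV. h x (coax x i) (nab\<Omega> x (axis k 1) (axis i 1) v (coax x k)))"
    proof (rule sum.cong[OF refl])
      fix k
      show "(\<Sum>i\<in>UNIV. h x (axis i 1) (nab\<Omega> x (axis k 1) (coax x i) v (coax x k)))
          = (\<Sum>i\<in>UNIV. h x (coax x i) (nab\<Omega> x (axis k 1) (axis i 1) v (coax x k)))"
        by (rule contract_sym[OF assms(3), symmetric,
              of "\<lambda>a b. h x a (nab\<Omega> x (axis k 1) b v (coax x k))"])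
          (auto intro!: linearI simp: blinfun.bilinear_simps linear_add[OF linear_nab\<Omega>] linear_cmul[OF linear_nab\<Omega>])
    qed
    also have "\<dots> = (\<Sum>k\<in>UNIV. m (axis k 1) * h x v (coax x k))"
    proof (rule sum.cong[OF refl])
      fix k
      show "(\<Sum>i\<in>UNIV. h x (coax x i) (nab\<Omega> x (axis k 1) (axis i 1) v (coax x k)))
          = m (axis k 1) * h x v (coax x k)"
        using tr_nab[of "axis k 1" v "coax x k"] unfolding tr_coax[OF assms(3)] .
    qed
    also have "\<dots> = m v"
      using linear_vec_expansion[OF m_lin, of v] h_sym[OF assms(3), of v]
      by (simp add: h_coax[OF assms(3)] mult.commute)
    finally have "(2 - real CARD('n)) * m v = 0"
      by (simp add: algebra_simps)
    then show ?thesis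
      using assms(1) by simp
  qed
  then have "m = (\<lambda>_. 0)"
    by blast
  then show ?thesis
    using m by simp
qed

end

section \<open>Almost Ricci solitons in a chart\<close>

lemma continuous_zero_on_dense:
  fixes f :: "'a::topological_space \<Rightarrow> real"
  assumes "continuous_on U f" "open U" "\<And>S. open S \<Longrightarrow> S \<subseteq> U \<Longrightarrow> S \<noteq> {} \<Longrightarrow> \<exists>z\<in>S. P z"
    and "\<And>z. z \<in> U \<Longrightarrow> P z \<Longrightarrow> f z = 0" "x \<in> U"
  shows "f x = 0"
proof (rule ccontr)
  assume "f x \<noteq> 0"
  have "open (U \<inter> f -` (- {0}))"
    using assms(1,2) by (intro continuous_open_preimage) auto
  moreover have "x \<in> U \<inter> f -` (- {0})"
    using assms(5) \<open>f x \<noteq> 0\<close> by simp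
  ultimately obtain z where "z \<in> U \<inter> f -` (- {0})" "P z"
    using assms(3) by (metis empty_iff inf_le1)
  then show False
    using assms(4) by blast
qed

text \<open>The complete lift differentiates along the flow that V induces on the tangent bundle,
  whose velocity at (x, y) is (V, V' y).\<close>

lemma complete_lift_eq:
  assumes "((\<lambda>p. f (fst p) (snd p)) has_derivative D) (at (x, y))"
    and "(V has_derivative blinfun_apply V') (at x)"
  shows "complete_lift V f x y = D (V x, V' y)"
proof -
  have D: "linear D"
    using assms(1) has_derivative_linear by blast
  have lin: "linear (\<lambda>v. (v, 0) :: (real ^ 'n) \<times> (real ^ 'n))" "linear (\<lambda>v. (0, v) :: (real ^ 'n) \<times> (real ^ 'n))"
    by (auto intro!: linearI)
  from this[THEN linear_compose[OF _ D]]
  have l: "linear (\<lambda>v. D (v, 0))" "linear (\<lambda>v. D (0, v))"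
    by (simp_all add: o_def)
  from has_derivative_slice_fst[OF assms(1)] have dx: "dx i f x y = D (axis i 1, 0)" for i
    unfolding dx_def by (subst frechet_derivative_eq) auto
  from has_derivative_slice_snd[OF assms(1)] have dy: "dy i f x y = D (0, axis i 1)" for i
    unfolding dy_def by (subst frechet_derivative_eq) auto
  have V': "frechet_derivative (\<lambda>x'. V x' $ i) (at x) v = V' v $ i" for i v
    by (subst frechet_derivative_eq[OF bounded_linear.has_derivative[OF bounded_linear_vec_nth assms(2)]]) simp
  have "(\<Sum>j\<in>UNIV. y $ j * V' (axis j 1) $ i) = V' y $ i" for i
    using arg_cong[OF linear_vec_expansion[of V' y], of "\<lambda>v. v $ i"] by simp
  then have "complete_lift V f x y = (\<Sum>i\<in>UNIV. V x $ i *\<^sub>R D (axis i 1, 0))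
      + (\<Sum>i\<in>UNIV. V' y $ i *\<^sub>R D (0, axis i 1))"
    by (simp add: complete_lift_def V' dx dy flip: sum_distrib_right)
  also have "\<dots> = D (V x, 0) + D (0, V' y)"
    by (simp only: linear_vec_expansion[OF l(1)] linear_vec_expansion[OF l(2)])
  finally show ?thesis
    using linear_add[OF D, of "(V x, 0)" "(0, V' y)"] by simp
qed

text \<open>The quadratic form \<open>h\<close> is irreducible, so it can only divide the product of a linear form and
  the quadratic form \<open>q\<close> (with polarization \<open>b\<close>) if it divides \<open>q\<close>.\<close>

lemma (in riemannian_chart) linear_times_quadratic:
  assumes "x \<in> U" "w \<noteq> 0"
    and q: "\<And>u v. q (u + v) = q u + q v + 2 * b u v" "\<And>u. q (- u) = q u" "\<And>u v. b u (- v) = - b u v"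
    and eq: "\<And>u. h x u w * q u = 2 * h x u u * h x u e"
  shows "\<exists>\<rho>. e = \<rho> *\<^sub>R w \<and> (\<forall>u. q u = 2 * \<rho> * h x u u)"
proof -
  have w: "h x w w > 0"
    using h_pos assms by blast
  \<comment> \<open>The projection of e onto w is \<rho> w. At the remainder u0, which is orthogonal
    to w, the hypothesis gives h(u0, u0)^2 = 0.\<close>
  define \<rho> where "\<rho> = h x e w / h x w w"
  define u0 where "u0 = e - \<rho> *\<^sub>R w"
  have u0w: "h x u0 w = 0"
    using w by (simp add: u0_def \<rho>_def blinfun.bilinear_simps)
  then have "h x u0 u0 * h x u0 e = 0"
    using eq[of u0] by simp
  moreover have "h x u0 e = h x u0 u0"
    using u0w by (simp add: u0_def[of] blinfun.bilinear_simps)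
  ultimately have "u0 = 0"
    using h_zeroD[OF assms(1)] by auto
  then have e: "e = \<rho> *\<^sub>R w"
    by (simp add: u0_def)
  have 1: "q u = 2 * \<rho> * h x u u" if "h x u w \<noteq> 0" for u
  proof -
    have "h x u w * q u = h x u w * (2 * \<rho> * h x u u)"
      using eq[of u] by (simp add: e blinfun.bilinear_simps mult.commute mult.left_commute)
    then show ?thesis
      using that by simp
  qed
  \<comment> \<open>For u orthogonal to w the vectors u + w and u - w are not; adding their values
    of q recovers that of u.\<close>
  have "q u = 2 * \<rho> * h x u u" if "h x u w = 0" for u
  proof -
    have "q (u + w) = 2 * \<rho> * h x (u + w) (u + w)" "q (u + - w) = 2 * \<rho> * h x (u + - w) (u + - w)"
      "q w = 2 * \<rho> * h x w w"
      using w that by (intro 1; simp add: blinfun.bilinear_simps)+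
    then show ?thesis
      unfolding q using that h_sym[OF assms(1), of w u] by (simp add: blinfun.bilinear_simps algebra_simps)
  qed
  then show ?thesis
    using 1 e by blast
qed

lemma (in riemannian_chart) C2_derivatives:
  fixes f :: "real ^ 'n \<Rightarrow> 'b::real_normed_vector"
  assumes "Ck_on 2 f U" "x \<in> U"
  shows "(f has_derivative blinfun_apply (blinfun_derivative f x)) (at x)"
    and "(blinfun_derivative f has_derivative blinfun_apply (blinfun_derivative (blinfun_derivative f) x)) (at x)"
  using Ck_on_Suc_has_derivative[of 1 f U x] Ck_on_Suc_has_derivative[of 0 "blinfun_derivative f" U x]
    Ck_on_blinfun_derivative[of U 1 f] assms open_U by (simp_all add: numeral_2_eq_2)

context randers_homothetic
begin

lemma lie_h_W:
  assumes "x \<in> U"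
  shows "h1 x (W x) u v + h x (W1 x u) v + h x u (W1 x v) = - 4 * \<sigma> * h x u v"
  using homothety[OF assms, of u v] \<Gamma>_sym[OF assms, of "W x"]
  by (simp add: W1_eq[OF assms] h_deriv[OF assms] blinfun.bilinear_simps)

end

locale randers_field = randers_homothetic U h \<Gamma> W B \<sigma>
  for U :: "(real ^ 'n::finite) set"
    and h :: "real ^ 'n \<Rightarrow> (real ^ 'n) \<Rightarrow>\<^sub>L (real ^ 'n) \<Rightarrow>\<^sub>L real"
    and \<Gamma> :: "real ^ 'n \<Rightarrow> (real ^ 'n) \<Rightarrow>\<^sub>L (real ^ 'n) \<Rightarrow>\<^sub>L (real ^ 'n)"
    and W B \<sigma> +
  fixes V :: "real ^ 'n \<Rightarrow> real ^ 'n"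
  assumes V_C2: "Ck_on 2 V U"
begin

abbreviation "V1 \<equiv> blinfun_derivative V"

definition LVh :: "real ^ 'n \<Rightarrow> real ^ 'n \<Rightarrow> real ^ 'n \<Rightarrow> real" where
  "LVh x u v = h1 x (V x) u v + h x (V1 x u) v + h x u (V1 x v)"

text \<open>The Lie bracket [V, W].\<close>

definition VW :: "real ^ 'n \<Rightarrow> real ^ 'n" where
  "VW x = W1 x (V x) - V1 x (W x)"

lemma complete_lift_Fd:
  assumes "x \<in> U" "y \<noteq> 0" "cov_s f f' x y"
  shows "complete_lift V f x y = f' (V x) (\<Gamma> x (V x) y + V1 x y)"
  using complete_lift_eq[OF assms(3)[unfolded cov_s_def] C2_derivatives(1)[OF V_C2 assms(1)]]
  by (simp add: add.commute)

text \<open>Lie differentiation along V of h(u, u) = F^2 with u = y - F W: the bracket is the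
  derivative of W, and solving for the derivative of F leaves the denominator
  \<open>root\<close>.\<close>

lemma complete_lift_F:
  assumes "x \<in> U" "y \<noteq> 0"
  shows "complete_lift V F x y = ((1/2) * LVh x (yt x y) (yt x y) - F x y * h x (yt x y) (VW x)) / root x y"
proof -
  let ?u = "yt x y"
  have "h x ?u (\<Gamma> x (V x) y + V1 x y) - F x y * h x ?u (B x (V x))
      = (1/2) * LVh x ?u ?u - F x y * h x ?u (VW x)"
  proof -
    have y: "y = ?u + F x y *\<^sub>R W x"
      by (simp add: yt_def)
    have "\<Gamma> x (V x) y + V1 x y = \<Gamma> x (V x) ?u + V1 x ?u + F x y *\<^sub>R (\<Gamma> x (V x) (W x) + V1 x (W x))"
      by (subst (1 2) y) (simp add: blinfun.bilinear_simps scaleR_add_right)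
    then show ?thesis
      using h_sym[OF assms(1), of _ ?u]
      by (simp add: LVh_def VW_def W1_eq[OF assms(1)] h_deriv[OF assms(1)] blinfun.bilinear_simps algebra_simps)
  qed
  then show ?thesis
    by (simp add: complete_lift_Fd[OF assms cov_F[OF assms]] Fd_def)
qed

lemma complete_lift_sq_F:
  assumes "x \<in> U" "y \<noteq> 0"
  shows "complete_lift V (sq F) x y = 2 * F x y * complete_lift V F x y"
  by (simp add: complete_lift_Fd[OF assms cov_F[OF assms]] complete_lift_Fd[OF assms cov_sq_F[OF assms]])

text \<open>The quadratic form P of the overview.\<close>

definition defect :: "real \<Rightarrow> real ^ 'n \<Rightarrow> real ^ 'n \<Rightarrow> real" where
  "defect k x u = 2 * Rc x u u - 2 * (real CARD('n) - 1) * \<sigma>\<^sup>2 * h x u u - 2 * k * h x u u"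

lemma soliton_split:
  assumes "x \<in> U"
    and "\<And>y. y \<noteq> 0 \<Longrightarrow> 2 * Ric F x y + complete_lift V (sq F) x y = 2 * k * (F x y)\<^sup>2"
  shows "LVh x u u = - defect k x u" "h x u (W x) * defect k x u = 2 * h x u u * h x u (VW x)"
proof -
  have neg: "LVh x (- u) (- u) = LVh x u u" "defect k x (- u) = defect k x u" "Rc x (- u) (- u) = Rc x u u" for u
    using Rc_scale[of x "-1" u] Rc_sym[OF assms(1)] Rc_scale[of x "-1" u "- u"]
    by (simp_all add: LVh_def defect_def blinfun.bilinear_simps)
  have eq: "(sqrt (h x u u) + h x u (W x)) * defect k x u + sqrt (h x u u) * LVh x u u
      - 2 * h x u u * h x u (VW x) = 0" if "u \<noteq> 0" for u
  proof -
    define s where "s = sqrt (h x u u)"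
    have s: "s > 0" "s * s = h x u u"
      using h_pos[OF assms(1) that] by (simp_all add: s_def)
    define y where "y = u + sqrt (h x u u) *\<^sub>R W x"
    note y = F_indicatrix[OF assms(1) that y_def]
    \<comment> \<open>Multiplying by \<open>root\<close> = s + h(u, W) clears the denominator; s is
      even and h(u, W) odd in u.\<close>
    define R where "R = root x y"
    have R: "R = s + h x u (W x)" "R > 0"
      using root_eq[OF assms(1), of y] root_pos[OF assms(1) y(1)] y(2,3) by (simp_all add: R_def s_def)
    have "2 * (Rc x u u - (real CARD('n) - 1) * \<sigma>\<^sup>2 * s\<^sup>2)
        + 2 * s * (((1/2) * LVh x u u - s * h x u (VW x)) / R) = 2 * k * s\<^sup>2"
      using assms(2)[OF y(1)] unfolding Ric_F[OF assms(1) y(1)] complete_lift_sq_F[OF assms(1) y(1)]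
        complete_lift_F[OF assms(1) y(1)] y(2,3) s_def[symmetric] R_def[symmetric] .
    then have "R * defect k x u + s * LVh x u u - 2 * (s * s) * h x u (VW x) = 0"
      using R(2) unfolding defect_def s(2)[symmetric] by (simp add: field_simps power2_eq_square)
    then show ?thesis
      using R(1) s(2) by (simp add: s_def)
  qed
  have "LVh x u u = - defect k x u \<and> h x u (W x) * defect k x u = 2 * h x u u * h x u (VW x)"
  proof (cases "u = 0")
    case True
    then show ?thesis
      using Rc_scale[of x 0 0 0] by (simp add: LVh_def defect_def blinfun.bilinear_simps)
  next
    case False
    have s: "sqrt (h x u u) > 0"
      using h_pos[OF assms(1) False] by simp
    have "sqrt (h x u u) * (defect k x u + LVh x u u) = 0"
      using eq[OF False] eq[of "- u"] False by (simp add: neg blinfun.bilinear_simps algebra_simps)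
    then have "LVh x u u = - defect k x u"
      using s by (simp add: add_eq_0_iff)
    then show ?thesis
      using eq[OF False] by (simp add: algebra_simps)
  qed
  then show "LVh x u u = - defect k x u" "h x u (W x) * defect k x u = 2 * h x u u * h x u (VW x)"
    by auto
qed

lemma LVh_sym: "x \<in> U \<Longrightarrow> LVh x u v = LVh x v u"
  by (simp add: LVh_def h_deriv h_sym[of x _ u] h_sym[of x _ v] h_sym)

definition e0 :: "real ^ 'n" where "e0 = axis undefined 1"

text \<open>Evaluation at a fixed vector defines the conformal factor on the whole chart, also where
  W = 0, and makes it C^1.\<close>

definition rho :: "real ^ 'n \<Rightarrow> real" where
  "rho x = - LVh x e0 e0 / (2 * h x e0 e0)"

lemma h_e0: "x \<in> U \<Longrightarrow> h x e0 e0 > 0"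
  by (rule h_pos) (simp_all add: e0_def)

lemma rho_C1: "Ck_on 1 rho U"
proof -
  have h: "Ck_on 1 h U" and V: "Ck_on 1 V U"
    by (rule Ck_on_mono[OF h_C2], simp) (rule Ck_on_mono[OF V_C2], simp)
  have h1: "Ck_on 1 h1 U" and V1: "Ck_on 1 V1 U"
    by (rule Ck_on_blinfun_derivative[OF open_U], simp only: Suc_1 h_C2 V_C2)+
  have c: "Ck_on 1 (\<lambda>x. e0) U"
    by (simp add: open_U)
  have "Ck_on 1 (\<lambda>x. inverse (2 * h x e0 e0)) U"
    using h_e0 by (intro Ck_on_inverse Ck_on_bilinear[OF bounded_bilinear_mult] Ck_on_blinfun_apply open_U h c)
      (fastforce simp: open_U)+
  then have "Ck_on 1 (\<lambda>x. (- LVh x e0 e0) * inverse (2 * h x e0 e0)) U"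
    unfolding LVh_def
    by (intro Ck_on_bilinear[OF bounded_bilinear_mult] Ck_on_bounded_linear[OF bounded_linear_minus[OF bounded_linear_ident]]
        Ck_on_add Ck_on_blinfun_apply open_U h h1 V V1 c)
  also have "(\<lambda>x. (- LVh x e0 e0) * inverse (2 * h x e0 e0)) = rho"
    by (rule ext) (simp only: rho_def divide_inverse)
  finally show ?thesis .
qed

lemma rho_has_derivative: "x \<in> U \<Longrightarrow> (rho has_derivative blinfun_apply (blinfun_derivative rho x)) (at x)"
  using Ck_on_Suc_has_derivative[of 0 rho U] rho_C1 open_U by simp

lemma rho_has_derivative_zero:
  assumes "CARD('n) \<ge> 2"
    and LV: "\<And>x u v. x \<in> U \<Longrightarrow> LVh x u v = - 2 * rho x * h x u v"
    and VW: "\<And>x. x \<in> U \<Longrightarrow> VW x = rho x *\<^sub>R W x"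
    and "x \<in> U" "W x \<noteq> 0"
  shows "blinfun_derivative rho x = 0"
proof -
  let ?D = "blinfun_derivative rho x" and ?h2 = "blinfun_derivative h1 x"
    and ?W2 = "blinfun_derivative W1 x" and ?V2 = "blinfun_derivative V1 x"
  note d = C2_derivatives[OF h_C2 assms(4)] C2_derivatives[OF W_C2 assms(4)]
    C2_derivatives[OF V_C2 assms(4)] rho_has_derivative[OF assms(4)]
  note LW = lie_h_W
  \<comment> \<open>Here \<open>i\<close> is the equation for the Lie derivative of h along W,
    differentiated along V; \<open>ii\<close> is the one for V, differentiated along W;
    \<open>iii\<close> is [V, W] = \<rho> W, differentiated along u. By symmetry the second
    derivatives of h, V and W drop out of the combination.\<close>
  have key: "?D u * h x (W x) u = (?D (W x) + 2 * \<sigma> * rho x) * h x u u" for u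
  proof -
    have "((\<lambda>x. h1 x (W x) u u + h x (W1 x u) u + h x u (W1 x u)) has_derivative
        (\<lambda>z. ?h2 z (W x) u u + h1 x (W1 x z) u u + (h1 x z (W1 x u) u + h x (?W2 z u) u)
          + (h1 x z u (W1 x u) + h x u (?W2 z u)))) (at x)"
      by (auto intro!: derivative_eq_intros d simp: blinfun.bilinear_simps fun_eq_iff)
    moreover have "((\<lambda>x. - 4 * \<sigma> * h x u u) has_derivative (\<lambda>z. - 4 * \<sigma> * h1 x z u u)) (at x)"
      by (auto intro!: derivative_eq_intros d simp: blinfun.bilinear_simps fun_eq_iff)
    ultimately have i: "?h2 (V x) (W x) u u + h1 x (W1 x (V x)) u u + (h1 x (V x) (W1 x u) u + h x (?W2 (V x) u) u)
          + (h1 x (V x) u (W1 x u) + h x u (?W2 (V x) u)) = - 4 * \<sigma> * h1 x (V x) u u"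
      by (rule has_derivative_eq_on_open[OF _ _ open_U assms(4) LW])
    have "((\<lambda>x. h1 x (V x) u u + h x (V1 x u) u + h x u (V1 x u)) has_derivative
        (\<lambda>z. ?h2 z (V x) u u + h1 x (V1 x z) u u + (h1 x z (V1 x u) u + h x (?V2 z u) u)
          + (h1 x z u (V1 x u) + h x u (?V2 z u)))) (at x)"
      by (auto intro!: derivative_eq_intros d simp: blinfun.bilinear_simps fun_eq_iff)
    moreover have "((\<lambda>x. - 2 * rho x * h x u u) has_derivative
        (\<lambda>z. - 2 * ?D z * h x u u - 2 * rho x * h1 x z u u)) (at x)"
      by (auto intro!: derivative_eq_intros d simp: blinfun.bilinear_simps fun_eq_iff)
    ultimately have ii: "?h2 (W x) (V x) u u + h1 x (V1 x (W x)) u u + (h1 x (W x) (V1 x u) u + h x (?V2 (W x) u) u)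
          + (h1 x (W x) u (V1 x u) + h x u (?V2 (W x) u)) = - 2 * ?D (W x) * h x u u - 2 * rho x * h1 x (W x) u u"
      by (rule has_derivative_eq_on_open[OF _ _ open_U assms(4) LV[unfolded LVh_def]])
    have "((\<lambda>x. W1 x (V x) - V1 x (W x)) has_derivative
        (\<lambda>z. ?W2 z (V x) + W1 x (V1 x z) - (?V2 z (W x) + V1 x (W1 x z)))) (at x)"
      by (auto intro!: derivative_eq_intros d simp: blinfun.bilinear_simps fun_eq_iff)
    moreover have "((\<lambda>x. rho x *\<^sub>R W x) has_derivative (\<lambda>z. rho x *\<^sub>R W1 x z + ?D z *\<^sub>R W x)) (at x)"
      by (auto intro!: derivative_eq_intros d)
    ultimately have iii: "?W2 u (V x) + W1 x (V1 x u) - (?V2 u (W x) + V1 x (W1 x u)) = rho x *\<^sub>R W1 x u + ?D u *\<^sub>R W x"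
      by (rule has_derivative_eq_on_open[OF _ _ open_U assms(4) VW[unfolded VW_def]])
    have sym: "?h2 (V x) (W x) = ?h2 (W x) (V x)" "?W2 (V x) u = ?W2 u (V x)" "?V2 (W x) u = ?V2 u (W x)"
      using blinfun_derivative_symmetric[OF open_U assms(4) h_C2]
        blinfun_derivative_symmetric[OF open_U assms(4) W_C2]
        blinfun_derivative_symmetric[OF open_U assms(4) V_C2] by metis+
    have W1V: "W1 x (V x) = rho x *\<^sub>R W x + V1 x (W x)"
      using VW[OF assms(4)] by (simp add: VW_def algebra_simps)
    have W2: "?W2 u (V x) = rho x *\<^sub>R W1 x u + ?D u *\<^sub>R W x + ?V2 u (W x) + V1 x (W1 x u) - W1 x (V1 x u)"
      using iii by (simp add: algebra_simps)
    have hs: "h x a b = h x b a" and h1s: "h1 x c a b = h1 x c b a" for a b c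
      using h_sym[OF assms(4)] by (simp_all add: h_deriv[OF assms(4)])
    note sw = hs[of "W1 x u" u] hs[of "V1 x u" u] hs[of "W x" u] hs[of "?V2 u (W x)" u]
      hs[of "V1 x (W1 x u)" u] hs[of "W1 x (V1 x u)" u] hs[of "V1 x u" "W1 x u"]
      h1s[of _ "W1 x u" u] h1s[of _ "V1 x u" u]
    have m1: "rho x * (h1 x (W x) u u + h x (W1 x u) u + h x u (W1 x u)) = rho x * (- 4 * \<sigma> * h x u u)"
      using LW[OF assms(4), of u u] by simp
    have m2: "\<sigma> * (h1 x (V x) u u + h x (V1 x u) u + h x u (V1 x u)) = \<sigma> * (- 2 * rho x * h x u u)"
      using LV[OF assms(4), of u u, unfolded LVh_def] by simp
    note eqs = i ii LV[OF assms(4), of "W1 x u" u, unfolded LVh_def] LW[OF assms(4), of "V1 x u" u] m1 m2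
    show ?thesis
      using eqs[unfolded sym W1V W2 blinfun.bilinear_simps sw] unfolding sw
      by (simp add: algebra_simps)
  qed
  \<comment> \<open>A nonzero vector orthogonal to W, found in the span of two coordinate
    directions; here n \<ge> 2 enters.\<close>
  obtain u where u: "u \<noteq> 0" "h x (W x) u = 0"
  proof -
    obtain i j :: 'n where "i \<noteq> j"
      using assms(1) card_2_iff'[of "UNIV :: 'n set"] by (metis One_nat_def card_le_Suc0_iff_eq finite
          not_less_eq_eq numeral_2_eq_2)
    define a b where "a = h x (W x) (axis i 1)" and "b = h x (W x) (axis j 1)"
    define u :: "real ^ 'n" where "u = (if a = 0 then axis i 1 else b *\<^sub>R axis i 1 - a *\<^sub>R axis j 1)"
    have "u $ j \<noteq> 0" if "a \<noteq> 0"
      using that \<open>i \<noteq> j\<close> by (simp add: u_def axis_def)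
    moreover have "u \<noteq> 0" if "a = 0"
      using that by (simp add: u_def)
    ultimately have "u \<noteq> 0"
      by (metis zero_index)
    moreover have "h x (W x) u = 0"
      by (simp add: u_def blinfun.bilinear_simps flip: a_def b_def)
    ultimately show thesis
      using that by blast
  qed
  have c: "?D (W x) + 2 * \<sigma> * rho x = 0"
    using key[of u] u h_pos[OF assms(4) u(1)] by simp
  have W: "h x (W x) (W x) > 0"
    using h_pos[OF assms(4,5)] .
  have z: "?D u * h x (W x) u = 0" for u
    using key[of u] unfolding c by simp
  have "?D (W x) = 0"
    using z[of "W x"] W by simp
  then have "?D u * h x (W x) (W x) = 0" for u
    using z[of "u + W x"] z[of u] by (auto simp: blinfun.bilinear_simps algebra_simps)
  then show ?thesis
    using W by (intro blinfun_eqI) simp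
qed

text \<open>The first identity extends by continuity from the dense set where W is nonzero. At a
  zero of W the left side in \<open>soliton_split\<close> vanishes, and u = [V, W] shows that the
  bracket is 0.\<close>

lemma soliton_conformal:
  assumes "\<And>S. open S \<Longrightarrow> S \<subseteq> U \<Longrightarrow> S \<noteq> {} \<Longrightarrow> \<exists>z\<in>S. W z \<noteq> 0"
    and sol: "\<And>x y. x \<in> U \<Longrightarrow> y \<noteq> 0 \<Longrightarrow>
      2 * Ric F x y + complete_lift V (sq F) x y = 2 * k x * (F x y)\<^sup>2"
    and "x \<in> U"
  shows "LVh x u v = - 2 * rho x * h x u v" "VW x = rho x *\<^sub>R W x"
proof -
  have nz: "LVh x u v = - 2 * rho x * h x u v \<and> VW x = rho x *\<^sub>R W x" if "x \<in> U" "W x \<noteq> 0" for x u v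
  proof -
    note split = soliton_split[OF that(1) sol[OF that(1)]]
    have "\<exists>\<rho>. VW x = \<rho> *\<^sub>R W x \<and> (\<forall>u. - LVh x u u = 2 * \<rho> * h x u u)"
    proof (rule linear_times_quadratic[OF that, where b = "\<lambda>u v. - LVh x u v"])
      show "- LVh x (u + v) (u + v) = - LVh x u u + - LVh x v v + 2 * - LVh x u v" for u v
        using LVh_sym[OF that(1), of v u] by (simp add: LVh_def blinfun.bilinear_simps algebra_simps)
      show "- LVh x (- u) (- u) = - LVh x u u" "- LVh x u (- v) = - (- LVh x u v)" for u v
        by (simp_all add: LVh_def blinfun.bilinear_simps)
      show "h x u (W x) * - LVh x u u = 2 * h x u u * h x u (VW x)" for u
        using split(1)[of u] split(2)[of u] by simp
    qed
    then obtain \<rho> where \<rho>1: "VW x = \<rho> *\<^sub>R W x" and "\<forall>u. - LVh x u u = 2 * \<rho> * h x u u"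
      by blast
    then have \<rho>2: "LVh x u u = - (2 * \<rho> * h x u u)" for u
      by (metis minus_minus)
    have "rho x = \<rho>"
      using h_e0[OF that(1)] by (simp add: rho_def \<rho>2)
    moreover have "LVh x u v = - 2 * \<rho> * h x u v"
    proof -
      have "LVh x (u + v) (u + v) = LVh x u u + LVh x v v + 2 * LVh x u v"
        using LVh_sym[OF that(1), of v u] by (simp add: LVh_def blinfun.bilinear_simps algebra_simps)
      moreover have "h x (u + v) (u + v) = h x u u + h x v v + 2 * h x u v"
        using h_sym[OF that(1), of v u] by (simp add: blinfun.bilinear_simps)
      ultimately have "- (2 * \<rho> * (h x u u + h x v v + 2 * h x u v))
          = - (2 * \<rho> * h x u u) + - (2 * \<rho> * h x v v) + 2 * LVh x u v"
        by (simp only: \<rho>2)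
      then show ?thesis
        by (simp add: distrib_left)
    qed
    ultimately show ?thesis
      using \<rho>1 by simp
  qed
  note cont = Ck_on_imp_continuous_on[OF h_C2] Ck_on_imp_continuous_on[OF V_C2] Ck_on_imp_continuous_on[OF rho_C1]
      Ck_on_imp_continuous_on[OF Ck_on_blinfun_derivative[OF open_U h_C2[folded Suc_1]]]
      Ck_on_imp_continuous_on[OF Ck_on_blinfun_derivative[OF open_U V_C2[folded Suc_1]]]
  have "LVh x u v + 2 * rho x * h x u v = 0" for u v
  proof (rule continuous_zero_on_dense[OF _ open_U assms(1) _ assms(3)])
    show "continuous_on U (\<lambda>x. LVh x u v + 2 * rho x * h x u v)"
      unfolding LVh_def by (intro continuous_intros cont)
  qed (use nz in auto)
  then show LV: "LVh x u v = - 2 * rho x * h x u v" for u v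
    by (simp add: add_eq_0_iff)
  show "VW x = rho x *\<^sub>R W x"
  proof (cases "W x = 0")
    case True
    then have "h x (VW x) (VW x) = 0"
      using soliton_split(2)[OF assms(3) sol[OF assms(3)], of "VW x"] by (simp add: blinfun.bilinear_simps)
    then show ?thesis
      using True h_zeroD[OF assms(3)] by simp
  qed (use nz[OF assms(3)] in simp)
qed

text \<open>The derivative of \<open>rho\<close> is continuous and vanishes on a dense set; in the
  complete lift of F the factor F + h(u, W) cancels against \<open>root\<close>.\<close>

theorem soliton_homothetic:
  assumes "CARD('n) \<ge> 2"
    and dense: "\<And>S. open S \<Longrightarrow> S \<subseteq> U \<Longrightarrow> S \<noteq> {} \<Longrightarrow> \<exists>z\<in>S. W z \<noteq> 0"
    and sol: "\<And>x y. x \<in> U \<Longrightarrow> y \<noteq> 0 \<Longrightarrow>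
      2 * Ric F x y + complete_lift V (sq F) x y = 2 * k x * (F x y)\<^sup>2"
    and "x \<in> U"
  shows "(rho has_derivative (\<lambda>_. 0)) (at x)"
    and "y \<noteq> 0 \<Longrightarrow> complete_lift V F x y = - rho x * F x y"
proof -
  have conf: "LVh z u v = - 2 * rho z * h z u v" "VW z = rho z *\<^sub>R W z" if "z \<in> U" for z u v
    by (rule soliton_conformal[OF dense sol that]; assumption)+
  have "blinfun_derivative rho x b = 0" for b
  proof (rule continuous_zero_on_dense[OF _ open_U dense _ assms(4)])
    have "Ck_on 0 (blinfun_derivative rho) U"
      by (rule Ck_on_blinfun_derivative[OF open_U]) (use rho_C1 in simp)
    then show "continuous_on U (\<lambda>x. blinfun_derivative rho x b)"
      by (auto intro!: continuous_intros)
  qed (simp_all add: rho_has_derivative_zero[OF assms(1) conf])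
  then have "blinfun_apply (blinfun_derivative rho x) = (\<lambda>_. 0)"
    by blast
  then show "(rho has_derivative (\<lambda>_. 0)) (at x)"
    using rho_has_derivative[OF assms(4)] by simp
  assume y: "y \<noteq> 0"
  have "(1/2) * LVh x (yt x y) (yt x y) - F x y * h x (yt x y) (VW x) = - rho x * F x y * root x y"
    using h_yt_yt[OF assms(4) y] root_eq[OF assms(4), of y]
    by (simp add: conf[OF assms(4)] blinfun.bilinear_simps power2_eq_square algebra_simps)
  then show "complete_lift V F x y = - rho x * F x y"
    using root_pos[OF assms(4) y] by (simp add: complete_lift_F[OF assms(4) y])
qed

end

section \<open>Unique continuation for the navigation field\<close>

text \<open>The function g(t) exp(-C t) is nonincreasing.\<close>

lemma gronwall_zero:
  fixes g :: "real \<Rightarrow> real"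
  assumes "\<And>t. 0 \<le> t \<Longrightarrow> t \<le> 1 \<Longrightarrow> (g has_real_derivative g' t) (at t)"
    and "\<And>t. 0 \<le> t \<Longrightarrow> t \<le> 1 \<Longrightarrow> g' t \<le> C * g t" "g 0 = 0"
  shows "g 1 \<le> 0"
proof -
  have "g 1 * exp (- C * 1) \<le> g 0 * exp (- C * 0)"
  proof (rule DERIV_nonpos_imp_nonincreasing[of 0 1 "\<lambda>t. g t * exp (- C * t)"])
    fix t :: real assume t: "0 \<le> t" "t \<le> 1"
    have "((\<lambda>t. g t * exp (- C * t)) has_real_derivative (g' t - C * g t) * exp (- C * t)) (at t)"
      by (auto intro!: derivative_eq_intros assms(1) t simp: algebra_simps)
    moreover have "(g' t - C * g t) * exp (- C * t) \<le> 0"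
      using assms(2)[OF t] by (simp add: mult_le_0_iff)
    ultimately show "\<exists>y. ((\<lambda>t. g t * exp (- C * t)) has_real_derivative y) (at t) \<and> y \<le> 0"
      by blast
  qed simp
  then show ?thesis
    using assms(3) by (simp add: mult_le_0_iff)
qed

lemma norm_blinfun3:
  "norm (blinfun_apply (blinfun_apply (blinfun_apply L a) b) c) \<le> norm L * norm a * norm b * norm c"
proof -
  have "norm (L a b c) \<le> norm (L a b) * norm c"
    by (rule norm_blinfun)
  also have "\<dots> \<le> (norm (L a) * norm b) * norm c"
    by (intro mult_right_mono norm_blinfun) simp
  also have "\<dots> \<le> ((norm L * norm a) * norm b) * norm c"
    by (intro mult_right_mono norm_blinfun) simp_all
  finally show ?thesis .
qed

lemma norm_blinfun4:
  "norm (blinfun_apply (blinfun_apply (blinfun_apply (blinfun_apply L a) b) c) d)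
    \<le> norm L * norm a * norm b * norm c * norm d"
proof -
  have "norm (L a b c d) \<le> norm (L a) * norm b * norm c * norm d"
    by (rule norm_blinfun3)
  also have "\<dots> \<le> (norm L * norm a) * norm b * norm c * norm d"
    by (intro mult_right_mono norm_blinfun) simp_all
  finally show ?thesis .
qed

text \<open>m is the minimum of h over the compact product of S and the unit sphere.\<close>

lemma (in riemannian_chart) h_lower_bound:
  assumes "compact S" "S \<subseteq> U"
  shows "\<exists>m>0. \<forall>y\<in>S. \<forall>u. m * (norm u)\<^sup>2 \<le> h y u u"
proof (cases "S = {}")
  case False
  let ?K = "S \<times> sphere (0 :: real ^ 'n) 1"
  have cont: "continuous_on ?K (\<lambda>p. h (fst p) (snd p) (snd p))"
  proof -
    have "continuous_on ?K (\<lambda>p. h (fst p))"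
      by (rule continuous_on_compose2[OF continuous_on_subset[OF Ck_on_imp_continuous_on[OF h_C2] assms(2)]])
        (auto intro: continuous_intros)
    then show ?thesis
      by (intro continuous_intros)
  qed
  have "axis undefined 1 \<in> sphere (0 :: real ^ 'n) 1"
    by simp
  then have "?K \<noteq> {}"
    using False by blast
  then obtain p where p: "p \<in> ?K" "\<And>q. q \<in> ?K \<Longrightarrow> h (fst p) (snd p) (snd p) \<le> h (fst q) (snd q) (snd q)"
    using continuous_attains_inf[OF compact_Times[OF assms(1) compact_sphere] _ cont] by blast
  define m where "m = h (fst p) (snd p) (snd p)"
  have "m > 0"
    using p(1) assms(2) unfolding m_def by (intro h_pos) auto
  moreover have "m * (norm u)\<^sup>2 \<le> h y u u" if "y \<in> S" for y u
  proof (cases "u = 0")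
    case False
    have "m \<le> h y (u /\<^sub>R norm u) (u /\<^sub>R norm u)"
      using p(2)[of "(y, u /\<^sub>R norm u)"] that False by (simp add: m_def)
    also have "\<dots> = h y u u / (norm u)\<^sup>2"
      by (simp add: blinfun.bilinear_simps power2_eq_square divide_inverse)
    finally show ?thesis
      using False by (simp add: field_simps)
  qed simp
  ultimately show ?thesis
    by blast
qed (auto intro: exI[of _ 1])

context randers_homothetic
begin

text \<open>For a Killing field the second derivatives are linear in the field and its first derivatives,
  by the permutation of indices that also yields the Christoffel symbols.\<close>

lemma killing_second_derivative:
  assumes "\<sigma> = 0" "x \<in> U"
  defines "c \<equiv> \<lambda>v u w. blinfun_derivative h1 x v (W x) u w + h1 x (W1 x v) u w
    + h1 x v (W1 x u) w + h1 x v u (W1 x w)"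
  shows "2 * h x (blinfun_derivative W1 x v u) w = c w v u - c v u w - c u v w"
proof -
  have eq: "h x (blinfun_derivative W1 x v u) w + h x u (blinfun_derivative W1 x v w) = - c v u w" for u v w
  proof -
    have h1: "(h1 has_derivative blinfun_apply (blinfun_derivative h1 x)) (at x)"
      by (rule h1_has_derivative[OF assms(2)])
    note d = h1 h_has_derivative[OF assms(2)] C2_derivatives[OF W_C2 assms(2)]
    have "((\<lambda>x. h1 x (W x) u w + h x (W1 x u) w + h x u (W1 x w)) has_derivative
        (\<lambda>v. c v u w + h x (blinfun_derivative W1 x v u) w + h x u (blinfun_derivative W1 x v w))) (at x)"
      by (auto intro!: derivative_eq_intros d simp: c_def blinfun.bilinear_simps fun_eq_iff)
    from has_derivative_eq_on_open[OF this has_derivative_const open_U assms(2), of 0 v] show ?thesis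
      using lie_h_W assms(1) by simp
  qed
  have W2: "blinfun_derivative W1 x a b = blinfun_derivative W1 x b a" for a b
    by (rule blinfun_derivative_symmetric[OF open_U assms(2) W_C2])
  show ?thesis
    using eq[of v u w] eq[of u v w] eq[of w v u] h_sym[OF assms(2)]
    by (simp add: W2[of u v] W2[of w v] W2[of w u])
qed

text \<open>Along the segment from z to x the pair of W and its derivative solves a linear
  differential equation with bounded coefficients, by \<open>killing_second_derivative\<close>, and
  starts at zero; Gronwall's estimate applies to its squared size.\<close>

lemma unique_continuation:
  assumes "convex C" "C \<subseteq> U" "open T" "\<And>y. y \<in> T \<Longrightarrow> W y = 0" "z \<in> T" "z \<in> C" "x \<in> C"
  shows "W x = 0"
proof -
  define S where "S = closed_segment z x"
  have S: "compact S" "S \<subseteq> U"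
    using assms closed_segment_subset[of z C x] by (auto simp: S_def)
  have z: "z \<in> U"
    using assms by auto
  have W1z: "W1 z = 0"
  proof (rule blinfun_derivative_eqI)
    show "(W has_derivative blinfun_apply 0) (at z)"
      by (rule has_derivative_transform_within_open[of "\<lambda>_. 0" _ _ _ T]) (use assms in \<open>auto simp: zero_blinfun.rep_eq\<close>)
  qed
  \<comment> \<open>W and its derivative vanish at z, so the homothety equation leaves no
    dilation.\<close>
  have "\<sigma> * h z (axis undefined 1) (axis undefined 1) = 0"
    using lie_h_W[OF z, of "axis undefined 1" "axis undefined 1"] W1z assms(4,5)
    by (simp add: blinfun.bilinear_simps)
  then have \<sigma>: "\<sigma> = 0"
    using h_pos[OF z, of "axis undefined 1"] by auto
  let ?h2 = "blinfun_derivative h1" and ?W2 = "blinfun_derivative W1"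
  have C1: "Ck_on 1 h1 U"
    by (rule Ck_on_blinfun_derivative[OF open_U h_C2[folded Suc_1]])
  have "continuous_on U ?h2"
    by (rule Ck_on_imp_continuous_on[OF Ck_on_blinfun_derivative[OF open_U C1[unfolded One_nat_def]]])
  then have "bounded (?h2 ` S)" "bounded (h1 ` S)"
    using S Ck_on_imp_continuous_on[OF C1]
    by (auto intro!: compact_imp_bounded compact_continuous_image intro: continuous_on_subset)
  then obtain K1 K2 where K1: "\<And>y. y \<in> S \<Longrightarrow> norm (?h2 y) \<le> K1" and K2: "\<And>y. y \<in> S \<Longrightarrow> norm (h1 y) \<le> K2"
    by (auto simp: bounded_iff)
  define K where "K = max K1 K2"
  have K: "norm (?h2 y) \<le> K" "norm (h1 y) \<le> K" if "y \<in> S" for y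
    using K1 K2 that by (auto simp: K_def le_max_iff_disj)
  have "z \<in> S"
    by (simp add: S_def)
  then have K0: "0 \<le> K"
    using K(1) norm_ge_zero order_trans by blast
  obtain m where m: "m > 0" "\<And>y u. y \<in> S \<Longrightarrow> m * (norm u)\<^sup>2 \<le> h y u u"
    using h_lower_bound[OF S] by blast
  \<comment> \<open>Dominates W and its derivative, the latter both on basis vectors and in operator
    norm.\<close>
  define s where "s y = norm (W y) + (\<Sum>b\<in>Basis. norm (W1 y b))" for y
  have s: "0 \<le> s y" "norm (W y) \<le> s y" "norm (W1 y) \<le> s y" "b \<in> Basis \<Longrightarrow> norm (W1 y b) \<le> s y" for y b
  proof -
    have 1: "0 \<le> (\<Sum>b\<in>Basis. norm (W1 y b))"
      by (simp add: sum_nonneg)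
    then show "0 \<le> s y" "norm (W y) \<le> s y"
      by (simp_all add: s_def)
    show "norm (W1 y) \<le> s y"
      using norm_blinfun_euclidean_le[of "W1 y"] norm_ge_zero[of "W y"] unfolding s_def by linarith
    show "norm (W1 y b) \<le> s y" if "b \<in> Basis"
      using member_le_sum[of b Basis "\<lambda>b. norm (W1 y b)"] that
      unfolding s_def by (simp add: add_increasing)
  qed
  \<comment> \<open>Each c has four terms bounded by K s |v| |u| |w|, and three values of c make 12
    K; the factor 2 and the lower bound m of h leave 6 K / m.\<close>
  define L where "L = 6 * K / m"
  have W2: "norm (?W2 y v u) \<le> L * s y * norm v * norm u" if "y \<in> S" for y u v
  proof -
    define c where "c v u w = ?h2 y v (W y) u w + h1 y (W1 y v) u w + h1 y v (W1 y u) w + h1 y v u (W1 y w)" for v u w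
    have c: "\<bar>c v u w\<bar> \<le> 4 * K * s y * norm v * norm u * norm w" for v u w
    proof -
      have W1: "norm (W1 y a) \<le> s y * norm a" for a
        by (rule order_trans[OF norm_blinfun mult_right_mono[OF s(3)]]) simp
      have "norm (?h2 y v (W y) u w) \<le> K * norm v * s y * norm u * norm w"
        by (rule order_trans[OF norm_blinfun4])
          (intro mult_mono mult_nonneg_nonneg K(1) that s(1,2) K0 order_refl norm_ge_zero)
      moreover have "norm (h1 y (W1 y v) u w) \<le> K * (s y * norm v) * norm u * norm w"
        by (rule order_trans[OF norm_blinfun3])
          (intro mult_mono mult_nonneg_nonneg K(2) that s(1) W1 K0 order_refl norm_ge_zero)
      moreover have "norm (h1 y v (W1 y u) w) \<le> K * norm v * (s y * norm u) * norm w"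
        by (rule order_trans[OF norm_blinfun3])
          (intro mult_mono mult_nonneg_nonneg K(2) that s(1) W1 K0 order_refl norm_ge_zero)
      moreover have "norm (h1 y v u (W1 y w)) \<le> K * norm v * norm u * (s y * norm w)"
        by (rule order_trans[OF norm_blinfun3])
          (intro mult_mono mult_nonneg_nonneg K(2) that s(1) W1 K0 order_refl norm_ge_zero)
      ultimately show ?thesis
        unfolding c_def real_norm_def by (simp add: algebra_simps abs_le_iff)
    qed
    define X where "X = ?W2 y v u"
    have yU: "y \<in> U"
      using that S by auto
    have "2 * h y X X = c X v u - c v u X - c u v X"
      unfolding X_def c_def by (rule killing_second_derivative[OF \<sigma> yU])
    also have "\<dots> \<le> 12 * K * s y * norm v * norm u * norm X"
      using c[of X v u] c[of v u X] c[of u v X] by (simp add: algebra_simps abs_le_iff)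
    finally have "2 * (m * (norm X)\<^sup>2) \<le> 12 * K * s y * norm v * norm u * norm X"
      using m(2)[OF that, of X] by linarith
    then have "(m * norm X) * norm X \<le> (6 * K * s y * norm v * norm u) * norm X"
      by (simp add: power2_eq_square algebra_simps)
    then have "m * norm X \<le> 6 * K * s y * norm v * norm u"
      using K0 s(1)[of y] by (cases "X = 0") auto
    then show ?thesis
      using m(1) by (simp add: X_def L_def field_simps)
  qed
  define v where "v = x - z"
  \<comment> \<open>Comparable to s^2, but a sum of inner products and hence differentiable in
    t.\<close>
  define g where "g t = W (z + t *\<^sub>R v) \<bullet> W (z + t *\<^sub>R v) + (\<Sum>b\<in>Basis. W1 (z + t *\<^sub>R v) b \<bullet> W1 (z + t *\<^sub>R v) b)" for t
  define g' where "g' t = 2 * (W (z + t *\<^sub>R v) \<bullet> W1 (z + t *\<^sub>R v) v)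
    + (\<Sum>b\<in>Basis. 2 * (W1 (z + t *\<^sub>R v) b \<bullet> ?W2 (z + t *\<^sub>R v) v b))" for t
  have seg: "z + t *\<^sub>R v \<in> S" if "0 \<le> t" "t \<le> 1" for t
    using that unfolding S_def v_def closed_segment_def by (auto intro!: exI[of _ t] simp: algebra_simps)
  have "g 1 \<le> 0"
  proof (rule gronwall_zero)
    fix t :: real assume t: "0 \<le> t" "t \<le> 1"
    define y where "y = z + t *\<^sub>R v"
    have y: "y \<in> S" "y \<in> U"
      using seg[OF t] S by (auto simp: y_def)
    have \<gamma>: "((\<lambda>t. z + t *\<^sub>R v) has_derivative (\<lambda>r. r *\<^sub>R v)) (at t)"
      by (auto intro!: derivative_eq_intros)
    have Wg: "((\<lambda>t. W (z + t *\<^sub>R v)) has_derivative (\<lambda>r. W1 y (r *\<^sub>R v))) (at t)"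
      using has_derivative_compose[OF \<gamma>, of W "blinfun_apply (W1 y)"] C2_derivatives(1)[OF W_C2 y(2)] by (simp add: y_def)
    have W1g: "((\<lambda>t. W1 (z + t *\<^sub>R v)) has_derivative (\<lambda>r. ?W2 y (r *\<^sub>R v))) (at t)"
      using has_derivative_compose[OF \<gamma>, of W1 "blinfun_apply (?W2 y)"] C2_derivatives(2)[OF W_C2 y(2)] by (simp add: y_def)
    show "(g has_real_derivative g' t) (at t)"
      unfolding has_field_derivative_def g_def
      by (auto intro!: derivative_eq_intros Wg W1g simp: fun_eq_iff g'_def y_def[symmetric]
          blinfun.bilinear_simps inner_commute sum_distrib_left algebra_simps)
    have "W y \<bullet> W1 y v \<le> s y * (s y * norm v)"
      by (rule order_trans[OF norm_cauchy_schwarz])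
        (intro mult_mono s order_trans[OF norm_blinfun] mult_right_mono norm_ge_zero)
    moreover have "(\<Sum>b\<in>Basis. 2 * (W1 y b \<bullet> ?W2 y v b)) \<le> (\<Sum>b\<in>(Basis :: (real ^ 'n) set). 2 * (s y * (L * s y * norm v)))"
    proof (rule sum_mono)
      fix b :: "real ^ 'n" assume b: "b \<in> Basis"
      have "W1 y b \<bullet> ?W2 y v b \<le> s y * (L * s y * norm v)"
      proof (rule order_trans[OF norm_cauchy_schwarz mult_mono])
        show "norm (?W2 y v b) \<le> L * s y * norm v"
          using W2[OF y(1), of v b] b by simp
      qed (use b s in auto)
      then show "2 * (W1 y b \<bullet> ?W2 y v b) \<le> 2 * (s y * (L * s y * norm v))"
        by simp
    qed
    ultimately have "g' t \<le> (2 * norm v * (1 + DIM(real ^ 'n) * L)) * (s y)\<^sup>2"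
      by (simp add: g'_def y_def[symmetric] power2_eq_square algebra_simps)
    also have "\<dots> \<le> (2 * norm v * (1 + DIM(real ^ 'n) * L)) * (2 * (1 + DIM(real ^ 'n)) * g t)"
    proof (rule mult_left_mono)
      \<comment> \<open>Combines (a + b)^2 \<le> 2 a^2 + 2 b^2 with the Cauchy-Schwarz inequality
        for the sum over the basis.\<close>
      have arith: "s2 \<le> 2 * (1 + d) * (a + S)" if "q2 \<le> S * d" "s2 \<le> 2 * a + 2 * q2" "0 \<le> S" "0 \<le> d * a"
        for s2 q2 a S d :: real
        using that by (simp add: algebra_simps)
      define q where "q = (\<Sum>b\<in>Basis. norm (W1 y b))"
      have f1: "q\<^sup>2 \<le> (\<Sum>b\<in>Basis. (norm (W1 y b))\<^sup>2) * DIM(real ^ 'n)"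
        unfolding q_def by (rule sum_squared_le_sum_of_squares)
      have f2: "(s y)\<^sup>2 \<le> 2 * (norm (W y))\<^sup>2 + 2 * q\<^sup>2"
        using sum_squares_bound[of "norm (W y)" q] by (simp add: s_def q_def[symmetric] power2_sum)
      have gt: "g t = (norm (W y))\<^sup>2 + (\<Sum>b\<in>Basis. (norm (W1 y b))\<^sup>2)"
        by (simp add: g_def y_def power2_norm_eq_inner)
      have f3: "0 \<le> (\<Sum>b\<in>Basis. (norm (W1 y b))\<^sup>2)"
        by (simp add: sum_nonneg)
      have f4: "0 \<le> DIM(real ^ 'n) * (norm (W y))\<^sup>2"
        by simp
      show "(s y)\<^sup>2 \<le> 2 * (1 + DIM(real ^ 'n)) * g t"
        using arith[OF f1 f2 f3 f4] unfolding gt by simp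
      show "0 \<le> 2 * norm v * (1 + DIM(real ^ 'n) * L)"
        using K0 m(1) by (simp add: L_def)
    qed
    finally show "g' t \<le> (2 * norm v * (1 + DIM(real ^ 'n) * L) * (2 * (1 + DIM(real ^ 'n)))) * g t"
      by (simp add: mult.assoc)
  next
    show "g 0 = 0"
      using assms(4)[OF assms(5)] by (simp add: g_def W1z)
  qed
  moreover have "0 \<le> (\<Sum>b\<in>Basis. W1 x b \<bullet> W1 x b)"
    by (simp add: sum_nonneg)
  ultimately have "W x \<bullet> W x \<le> 0"
    by (simp add: g_def v_def)
  then show ?thesis
    using inner_gt_zero_iff[of "W x"] by linarith
qed

end

section \<open>From metrics in a chart to the invariant description\<close>

text \<open>Assembled from compositions of bounded linear maps, so that the rules for
  \<open>Ck_on\<close> give regularity in a parameter.\<close>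

definition bil2 :: "('n \<Rightarrow> 'n \<Rightarrow> 'b) \<Rightarrow> (real ^ 'n) \<Rightarrow>\<^sub>L (real ^ 'n) \<Rightarrow>\<^sub>L 'b::real_normed_vector" where
  "bil2 T = (\<Sum>i\<in>UNIV. blinfun_scaleR_left (\<Sum>j\<in>UNIV. blinfun_scaleR_left (T i j) o\<^sub>L blinfun_inner_left (axis j 1))
    o\<^sub>L blinfun_inner_left (axis i 1))"

lemma bil2_apply: "bil2 T u v = (\<Sum>i\<in>UNIV. \<Sum>j\<in>UNIV. (u $ i * v $ j) *\<^sub>R T i j)"
  by (simp add: bil2_def blinfun.bilinear_simps inner_axis scaleR_sum_right)

lemma bil2_eq:
  fixes f :: "real ^ 'n \<Rightarrow> real ^ 'n \<Rightarrow> 'b::real_normed_vector"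
  assumes "\<And>u. linear (f u)" "\<And>v. linear (\<lambda>u. f u v)"
  shows "bil2 (\<lambda>i j. f (axis i 1) (axis j 1)) u v = f u v"
proof -
  have "bil2 (\<lambda>i j. f (axis i 1) (axis j 1)) u v = (\<Sum>i\<in>UNIV. u $ i *\<^sub>R f (axis i 1) v)"
  proof -
    have "(\<Sum>j\<in>UNIV. (u $ i * v $ j) *\<^sub>R f (axis i 1) (axis j 1)) = u $ i *\<^sub>R f (axis i 1) v" for i
      using arg_cong[OF linear_vec_expansion[OF assms(1), of v "axis i 1"], of "(*\<^sub>R) (u $ i)"]
      by (simp add: scaleR_sum_right)
    then show ?thesis
      by (simp add: bil2_apply)
  qed
  also have "\<dots> = f u v"
    by (rule linear_vec_expansion[OF assms(2)])
  finally show ?thesis .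
qed

lemma Ck_on_bil2:
  assumes "open S" "\<And>i j. Ck_on k (\<lambda>x. T x i j) S"
  shows "Ck_on k (\<lambda>x. bil2 (T x)) S"
  unfolding bil2_def using assms
  by (intro Ck_on_sum Ck_on_bilinear[OF bounded_bilinear_blinfun_compose] Ck_on_const
      Ck_on_bounded_linear[OF bounded_linear_blinfun_scaleR_left])

definition bilh :: "real ^ 'n ^ 'n \<Rightarrow> (real ^ 'n) \<Rightarrow>\<^sub>L (real ^ 'n) \<Rightarrow>\<^sub>L real" where
  "bilh H = bil2 (\<lambda>i j. H $ i $ j)"

lemma bilh_apply: "bilh H u v = bil H u v"
  by (simp add: bilh_def bil2_apply bil_def mult_ac)

lemma bil_inner:
  assumes "transpose H = H"
  shows "bil H z w = (H *v z) \<bullet> w"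
proof -
  have "H $ i $ j = H $ j $ i" for i j
    using arg_cong[OF assms, of "\<lambda>M. M $ j $ i"] by (simp add: transpose_def)
  then have "bil H z w = (\<Sum>i\<in>UNIV. \<Sum>j\<in>UNIV. H $ j $ i * z $ i * w $ j)"
    by (simp add: bil_def)
  then show ?thesis
    by (subst (asm) sum.swap) (simp add: matrix_vector_mult_def inner_vec_def sum_distrib_right)
qed

text \<open>The Koszul formula determines \<Gamma>; raising its index with the inverse matrix of h
  preserves regularity.\<close>

lemma christoffel_exists:
  fixes H :: "real ^ 'n \<Rightarrow> real ^ 'n ^ 'n::finite"
  assumes "open U" "smooth_on H U" "\<And>x. x \<in> U \<Longrightarrow> transpose (H x) = H x"
    and pos: "\<And>x y. x \<in> U \<Longrightarrow> y \<noteq> 0 \<Longrightarrow> bil (H x) y y > 0"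
  shows "\<exists>\<Gamma>. riemannian_chart U (\<lambda>x. bilh (H x)) \<Gamma>"
proof -
  define h where "h x = bilh (H x)" for x
  define h1 where "h1 = blinfun_derivative h"
  have h_Ck: "Ck_on k h U" for k
    unfolding h_def bilh_def using assms(2)
    by (intro Ck_on_bil2 Ck_on_vec_nth assms(1)) (simp add: smooth_on_def)
  have hd: "(h has_derivative blinfun_apply (h1 x)) (at x)" if "x \<in> U" for x
    unfolding h1_def by (rule Ck_on_Suc_has_derivative[OF h_Ck assms(1) that])
  have h_sym: "h x u v = h x v u" if "x \<in> U" for x u v
    using assms(3)[OF that] by (simp add: h_def bilh_apply bil_inner)
      (metis dot_lmul_matrix inner_commute transpose_matrix_vector)
  have h1_sym: "h1 x w u v = h1 x w v u" if "x \<in> U" for x w u v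
    by (rule has_derivative_eq_on_open[OF has_derivative_blinfun_apply2[OF hd]
          has_derivative_blinfun_apply2[OF hd] assms(1)]) (use that h_sym in auto)
  have inv: "invertible (H x)" if "x \<in> U" for x
  proof -
    have "u = 0" if "H x *v u = 0" for u
      using pos[OF \<open>x \<in> U\<close>, of u] that assms(3)[OF \<open>x \<in> U\<close>] by (auto simp: bil_inner)
    then have "inj ((*v) (H x))"
      by (intro linear_injective_0[OF matrix_vector_mul_linear, THEN iffD2]) blast
    then show ?thesis
      using matrix_left_invertible_injective invertible_left_inverse by blast
  qed
  \<comment> \<open>The Christoffel symbols of the first kind.\<close>
  define b where "b x u v = (\<chi> l. (1/2) * (h1 x u v (axis l 1) + h1 x v u (axis l 1) - h1 x (axis l 1) u v))" for x u v
  define f where "f x u v = matrix_inv (H x) *v b x u v" for x u v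
  define \<Gamma> where "\<Gamma> x = bil2 (\<lambda>i j. f x (axis i 1) (axis j 1))" for x
  have b_lin: "b x (u + u') v = b x u v + b x u' v" "b x (r *\<^sub>R u) v = r *\<^sub>R b x u v"
    "b x u (v + v') = b x u v + b x u v'" "b x u (r *\<^sub>R v) = r *\<^sub>R b x u v" for x u u' v v' r
    by (simp_all add: b_def vec_eq_iff blinfun.bilinear_simps field_simps)
  have \<Gamma>_eq: "\<Gamma> x u v = f x u v" for x u v
    unfolding \<Gamma>_def by (rule bil2_eq)
      (auto intro!: linearI simp: f_def b_lin matrix_vector_right_distrib scaleR_matrix_vector_assoc[symmetric]
        matrix_vector_mult_scaleR)
  have koszul: "2 * h x (\<Gamma> x u v) w = h1 x u v w + h1 x v u w - h1 x w u v" if "x \<in> U" for x u v w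
  proof -
    have "h x (\<Gamma> x u v) w = (H x *v (matrix_inv (H x) *v b x u v)) \<bullet> w"
      using assms(3)[OF that] by (simp add: h_def bilh_apply bil_inner \<Gamma>_eq f_def)
    also have "\<dots> = b x u v \<bullet> w"
      using inv[OF that] by (simp add: matrix_vector_mul_assoc matrix_inv_right)
    also have "\<dots> = (\<Sum>l\<in>UNIV. w $ l *\<^sub>R ((1/2) * (h1 x u v (axis l 1) + h1 x v u (axis l 1) - h1 x (axis l 1) u v)))"
      by (simp add: b_def inner_vec_def mult.commute)
    also have "\<dots> = (1/2) * (h1 x u v w + h1 x v u w - h1 x w u v)"
      by (rule linear_vec_expansion) (auto intro!: linearI simp: blinfun.bilinear_simps field_simps)
    finally show ?thesis
      by simp
  qed
  have "riemannian_chart U h \<Gamma>"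
  proof
    show "Ck_on 2 \<Gamma> U"
      unfolding \<Gamma>_def
    proof (intro Ck_on_bil2 Ck_on_vecI assms(1))
      fix i j k
      have h1_Ck: "Ck_on 2 h1 U"
        unfolding h1_def by (rule Ck_on_blinfun_derivative[OF assms(1) h_Ck])
      have "Ck_on 2 (\<lambda>x. h1 x (axis p 1) (axis q 1) (axis r 1)) U" for p q r
        by (intro Ck_on_blinfun_apply h1_Ck Ck_on_const assms(1))
      then have "Ck_on 2 (\<lambda>x. b x (axis i 1) (axis j 1) $ l) U" for l
        unfolding b_def using assms(1)
        by (simp only: vec_lambda_beta)
          (intro Ck_on_bilinear[OF bounded_bilinear_mult] Ck_on_const Ck_on_add Ck_on_diff)
      moreover have "Ck_on 2 (\<lambda>x. matrix_inv (H x) $ k $ l) U" for l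
        using assms(2) by (intro Ck_on_vec_nth Ck_on_matrix_inv assms(1) inv) (simp add: smooth_on_def)
      ultimately have "Ck_on 2 (\<lambda>x. \<Sum>l\<in>UNIV. matrix_inv (H x) $ k $ l * b x (axis i 1) (axis j 1) $ l) U"
        by (intro Ck_on_sum Ck_on_bilinear[OF bounded_bilinear_mult] assms(1))
      then show "Ck_on 2 (\<lambda>x. f x (axis i 1) (axis j 1) $ k) U"
        by (simp only: f_def matrix_vector_mult_def vec_lambda_beta)
    qed
    fix x u v assume x: "x \<in> U"
    show "h x u v = h x v u"
      by (rule h_sym[OF x])
    have "b x u v = b x v u"
      using h1_sym[OF x] by (simp add: b_def vec_eq_iff)
    then show "\<Gamma> x u v = \<Gamma> x v u"
      by (simp add: \<Gamma>_eq f_def)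
    show "blinfun_derivative h x w u v = h x (\<Gamma> x w u) v + h x u (\<Gamma> x w v)" for w
      using koszul[OF x, of w u v] koszul[OF x, of w v u] h_sym[OF x, of u "\<Gamma> x w v"] h1_sym[OF x]
      unfolding h1_def[symmetric] by simp
  qed (use assms h_Ck in \<open>auto simp: h_def bilh_apply\<close>)
  then show ?thesis
    by (auto simp: h_def[abs_def])
qed

lemma randers_chart_exists:
  fixes H :: "real ^ 'n \<Rightarrow> real ^ 'n ^ 'n::finite" and W :: "real ^ 'n \<Rightarrow> real ^ 'n"
  assumes "open U" "smooth_on H U" "\<And>x. x \<in> U \<Longrightarrow> transpose (H x) = H x"
    and "\<And>x y. x \<in> U \<Longrightarrow> y \<noteq> 0 \<Longrightarrow> bil (H x) y y > 0"
    and "Ck_on 2 W U" "\<And>x. x \<in> U \<Longrightarrow> bil (H x) (W x) (W x) < 1"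
  shows "\<exists>\<Gamma> B. randers_chart U (\<lambda>x. bilh (H x)) \<Gamma> W B"
proof -
  obtain \<Gamma> where \<Gamma>: "riemannian_chart U (\<lambda>x. bilh (H x)) \<Gamma>"
    using christoffel_exists[OF assms(1-4)] by blast
  interpret riemannian_chart U "\<lambda>x. bilh (H x)" \<Gamma>
    by (rule \<Gamma>)
  define B where "B x = blinfun_derivative W x + \<Gamma> x (W x)" for x
  have "randers_chart U (\<lambda>x. bilh (H x)) \<Gamma> W B"
  proof
    fix x assume x: "x \<in> U"
    have "(W has_derivative blinfun_apply (blinfun_derivative W x)) (at x)"
      by (rule Ck_on_Suc_has_derivative[OF assms(5)[folded Suc_1] assms(1) x])
    moreover have "blinfun_apply (blinfun_derivative W x) = (\<lambda>w. B x w - \<Gamma> x w (W x))"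
      using \<Gamma>_sym[OF x] by (simp add: fun_eq_iff B_def blinfun.bilinear_simps)
    ultimately show "(W has_derivative (\<lambda>w. B x w - \<Gamma> x w (W x))) (at x)"
      by (simp only:)
    show "bilh (H x) (W x) (W x) < 1"
      using assms(6)[OF x] by (simp add: bilh_apply)
  next
    show "Ck_on 1 B U"
      unfolding B_def
      by (intro Ck_on_add Ck_on_blinfun_apply Ck_on_blinfun_derivative[OF assms(1) assms(5)[folded Suc_1]]
          Ck_on_mono[OF \<Gamma>_C2] Ck_on_mono[OF assms(5)] assms(1)) simp_all
  qed
  then show ?thesis
    by blast
qed

context randers_homothetic
begin

text \<open>The norm of h is the Randers metric with W = 0, so \<open>Ric_F\<close> applies with
  \<sigma> = 0 and u = y.\<close>

lemma Ric_norm: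
  assumes "x \<in> U" "y \<noteq> 0"
  shows "Ric (\<lambda>x y. sqrt (h x y y)) x y = Rc x y y"
proof -
  interpret R: randers_homothetic U h \<Gamma> "\<lambda>_. 0" "\<lambda>_. 0" 0
    by unfold_locales (simp_all add: blinfun.bilinear_simps open_U)
  have "R.F = (\<lambda>x y. sqrt (h x y y))"
    by (simp add: R.F_def R.root_def R.lam_def blinfun.bilinear_simps fun_eq_iff)
  moreover have "R.yt x y = y"
    by (simp add: R.yt_def)
  ultimately show ?thesis
    using R.Ric_F[OF assms] by simp
qed

end

text \<open>\<open>frechet_derivative\<close> is a choice from a predicate that coincides for f and
  g, so the equality holds even at points without derivative. This covers the logarithm of
  \<open>sigma_BH\<close>, whose differentiability is never established.\<close>

lemma frechet_derivative_cong:
  assumes "open S" "x \<in> S" "\<And>z. z \<in> S \<Longrightarrow> f z = g z"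
  shows "frechet_derivative f (at x) = frechet_derivative g (at x)"
proof -
  have "(f has_derivative D) (at x) \<longleftrightarrow> (g has_derivative D) (at x)" for D
    using has_derivative_transform_within_open[OF _ assms(1,2)] assms(3) by metis
  then show ?thesis
    by (simp add: frechet_derivative_def)
qed

text \<open>The components of a metric are unconstrained off the image of the chart, so the Randers metric
  coincides with the function studied above only there.\<close>

definition agree :: "(real ^ 'n) set \<Rightarrow> 'n::finite locfun \<Rightarrow> 'n locfun \<Rightarrow> bool" where
  "agree U f g \<longleftrightarrow> (\<forall>x\<in>U. f x = g x)"

lemma agree_dx:
  assumes "open U" "agree U f g"
  shows "agree U (dx i f) (dx i g)"
  unfolding agree_def
proof (intro ballI ext)
  fix x y assume "x \<in> U"
  then show "dx i f x y = dx i g x y"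
    using assms(2) unfolding dx_def agree_def by (subst frechet_derivative_cong[OF assms(1)]) auto
qed

lemma agree_dy: "agree U f g \<Longrightarrow> agree U (dy i f) (dy i g)"
  by (simp add: agree_def dy_def fun_eq_iff)

lemma agree_sq: "agree U f g \<Longrightarrow> agree U (sq f) (sq g)"
  by (simp add: agree_def sq_def fun_eq_iff)

lemma agree_spray_coeff:
  assumes "open U" "agree U f g"
  shows "agree U (spray_coeff f i) (spray_coeff g i)"
proof -
  note 1 = agree_dy[OF agree_sq[OF assms(2)]]
  show ?thesis
    using agree_dy[OF 1] agree_dx[OF assms(1) 1] agree_dx[OF assms(1) agree_sq[OF assms(2)]]
    unfolding agree_def by (simp add: spray_coeff_def fundamental_tensor_def fun_eq_iff)
qed

lemma agree_Ric:
  assumes "open U" "agree U f g"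
  shows "agree U (Ric f) (Ric g)"
proof -
  note G = agree_spray_coeff[OF assms]
  show ?thesis
    using agree_dx[OF assms(1) G] agree_dy[OF G] agree_dx[OF assms(1) agree_dy[OF G]] agree_dy[OF agree_dy[OF G]] G
    unfolding agree_def by (simp add: Ric_def riemann_curv_def Let_def fun_eq_iff)
qed

lemma agree_S_BH:
  assumes "open U" "agree U f g"
  shows "agree U (S_BH f) (S_BH g)"
proof -
  have "frechet_derivative (\<lambda>x'. ln (sigma_BH f x')) (at x) = frechet_derivative (\<lambda>x'. ln (sigma_BH g x')) (at x)"
    if "x \<in> U" for x
    using assms(2) that by (intro frechet_derivative_cong[OF assms(1)]) (simp_all add: agree_def sigma_BH_def)
  then show ?thesis
    using agree_dy[OF agree_spray_coeff[OF assms]] unfolding agree_def by (simp add: S_BH_def fun_eq_iff)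
qed

lemma agree_complete_lift:
  assumes "open U" "agree U f g"
  shows "agree U (complete_lift V f) (complete_lift V g)"
  using agree_dx[OF assms] agree_dy[OF assms(2)] unfolding agree_def by (simp add: complete_lift_def fun_eq_iff)

section \<open>Manifolds\<close>

text \<open>Naturality under coordinate changes. Differentiating the transformation law of V
  produces the second derivative of \<tau>, and its symmetry matches the term that comes from the
  tangent map of \<tau>.\<close>

lemma complete_lift_transform:
  fixes \<tau> :: "real ^ 'n \<Rightarrow> real ^ 'n::finite"
  assumes "open S" "x \<in> S" "Ck_on 2 \<tau> S"
    and f: "\<And>z y. z \<in> S \<Longrightarrow> f z y = f' (\<tau> z) (blinfun_derivative \<tau> z y)"
    and f': "((\<lambda>p. f' (fst p) (snd p)) has_derivative D) (at (\<tau> x, blinfun_derivative \<tau> x y))"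
    and V: "(V has_derivative blinfun_apply V1) (at x)" and V': "(V' has_derivative blinfun_apply V1') (at (\<tau> x))"
    and tr: "\<And>z. z \<in> S \<Longrightarrow> V' (\<tau> z) = blinfun_derivative \<tau> z (V z)"
  shows "complete_lift V f x y = complete_lift V' f' (\<tau> x) (blinfun_derivative \<tau> x y)"
proof -
  let ?T = "blinfun_derivative \<tau>" and ?T2 = "blinfun_derivative (blinfun_derivative \<tau>)"
  have \<tau>: "(\<tau> has_derivative blinfun_apply (?T x)) (at x)"
    by (rule Ck_on_Suc_has_derivative[OF assms(3)[folded Suc_1] assms(1,2)])
  have "Ck_on (Suc 0) ?T S"
    using Ck_on_blinfun_derivative[OF assms(1) assms(3)[folded Suc_1]] by (simp only: One_nat_def)
  then have T: "(?T has_derivative blinfun_apply (?T2 x)) (at x)"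
    by (rule Ck_on_Suc_has_derivative[OF _ assms(1,2)])
  have "((\<lambda>p. (\<tau> (fst p), ?T (fst p) (snd p))) has_derivative
      (\<lambda>q. (?T x (fst q), ?T2 x (fst q) y + ?T x (snd q)))) (at (x, y))"
  proof -
    have 1: "((\<lambda>p :: (real ^ 'n) \<times> (real ^ 'n). \<tau> (fst p)) has_derivative (\<lambda>q. ?T x (fst q))) (at (x, y))"
      by (rule has_derivative_comp_fst[OF \<tau>])
    have 2: "((\<lambda>p :: (real ^ 'n) \<times> (real ^ 'n). ?T (fst p)) has_derivative (\<lambda>q. ?T2 x (fst q))) (at (x, y))"
      by (rule has_derivative_comp_fst[OF T])
    show ?thesis
      by (auto intro!: derivative_eq_intros 1 2 simp: fun_eq_iff)
  qed
  then have "((\<lambda>p. f' (\<tau> (fst p)) (?T (fst p) (snd p))) has_derivative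
      (\<lambda>q. D (?T x (fst q), ?T2 x (fst q) y + ?T x (snd q)))) (at (x, y))"
    using has_derivative_compose[of "\<lambda>p. (\<tau> (fst p), ?T (fst p) (snd p))" _ "(x, y)" UNIV "\<lambda>p. f' (fst p) (snd p)" D] f'
    by simp
  then have "((\<lambda>p. f (fst p) (snd p)) has_derivative (\<lambda>q. D (?T x (fst q), ?T2 x (fst q) y + ?T x (snd q)))) (at (x, y))"
    by (rule has_derivative_transform_within_open[of _ _ _ _ "S \<times> UNIV"])
      (simp_all add: open_Times assms(1,2) f mem_Times_iff)
  from complete_lift_eq[OF this V]
  have "complete_lift V f x y = D (?T x (V x), ?T2 x (V x) y + ?T x (V1 y))"
    by simp
  also have "?T2 x (V x) y + ?T x (V1 y) = V1' (?T x y)"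
  proof -
    have "((\<lambda>z. V' (\<tau> z)) has_derivative (\<lambda>w. V1' (?T x w))) (at x)"
      by (rule has_derivative_compose[OF \<tau> V'])
    moreover have "((\<lambda>z. ?T z (V z)) has_derivative (\<lambda>w. ?T2 x w (V x) + ?T x (V1 w))) (at x)"
      by (auto intro!: derivative_eq_intros T V simp: fun_eq_iff)
    ultimately have "V1' (?T x y) = ?T2 x y (V x) + ?T x (V1 y)"
      by (rule has_derivative_eq_on_open[OF _ _ assms(1,2) tr])
    then show ?thesis
      using blinfun_derivative_symmetric[OF assms(1-3), of "V x" y] by simp
  qed
  also have "?T x (V x) = V' (\<tau> x)"
    using tr[OF assms(2)] by simp
  finally show ?thesis
    using complete_lift_eq[OF f' V'] by simp
qed

locale atlas =
  fixes A :: "('m::{t2_space, second_countable_topology}, 'n::finite) chart set"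
  assumes manifold: "manifold_atlas A"
begin

definition dom :: "('m, 'n) chart \<Rightarrow> (real ^ 'n) set" where "dom c = snd c ` fst c"

definition pt :: "('m, 'n) chart \<Rightarrow> real ^ 'n \<Rightarrow> 'm" where "pt c = the_inv_into (fst c) (snd c)"

lemma is_chart: "c \<in> A \<Longrightarrow> is_chart c"
  using manifold by (simp add: manifold_atlas_def smooth_atlas_def)

lemma homeo: "c \<in> A \<Longrightarrow> homeomorphism (fst c) (dom c) (snd c) (pt c)"
  using is_chart by (simp add: is_chart_def dom_def pt_def)

lemma open_dom: "c \<in> A \<Longrightarrow> open (dom c)" and open_fst: "c \<in> A \<Longrightarrow> open (fst c)"
  using is_chart by (simp_all add: is_chart_def dom_def)

lemma pt_snd: "c \<in> A \<Longrightarrow> p \<in> fst c \<Longrightarrow> pt c (snd c p) = p"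
  by (rule homeomorphism_apply1[OF homeo])

lemma snd_pt: "c \<in> A \<Longrightarrow> x \<in> dom c \<Longrightarrow> snd c (pt c x) = x"
  by (rule homeomorphism_apply2[OF homeo])

lemma pt_in: "c \<in> A \<Longrightarrow> x \<in> dom c \<Longrightarrow> pt c x \<in> fst c"
  using homeomorphism_image2[OF homeo] by blast

lemma snd_in: "p \<in> fst c \<Longrightarrow> snd c p \<in> dom c"
  by (simp add: dom_def)

lemma chart_at: "\<exists>c\<in>A. p \<in> fst c"
  using manifold by (auto simp: manifold_atlas_def smooth_atlas_def)

lemma open_preimage: "c \<in> A \<Longrightarrow> open S \<Longrightarrow> open (fst c \<inter> snd c -` S)"
  using homeo open_fst by (intro continuous_open_preimage) (auto simp: homeomorphism_def)

lemma open_image: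
  assumes "c \<in> A" "open N" "N \<subseteq> fst c"
  shows "open (snd c ` N)"
proof -
  have "openin (top_of_set (dom c)) (snd c ` N)"
    using assms by (intro homeomorphism_imp_open_map[OF homeo]) (simp_all add: open_subset)
  then show ?thesis
    using open_dom[OF assms(1)] openin_open_eq by blast
qed

text \<open>A coordinate ball is convex, so a vanishing derivative gives constancy on it;
  connectedness of the manifold does the rest.\<close>

lemma locally_constant_on_charts:
  fixes f :: "'m \<Rightarrow> real"
  assumes "\<And>c x. c \<in> A \<Longrightarrow> x \<in> dom c \<Longrightarrow> ((\<lambda>z. f (pt c z)) has_derivative (\<lambda>_. 0)) (at x)"
  shows "f constant_on UNIV"
proof (rule locally_constant_imp_constant)
  show "connected (UNIV :: 'm set)"
    using manifold by (simp add: manifold_atlas_def)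
  fix p :: 'm
  obtain c where c: "c \<in> A" "p \<in> fst c"
    using chart_at by blast
  obtain r where r: "r > 0" "ball (snd c p) r \<subseteq> dom c"
    using open_dom[OF c(1)] snd_in[OF c(2)] open_contains_ball by blast
  let ?N = "fst c \<inter> snd c -` ball (snd c p) r"
  have const: "f (pt c z) = f (pt c (snd c p))" if "z \<in> ball (snd c p) r" for z
    using has_derivative_zero_unique[of "ball (snd c p) r" "\<lambda>z. f (pt c z)" z "snd c p"]
      has_derivative_at_withinI[OF assms[OF c(1)]] r that by fastforce
  have eq: "f q = f p" if "q \<in> ?N" for q
    using const[of "snd c q"] that c pt_snd by auto
  have N: "open ?N" "p \<in> ?N"
    using open_preimage[OF c(1)] r(1) c(2) by auto
  show "\<exists>T. openin (top_of_set UNIV) T \<and> p \<in> T \<and> (\<forall>x\<in>T. f x = f p)"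
    by (rule exI[of _ ?N], intro conjI ballI eq) (use N in simp_all)
qed

lemma overlap:
  assumes "c \<in> A" "c' \<in> A"
  defines "S \<equiv> snd c ` (fst c \<inter> fst c')"
  shows "open S" "Ck_on k (transition c c') S" "z \<in> S \<Longrightarrow> pt c z \<in> fst c \<inter> fst c'"
    and "z \<in> S \<Longrightarrow> z \<in> dom c" "z \<in> S \<Longrightarrow> transition c c' z = snd c' (pt c z)"
    and "z \<in> S \<Longrightarrow> frechet_derivative (transition c c') (at z) = blinfun_apply (blinfun_derivative (transition c c') z)"
proof -
  show S: "open S"
    unfolding S_def by (intro open_image open_Int open_fst assms(1,2)) simp
  have sm: "Ck_on k (transition c c') S" for k
    using manifold assms by (simp add: manifold_atlas_def smooth_atlas_def smooth_on_def)
  then show "Ck_on k (transition c c') S" .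
  show "z \<in> S \<Longrightarrow> pt c z \<in> fst c \<inter> fst c'" "z \<in> S \<Longrightarrow> z \<in> dom c"
    "z \<in> S \<Longrightarrow> transition c c' z = snd c' (pt c z)"
    using pt_snd[OF assms(1)] by (auto simp: S_def dom_def transition_def pt_def[symmetric])
  show "z \<in> S \<Longrightarrow> frechet_derivative (transition c c') (at z) = blinfun_apply (blinfun_derivative (transition c c') z)"
    by (rule frechet_derivative_eq[OF Ck_on_Suc_has_derivative[OF sm S]])
qed

end

section \<open>Randers metrics of constant S-curvature on a manifold\<close>

locale randers_manifold = atlas A
  for A :: "('m::{t2_space, second_countable_topology}, 'n::finite) chart set" +
  fixes h :: "('m, 'n) tensor2" and W :: "('m, 'n) vfield" and \<sigma> :: real
  assumes nav: "navigation_data A h W"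
    and S_const: "constant_S_BH A (randers_metric h W) \<sigma>"
begin

abbreviation "FM \<equiv> randers_metric h W"

lemma riem: "riemannian_metric A h" and W_field: "smooth_vector_field A W"
  using nav by (simp_all add: navigation_data_def)

lemma h_pos: "c \<in> A \<Longrightarrow> x \<in> dom c \<Longrightarrow> y \<noteq> 0 \<Longrightarrow> bil (h c x) y y > 0"
  and h_transpose: "c \<in> A \<Longrightarrow> x \<in> dom c \<Longrightarrow> transpose (h c x) = h c x"
  using riem by (auto simp: riemannian_metric_def dom_def)

lemma h_nonneg: "c \<in> A \<Longrightarrow> x \<in> dom c \<Longrightarrow> bil (h c x) y y \<ge> 0"
  using h_pos[of c x y] by (cases "y = 0") (auto simp: bil_def)

lemma metric_norm_sq: "c \<in> A \<Longrightarrow> x \<in> dom c \<Longrightarrow> (metric_norm h c x y)\<^sup>2 = bil (h c x) y y"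
  using h_nonneg by (simp add: metric_norm_def)

lemma W_Ck: "c \<in> A \<Longrightarrow> Ck_on k (W c) (dom c)"
  using W_field by (auto simp: smooth_vector_field_def Ck_vector_field_def dom_def)

lemma chart_exists:
  assumes "c \<in> A"
  shows "\<exists>\<Gamma> B. randers_chart (dom c) (\<lambda>x. bilh (h c x)) \<Gamma> (W c) B"
proof (rule randers_chart_exists[OF open_dom[OF assms]])
  show "smooth_on (h c) (dom c)"
    using riem assms by (simp add: riemannian_metric_def dom_def)
  show "bil (h c x) (W c x) (W c x) < 1" if "x \<in> dom c" for x
    using nav assms that metric_norm_sq[OF assms that, of "W c x"] h_nonneg[OF assms that, of "W c x"]
    by (auto simp: navigation_data_def dom_def metric_norm_def real_sqrt_less_iff)
qed (use assms h_pos h_transpose W_Ck in auto)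

lemma agree_FM:
  assumes "c \<in> A" "randers_chart (dom c) (\<lambda>x. bilh (h c x)) \<Gamma> (W c) B"
  shows "agree (dom c) (FM c) (randers_chart.F (\<lambda>x. bilh (h c x)) (W c))"
proof -
  interpret randers_chart "dom c" "\<lambda>x. bilh (h c x)" \<Gamma> "W c" B
    by (rule assms(2))
  show ?thesis
    unfolding agree_def
    by (simp add: fun_eq_iff randers_metric_def Let_def F_def root_def lam_def metric_norm_sq[OF assms(1)]
        bilh_apply diff_divide_distrib)
qed

lemma FM_pos:
  assumes "c \<in> A" "x \<in> dom c" "y \<noteq> 0"
  shows "FM c x y > 0"
proof -
  obtain \<Gamma> B where R: "randers_chart (dom c) (\<lambda>x. bilh (h c x)) \<Gamma> (W c) B"
    using chart_exists[OF assms(1)] by blast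
  show ?thesis
    using randers_chart.F_pos[OF R assms(2,3)] agree_FM[OF assms(1) R] assms(2) by (simp add: agree_def)
qed

lemma homothetic_chart_exists:
  assumes "c \<in> A"
  shows "\<exists>\<Gamma> B. randers_homothetic (dom c) (\<lambda>x. bilh (h c x)) \<Gamma> (W c) B \<sigma>"
proof -
  obtain \<Gamma> B where R: "randers_chart (dom c) (\<lambda>x. bilh (h c x)) \<Gamma> (W c) B"
    using chart_exists[OF assms] by blast
  interpret randers_chart "dom c" "\<lambda>x. bilh (h c x)" \<Gamma> "W c" B
    by (rule R)
  note S = agree_S_BH[OF open_U agree_FM[OF assms R]]
  have "S_BH F x y = (real CARD('n) + 1) * \<sigma> * F x y" if "x \<in> dom c" "y \<noteq> 0" for x y
    using S_const assms that S agree_FM[OF assms R] unfolding constant_S_BH_def agree_def dom_def by fastforce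
  note hom = homothetic_of_constant_S_BH[OF _ this]
  have "randers_homothetic (dom c) (\<lambda>x. bilh (h c x)) \<Gamma> (W c) B \<sigma>"
  proof
    show "bilh (h c x) (B x u) v + bilh (h c x) u (B x v) = - 4 * \<sigma> * bilh (h c x) u v"
      if "x \<in> dom c" for x u v
      by (rule hom[OF that]) (simp_all add: that)
  qed (rule W_Ck[OF assms])
  then show ?thesis
    by blast
qed

text \<open>Every nonzero y has its u and every nonzero u its y, so Einstein conditions can be
  carried in both directions.\<close>

lemma Ric_relation:
  assumes "c \<in> A" "x \<in> dom c"
  shows "y \<noteq> 0 \<Longrightarrow> \<exists>u. u \<noteq> 0 \<and> FM c x y = metric_norm h c x u \<and>
      Ric (FM c) x y = Ric (metric_norm h c) x u - (real CARD('n) - 1) * \<sigma>\<^sup>2 * (FM c x y)\<^sup>2" (is "_ \<Longrightarrow> ?P y")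
    and "u \<noteq> 0 \<Longrightarrow> \<exists>y. y \<noteq> 0 \<and> FM c x y = metric_norm h c x u \<and>
      Ric (FM c) x y = Ric (metric_norm h c) x u - (real CARD('n) - 1) * \<sigma>\<^sup>2 * (FM c x y)\<^sup>2" (is "_ \<Longrightarrow> ?Q u")
proof -
  obtain \<Gamma> B where R: "randers_homothetic (dom c) (\<lambda>x. bilh (h c x)) \<Gamma> (W c) B \<sigma>"
    using homothetic_chart_exists[OF assms(1)] by blast
  interpret R: randers_homothetic "dom c" "\<lambda>x. bilh (h c x)" \<Gamma> "W c" B \<sigma>
    by (rule R)
  note ag = agree_FM[OF assms(1) R.randers_chart_axioms]
  have FM: "FM c x = R.F x" and Ric: "Ric (FM c) x = Ric R.F x"
    using ag agree_Ric[OF R.open_U ag] assms(2) by (auto simp: agree_def)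
  have norm: "metric_norm h c = (\<lambda>x y. sqrt (bilh (h c x) y y))"
    by (simp add: metric_norm_def bilh_apply fun_eq_iff)
  have key: "R.F x y = metric_norm h c x (R.yt x y) \<and> R.yt x y \<noteq> 0 \<and>
      Ric R.F x y = Ric (metric_norm h c) x (R.yt x y) - (real CARD('n) - 1) * \<sigma>\<^sup>2 * (R.F x y)\<^sup>2"
    if "y \<noteq> 0" for y
  proof -
    have sq: "bilh (h c x) (R.yt x y) (R.yt x y) = (R.F x y)\<^sup>2"
      by (rule R.h_yt_yt[OF assms(2) that])
    have F: "R.F x y > 0"
      by (rule R.F_pos[OF assms(2) that])
    have nz: "R.yt x y \<noteq> 0"
      using sq F by auto
    show ?thesis
      using R.Ric_F[OF assms(2) that] R.Ric_norm[OF assms(2) nz] sq F nz unfolding norm by simp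
  qed
  show "y \<noteq> 0 \<Longrightarrow> ?P y"
    using key[of y] unfolding FM Ric by blast
  show "u \<noteq> 0 \<Longrightarrow> ?Q u"
    using R.F_indicatrix[OF assms(2) _ refl, of u] key unfolding FM Ric by metis
qed

lemma einstein_FM_iff:
  "einstein A FM \<nu> \<longleftrightarrow> einstein A (metric_norm h) (\<lambda>p. \<nu> p + (real CARD('n) - 1) * \<sigma>\<^sup>2)"
proof
  assume e: "einstein A FM \<nu>"
  show "einstein A (metric_norm h) (\<lambda>p. \<nu> p + (real CARD('n) - 1) * \<sigma>\<^sup>2)"
    unfolding einstein_def
  proof (intro ballI allI impI)
    fix c p and u :: "real ^ 'n" assume c: "c \<in> A" "p \<in> fst c" "u \<noteq> 0"
    obtain y where y: "y \<noteq> 0" "FM c (snd c p) y = metric_norm h c (snd c p) u"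
      "Ric (FM c) (snd c p) y = Ric (metric_norm h c) (snd c p) u - (real CARD('n) - 1) * \<sigma>\<^sup>2 * (FM c (snd c p) y)\<^sup>2"
      using Ric_relation(2)[OF c(1) snd_in[OF c(2)] c(3)] by blast
    show "Ric (metric_norm h c) (snd c p) u = (\<nu> p + (real CARD('n) - 1) * \<sigma>\<^sup>2) * (metric_norm h c (snd c p) u)\<^sup>2"
      using y e c unfolding einstein_def by (simp add: algebra_simps)
  qed
next
  assume e: "einstein A (metric_norm h) (\<lambda>p. \<nu> p + (real CARD('n) - 1) * \<sigma>\<^sup>2)"
  show "einstein A FM \<nu>"
    unfolding einstein_def
  proof (intro ballI allI impI)
    fix c p and y :: "real ^ 'n" assume c: "c \<in> A" "p \<in> fst c" "y \<noteq> 0"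
    obtain u where y: "u \<noteq> 0" "FM c (snd c p) y = metric_norm h c (snd c p) u"
      "Ric (FM c) (snd c p) y = Ric (metric_norm h c) (snd c p) u - (real CARD('n) - 1) * \<sigma>\<^sup>2 * (FM c (snd c p) y)\<^sup>2"
      using Ric_relation(1)[OF c(1) snd_in[OF c(2)] c(3)] by blast
    show "Ric (FM c) (snd c p) y = \<nu> p * (FM c (snd c p) y)\<^sup>2"
      using y e c unfolding einstein_def by (simp add: algebra_simps)
  qed
qed

lemma einstein_constant:
  assumes "CARD('n) \<ge> 3" "einstein A (metric_norm h) \<mu>"
  shows "\<mu> constant_on UNIV"
proof (rule locally_constant_on_charts)
  fix c x assume c: "c \<in> A" and x: "x \<in> dom c"
  obtain \<Gamma> B where R: "randers_homothetic (dom c) (\<lambda>x. bilh (h c x)) \<Gamma> (W c) B \<sigma>"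
    using homothetic_chart_exists[OF c] by blast
  interpret R: randers_homothetic "dom c" "\<lambda>x. bilh (h c x)" \<Gamma> "W c" B \<sigma>
    by (rule R)
  have norm: "metric_norm h c = (\<lambda>x y. sqrt (bilh (h c x) y y))"
    by (simp add: metric_norm_def bilh_apply fun_eq_iff)
  have "R.Rc z y y = \<mu> (pt c z) * bilh (h c z) y y" if z: "z \<in> dom c" for z y
  proof (cases "y = 0")
    case True
    then show ?thesis
      using R.Rc_scale[of z 0 0 0] by simp
  next
    case False
    have "Ric (metric_norm h c) z y = \<mu> (pt c z) * (metric_norm h c z y)\<^sup>2"
      using assms(2) c pt_in[OF c z] snd_pt[OF c z] False unfolding einstein_def by metis
    then show ?thesis
      using R.Ric_norm[OF z False] metric_norm_sq[OF c z, of y] by (simp add: norm bilh_apply)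
  qed
  then show "((\<lambda>z. \<mu> (pt c z)) has_derivative (\<lambda>_. 0)) (at x)"
    by (rule R.schur[OF assms(1) _ x])
qed

lemma transition_W:
  assumes "c \<in> A" "c' \<in> A" "z \<in> snd c ` (fst c \<inter> fst c')"
  shows "W c' (transition c c' z) = blinfun_derivative (transition c c') z (W c z)"
  using W_field assms overlap(3,5,6)[OF assms] snd_pt[OF assms(1) overlap(4)[OF assms]]
  unfolding smooth_vector_field_def Ck_vector_field_def vfield_transformation_law_def by metis

lemma transition_bil:
  assumes "c \<in> A" "c' \<in> A" "z \<in> snd c ` (fst c \<inter> fst c')"
  shows "bil (h c z) u v = bil (h c' (transition c c' z)) (blinfun_derivative (transition c c') z u)
    (blinfun_derivative (transition c c') z v)"
  using riem assms overlap(3,5,6)[OF assms] snd_pt[OF assms(1) overlap(4)[OF assms]]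
  unfolding riemannian_metric_def by metis

lemma transition_FM:
  assumes "c \<in> A" "c' \<in> A" "z \<in> snd c ` (fst c \<inter> fst c')"
  shows "FM c z y = FM c' (transition c c' z) (blinfun_derivative (transition c c') z y)"
  by (simp add: randers_metric_def Let_def metric_norm_def transition_W[OF assms] transition_bil[OF assms])

lemma W_zero_transition:
  assumes "c \<in> A" "c' \<in> A" "p \<in> fst c" "p \<in> fst c'" "W c (snd c p) = 0"
  shows "W c' (snd c' p) = 0"
proof -
  have z: "snd c p \<in> snd c ` (fst c \<inter> fst c')"
    using assms(3,4) by simp
  show ?thesis
    using transition_W[OF assms(1,2) z] overlap(5)[OF assms(1,2) z] pt_snd[OF assms(1,3)] assms(5) by simp
qed

lemma W_nonzero_dense:
  assumes "\<not> is_riemannian A FM" "c \<in> A" "open S" "S \<subseteq> dom c" "S \<noteq> {}"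
  shows "\<exists>z\<in>S. W c z \<noteq> 0"
proof (rule ccontr)
  assume zero: "\<not> (\<exists>z\<in>S. W c z \<noteq> 0)"
  define zp where "zp p \<longleftrightarrow> (\<forall>c\<in>A. p \<in> fst c \<longrightarrow> W c (snd c p) = 0)" for p
  \<comment> \<open>The interior of the zero set of W. It is open by construction, and unique
    continuation on coordinate balls makes it closed.\<close>
  define Z where "Z = \<Union>{N. open N \<and> (\<forall>p\<in>N. zp p)}"
  have zp_chart: "zp p" if "c \<in> A" "p \<in> fst c" "W c (snd c p) = 0" for c p
    using W_zero_transition that unfolding zp_def by blast
  have Z_pre: "fst c \<inter> snd c -` T \<subseteq> Z" if "c \<in> A" "open T" "\<And>z. z \<in> T \<Longrightarrow> W c z = 0" for c T
  proof -
    have "\<forall>p\<in>fst c \<inter> snd c -` T. zp p"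
      using that by (auto intro: zp_chart)
    then show ?thesis
      unfolding Z_def using open_preimage[OF that(1,2)] by blast
  qed
  have openZ: "open Z"
    unfolding Z_def by blast
  have Z_zero: "zp p" if "p \<in> Z" for p
    using that by (auto simp: Z_def)
  have "closed Z"
  proof -
    have "p \<in> Z" if p: "p \<in> closure Z" for p
    proof -
      obtain c where c: "c \<in> A" "p \<in> fst c"
        using chart_at by blast
      obtain r where r: "r > 0" "ball (snd c p) r \<subseteq> dom c"
        using open_dom[OF c(1)] snd_in[OF c(2)] open_contains_ball by blast
      let ?N = "fst c \<inter> snd c -` ball (snd c p) r"
      have "open ?N" "p \<in> ?N"
        using open_preimage[OF c(1)] r(1) c(2) by auto
      then obtain q where q: "q \<in> ?N" "q \<in> Z"
        using p closure_iff_nhds_not_empty by (metis disjoint_iff order_refl)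
      have T: "open (snd c ` (fst c \<inter> Z))"
        by (intro open_image open_Int open_fst c openZ) simp
      obtain \<Gamma> B where R: "randers_homothetic (dom c) (\<lambda>x. bilh (h c x)) \<Gamma> (W c) B \<sigma>"
        using homothetic_chart_exists[OF c(1)] by blast
      have "W c z = 0" if "z \<in> ball (snd c p) r" for z
      proof (rule randers_homothetic.unique_continuation[OF R convex_ball r(2) T _ _ _ that])
        show "W c y = 0" if "y \<in> snd c ` (fst c \<inter> Z)" for y
          using that Z_zero c(1) unfolding zp_def by auto
        show "snd c q \<in> snd c ` (fst c \<inter> Z)" "snd c q \<in> ball (snd c p) r"
          using q by auto
      qed
      then have "?N \<subseteq> Z"
        by (rule Z_pre[OF c(1) open_ball])
      then show "p \<in> Z"
        using \<open>p \<in> ?N\<close> by blast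
    qed
    then show ?thesis
      using closure_subset_eq by blast
  qed
  moreover have "Z \<noteq> {}"
  proof -
    obtain z where z: "z \<in> S"
      using assms(5) by blast
    then have "pt c z \<in> fst c \<inter> snd c -` S"
      using assms(4) pt_in[OF assms(2)] snd_pt[OF assms(2)] by auto
    then show ?thesis
      using Z_pre[OF assms(2,3)] zero by blast
  qed
  ultimately have "Z = UNIV"
    using openZ manifold unfolding manifold_atlas_def connected_clopen by auto
  then have "W c (snd c p) = 0" if "c \<in> A" "p \<in> fst c" for c p
    using Z_zero that unfolding zp_def by blast
  \<comment> \<open>With W = 0 the formula for F returns the norm of h.\<close>
  then have "is_riemannian A FM"
    unfolding is_riemannian_def using riem
    by (intro exI[of _ h]) (simp add: randers_metric_def Let_def metric_norm_def bil_def
        h_nonneg[unfolded bil_def] dom_def)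
  then show False
    using assms(1) by blast
qed

text \<open>Serves to compare, between charts, the ratio of the complete lift of F to F.\<close>

lemma complete_lift_FM_transition:
  assumes "c \<in> A" "c' \<in> A" "p \<in> fst c" "p \<in> fst c'" "Ck_vector_field 2 A V" "y \<noteq> 0"
  shows "\<exists>y'. y' \<noteq> 0 \<and> FM c (snd c p) y = FM c' (snd c' p) y' \<and>
    complete_lift (V c) (FM c) (snd c p) y = complete_lift (V c') (FM c') (snd c' p) y'"
proof -
  let ?S = "snd c ` (fst c \<inter> fst c')" and ?\<tau> = "transition c c'"
  let ?y' = "blinfun_derivative ?\<tau> (snd c p) y"
  have z: "snd c p \<in> ?S"
    using assms(3,4) by simp
  have \<tau>: "?\<tau> (snd c p) = snd c' p"
    using overlap(5)[OF assms(1,2) z] pt_snd[OF assms(1,3)] by simp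
  have F: "FM c (snd c p) y = FM c' (snd c' p) ?y'"
    using transition_FM[OF assms(1,2) z] \<tau> by simp
  have "?y' \<noteq> 0"
  proof
    assume "?y' = 0"
    then have "FM c (snd c p) y = 0"
      unfolding F by (simp add: randers_metric_def Let_def metric_norm_def bil_def)
    then show False
      using FM_pos[OF assms(1) snd_in[OF assms(3)] assms(6)] by simp
  qed
  moreover have "complete_lift (V c) (FM c) (snd c p) y = complete_lift (V c') (FM c') (?\<tau> (snd c p)) ?y'"
  proof -
    obtain \<Gamma> B where R: "randers_chart (dom c') (\<lambda>x. bilh (h c' x)) \<Gamma> (W c') B"
      using chart_exists[OF assms(2)] by blast
    interpret R: randers_chart "dom c'" "\<lambda>x. bilh (h c' x)" \<Gamma> "W c'" B
      by (rule R)
    have "((\<lambda>p. R.F (fst p) (snd p)) has_derivative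
        (\<lambda>q. R.Fd (snd c' p) ?y' (fst q) (snd q + \<Gamma> (snd c' p) (fst q) ?y'))) (at (snd c' p, ?y'))"
      using R.cov_F[OF snd_in[OF assms(4)] \<open>?y' \<noteq> 0\<close>] unfolding R.cov_s_def .
    then have D: "((\<lambda>p. FM c' (fst p) (snd p)) has_derivative
        (\<lambda>q. R.Fd (snd c' p) ?y' (fst q) (snd q + \<Gamma> (snd c' p) (fst q) ?y'))) (at (?\<tau> (snd c p), ?y'))"
      unfolding \<tau>
      by (rule has_derivative_transform_within_open[of _ _ _ _ "dom c' \<times> UNIV"])
        (use agree_FM[OF assms(2) R] snd_in[OF assms(4)] in \<open>simp_all add: open_Times R.open_U agree_def mem_Times_iff\<close>)
    have VC: "Ck_on (Suc 1) (V c) (dom c)" "Ck_on (Suc 1) (V c') (dom c')"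
      using assms(1,2,5) by (simp_all only: Suc_1 Ck_vector_field_def dom_def)
    have V: "(V c has_derivative blinfun_apply (blinfun_derivative (V c) (snd c p))) (at (snd c p))"
      by (rule Ck_on_Suc_has_derivative[OF VC(1) open_dom[OF assms(1)] snd_in[OF assms(3)]])
    have V': "(V c' has_derivative blinfun_apply (blinfun_derivative (V c') (snd c' p))) (at (?\<tau> (snd c p)))"
      unfolding \<tau> by (rule Ck_on_Suc_has_derivative[OF VC(2) open_dom[OF assms(2)] snd_in[OF assms(4)]])
    have tr: "V c' (?\<tau> z) = blinfun_derivative ?\<tau> z (V c z)" if "z \<in> ?S" for z
      using assms(1,2,5) overlap(3,5,6)[OF assms(1,2) that] snd_pt[OF assms(1) overlap(4)[OF assms(1,2) that]]
      unfolding Ck_vector_field_def vfield_transformation_law_def by metis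
    show ?thesis
      by (rule complete_lift_transform[OF overlap(1)[OF assms(1,2)] z overlap(2)[OF assms(1,2)]
            transition_FM[OF assms(1,2)] D V V' tr])
  qed
  ultimately show ?thesis
    using F \<tau> by auto
qed

end

section \<open>Solitons on manifolds\<close>

context randers_manifold
begin

lemma field_chart_exists:
  assumes "c \<in> A" "Ck_vector_field 2 A V"
  shows "\<exists>\<Gamma> B. randers_field (dom c) (\<lambda>x. bilh (h c x)) \<Gamma> (W c) B \<sigma> (V c)"
proof -
  obtain \<Gamma> B where "randers_homothetic (dom c) (\<lambda>x. bilh (h c x)) \<Gamma> (W c) B \<sigma>"
    using homothetic_chart_exists[OF assms(1)] by blast
  moreover have "Ck_on 2 (V c) (dom c)"
    using assms unfolding Ck_vector_field_def dom_def by blast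
  ultimately show ?thesis
    by (metis randers_field.intro randers_field_axioms.intro)
qed

lemma complete_lift_sq_FM:
  assumes "c \<in> A" "x \<in> dom c" "y \<noteq> 0" "Ck_vector_field 2 A V"
  shows "complete_lift (V c) (sq (FM c)) x y = 2 * FM c x y * complete_lift (V c) (FM c) x y"
proof -
  obtain \<Gamma> B where R: "randers_field (dom c) (\<lambda>x. bilh (h c x)) \<Gamma> (W c) B \<sigma> (V c)"
    using field_chart_exists[OF assms(1,4)] by blast
  interpret R: randers_field "dom c" "\<lambda>x. bilh (h c x)" \<Gamma> "W c" B \<sigma> "V c"
    by (rule R)
  note ag = agree_FM[OF assms(1) R.randers_chart_axioms]
  show ?thesis
    using R.complete_lift_sq_F[OF assms(2,3)] ag agree_complete_lift[OF R.open_U ag]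
      agree_complete_lift[OF R.open_U agree_sq[OF ag]] assms(2)
    unfolding agree_def by simp
qed

text \<open>\<open>rho\<close> is built from a coordinate vector of its chart. The ratio r of the
  complete lift of F to F does not depend on the chart, so it is a function on the manifold; in each
  chart it equals minus \<open>rho\<close> and is locally constant.\<close>

lemma soliton_imp_homothetic:
  assumes "CARD('n) \<ge> 2" "\<not> is_riemannian A FM" "Ck_vector_field 2 A V" "almost_ricci_soliton A FM V \<kappa>"
  shows "\<exists>c. homothetic A FM V (c / 2)"
proof -
  have chart: "\<exists>\<rho>. (\<forall>x\<in>dom c. (\<rho> has_derivative (\<lambda>_. 0)) (at x)) \<and>
      (\<forall>x\<in>dom c. \<forall>y. y \<noteq> 0 \<longrightarrow> complete_lift (V c) (FM c) x y = - \<rho> x * FM c x y)" if c: "c \<in> A" for c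
  proof -
    obtain \<Gamma> B where R: "randers_field (dom c) (\<lambda>x. bilh (h c x)) \<Gamma> (W c) B \<sigma> (V c)"
      using field_chart_exists[OF c assms(3)] by blast
    interpret R: randers_field "dom c" "\<lambda>x. bilh (h c x)" \<Gamma> "W c" B \<sigma> "V c"
      by (rule R)
    note ag = agree_FM[OF c R.randers_chart_axioms]
    note ag' = agree_Ric[OF R.open_U ag] agree_complete_lift[OF R.open_U ag]
      agree_complete_lift[OF R.open_U agree_sq[OF ag]]
    have sol: "2 * Ric R.F x y + complete_lift (V c) (sq R.F) x y = 2 * \<kappa> (pt c x) * (R.F x y)\<^sup>2"
      if "x \<in> dom c" "y \<noteq> 0" for x y
    proof -
      have "2 * Ric (FM c) x y + complete_lift (V c) (sq (FM c)) x y = 2 * \<kappa> (pt c x) * (FM c x y)\<^sup>2"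
        using assms(4) c pt_in[OF c that(1)] snd_pt[OF c that(1)] that(2) unfolding almost_ricci_soliton_def by metis
      then show ?thesis
        using ag ag' that(1) unfolding agree_def by simp
    qed
    have dense: "\<exists>z\<in>S. W c z \<noteq> 0" if "open S" "S \<subseteq> dom c" "S \<noteq> {}" for S
      by (rule W_nonzero_dense[OF assms(2) c that])
    show ?thesis
    proof (intro exI[of _ R.rho] conjI ballI allI impI)
      fix x assume x: "x \<in> dom c"
      show "(R.rho has_derivative (\<lambda>_. 0)) (at x)"
        by (rule R.soliton_homothetic(1)[OF assms(1) dense sol x]; assumption)
      fix y :: "real ^ 'n" assume y: "y \<noteq> 0"
      have "complete_lift (V c) R.F x y = - R.rho x * R.F x y"
        by (rule R.soliton_homothetic(2)[OF assms(1) dense sol x y]; assumption)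
      then show "complete_lift (V c) (FM c) x y = - R.rho x * FM c x y"
        using ag ag'(2) x unfolding agree_def by simp
    qed
  qed
  have "\<exists>r. \<forall>c\<in>A. p \<in> fst c \<longrightarrow> (\<forall>y. y \<noteq> 0 \<longrightarrow>
      complete_lift (V c) (FM c) (snd c p) y = r * FM c (snd c p) y)" for p
  proof -
    obtain c' where c': "c' \<in> A" "p \<in> fst c'"
      using chart_at by blast
    then obtain r where r: "\<And>y. y \<noteq> 0 \<Longrightarrow> complete_lift (V c') (FM c') (snd c' p) y = r * FM c' (snd c' p) y"
      using chart[OF c'(1)] snd_in[OF c'(2)] by blast
    have "complete_lift (V c) (FM c) (snd c p) y = r * FM c (snd c p) y"
      if c: "c \<in> A" "p \<in> fst c" "y \<noteq> 0" for c y
      using complete_lift_FM_transition[OF c(1) c'(1) c(2) c'(2) assms(3) c(3)] r by metis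
    then show ?thesis
      by blast
  qed
  then obtain r where r: "\<And>p c y. c \<in> A \<Longrightarrow> p \<in> fst c \<Longrightarrow> y \<noteq> 0 \<Longrightarrow>
      complete_lift (V c) (FM c) (snd c p) y = r p * FM c (snd c p) y"
    by metis
  have "r constant_on UNIV"
  proof (rule locally_constant_on_charts)
    fix c x assume c: "c \<in> A" and x: "x \<in> dom c"
    obtain \<rho> where \<rho>: "\<And>x. x \<in> dom c \<Longrightarrow> (\<rho> has_derivative (\<lambda>_. 0)) (at x)"
      "\<And>x y. x \<in> dom c \<Longrightarrow> y \<noteq> 0 \<Longrightarrow> complete_lift (V c) (FM c) x y = - \<rho> x * FM c x y"
      using chart[OF c] by blast
    have eq: "- \<rho> z = r (pt c z)" if z: "z \<in> dom c" for z
    proof -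
      define y :: "real ^ 'n" where "y = axis undefined 1"
      have y: "y \<noteq> 0"
        by (simp add: y_def)
      have "- \<rho> z * FM c z y = r (pt c z) * FM c z y"
        using \<rho>(2)[OF z y] r[OF c pt_in[OF c z] y] snd_pt[OF c z] by simp
      then show ?thesis
        using FM_pos[OF c z y] mult_right_cancel[of "FM c z y" "- \<rho> z" "r (pt c z)"] by simp
    qed
    have "((\<lambda>z. - \<rho> z) has_derivative (\<lambda>_. 0)) (at x)"
      using has_derivative_minus[OF \<rho>(1)[OF x]] by simp
    then show "((\<lambda>z. r (pt c z)) has_derivative (\<lambda>_. 0)) (at x)"
      by (rule has_derivative_transform_within_open[OF _ open_dom[OF c] x eq])
  qed
  then obtain k where "\<And>p. r p = k"
    by (auto simp: constant_on_def)
  then show ?thesis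
    using r by (intro exI[of _ k]) (simp add: homothetic_def)
qed

text \<open>Homothety turns the Lie derivative of F^2 into 2 c F^2, which moves to the other
  side.\<close>

lemma soliton_iff_einstein:
  assumes "Ck_vector_field 2 A V" "homothetic A FM V (c / 2)"
  shows "almost_ricci_soliton A FM V \<kappa> \<longleftrightarrow> einstein A FM (\<lambda>p. \<kappa> p - c)"
proof -
  have "2 * Ric (FM d) (snd d p) y + complete_lift (V d) (sq (FM d)) (snd d p) y = 2 * \<kappa> p * (FM d (snd d p) y)\<^sup>2
      \<longleftrightarrow> Ric (FM d) (snd d p) y = (\<kappa> p - c) * (FM d (snd d p) y)\<^sup>2"
    if "d \<in> A" "p \<in> fst d" "y \<noteq> 0" for d p y
    using complete_lift_sq_FM[OF that(1) snd_in[OF that(2)] that(3) assms(1)] assms(2) that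
    unfolding homothetic_def by (auto simp: algebra_simps power2_eq_square)
  then show ?thesis
    unfolding almost_ricci_soliton_def einstein_def by blast
qed

end

theorem corollary1p5:
  fixes A :: "('m::{t2_space, second_countable_topology}, 'n::finite) chart set"
    and h :: "('m, 'n) tensor2"
    and W V :: "('m, 'n) vfield"
    and F :: "('m, 'n) tmfun"
    and \<sigma> :: real
    and \<kappa> :: "'m \<Rightarrow> real"
  assumes "manifold_atlas A"
    and "CARD('n) \<ge> 2"
    and "navigation_data A h W"
    and "F = randers_metric h W"
    and "\<not> is_riemannian A F"
    and "Ck_vector_field 2 A V"
    and "constant_S_BH A F \<sigma>"
  shows "(almost_ricci_soliton A F V \<kappa> \<longleftrightarrow>
           (\<exists>\<mu> c. einstein A (metric_norm h) \<mu> \<and> homothetic A (metric_norm h) W (- \<sigma>) \<and>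
              homothetic A F V (c / 2) \<and>
              (\<forall>p. \<kappa> p = \<mu> p + c - (real CARD('n) - 1) * \<sigma>\<^sup>2)) \<or>
           (\<exists>\<nu> c. einstein A F \<nu> \<and> homothetic A F V (c / 2) \<and> (\<forall>p. \<kappa> p = \<nu> p + c)))
       \<and> (\<forall>\<mu> c. einstein A (metric_norm h) \<mu> \<and> homothetic A (metric_norm h) W (- \<sigma>) \<and>
              homothetic A F V (c / 2) \<and>
              (\<forall>p. \<kappa> p = \<mu> p + c - (real CARD('n) - 1) * \<sigma>\<^sup>2) \<and> CARD('n) \<ge> 3
            \<longrightarrow> \<kappa> constant_on UNIV \<and> \<mu> constant_on UNIV)
       \<and> (\<forall>\<nu> c. einstein A F \<nu> \<and> homothetic A F V (c / 2) \<and> (\<forall>p. \<kappa> p = \<nu> p + c) \<and>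
              CARD('n) \<ge> 3
            \<longrightarrow> \<kappa> constant_on UNIV \<and> \<nu> constant_on UNIV)"
proof -
  interpret randers_manifold A h W \<sigma>
    using assms by unfold_locales auto
  note [simp] = assms(4)
  let ?k = "(real CARD('n) - 1) * \<sigma>\<^sup>2"
  have shift: "(\<lambda>p. f p + a) constant_on UNIV \<longleftrightarrow> f constant_on UNIV" for f :: "'m \<Rightarrow> real" and a
    unfolding constant_on_def by (metis add_diff_cancel)
  show ?thesis
  proof (intro conjI allI impI iffI)
    assume sol: "almost_ricci_soliton A F V \<kappa>"
    obtain c where c: "homothetic A FM V (c / 2)"
      using soliton_imp_homothetic[OF assms(2) _ assms(6)] sol assms(5) by auto
    then have "einstein A FM (\<lambda>p. \<kappa> p - c)"
      using soliton_iff_einstein[OF assms(6) c] sol by simp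
    then have "\<exists>\<nu> c. einstein A F \<nu> \<and> homothetic A F V (c / 2) \<and> (\<forall>p. \<kappa> p = \<nu> p + c)"
      using c by (intro exI[of _ "\<lambda>p. \<kappa> p - c"] exI[of _ c]) simp
    then show "(\<exists>\<mu> c. einstein A (metric_norm h) \<mu> \<and> homothetic A (metric_norm h) W (- \<sigma>) \<and>
              homothetic A F V (c / 2) \<and> (\<forall>p. \<kappa> p = \<mu> p + c - ?k)) \<or>
           (\<exists>\<nu> c. einstein A F \<nu> \<and> homothetic A F V (c / 2) \<and> (\<forall>p. \<kappa> p = \<nu> p + c))"
      by (rule disjI2)
  next
    assume "(\<exists>\<mu> c. einstein A (metric_norm h) \<mu> \<and> homothetic A (metric_norm h) W (- \<sigma>) \<and>
              homothetic A F V (c / 2) \<and> (\<forall>p. \<kappa> p = \<mu> p + c - ?k)) \<or>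
           (\<exists>\<nu> c. einstein A F \<nu> \<and> homothetic A F V (c / 2) \<and> (\<forall>p. \<kappa> p = \<nu> p + c))"
    then obtain \<nu> c where e: "einstein A FM \<nu>" "homothetic A FM V (c / 2)" "\<And>p. \<kappa> p = \<nu> p + c"
    proof (elim disjE exE conjE)
      fix \<mu> c
      assume m: "einstein A (metric_norm h) \<mu>" "homothetic A F V (c / 2)" "\<forall>p. \<kappa> p = \<mu> p + c - ?k"
      \<comment> \<open>By \<open>einstein_FM_iff\<close> the Einstein scalar of F is \<mu> - (n-1)
        \<sigma>^2.\<close>
      show thesis
        by (rule that[of "\<lambda>p. \<mu> p - ?k" c]) (use m in \<open>simp_all add: einstein_FM_iff\<close>)
    next
      fix \<nu> c assume "einstein A F \<nu>" "homothetic A F V (c / 2)" "\<forall>p. \<kappa> p = \<nu> p + c"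
      then show thesis
        by (intro that) simp_all
    qed
    then show "almost_ricci_soliton A F V \<kappa>"
      using soliton_iff_einstein[OF assms(6) e(2)] by simp
  next
    fix \<mu> c
    assume m: "einstein A (metric_norm h) \<mu> \<and> homothetic A (metric_norm h) W (- \<sigma>) \<and>
              homothetic A F V (c / 2) \<and> (\<forall>p. \<kappa> p = \<mu> p + c - ?k) \<and> CARD('n) \<ge> 3"
    then show \<mu>: "\<mu> constant_on UNIV"
      using einstein_constant by blast
    have "\<kappa> = (\<lambda>p. \<mu> p + (c - ?k))"
      using m by (simp add: fun_eq_iff)
    then show "\<kappa> constant_on UNIV"
      using \<mu> shift by simp
  next
    fix \<nu> c
    assume n: "einstein A F \<nu> \<and> homothetic A F V (c / 2) \<and> (\<forall>p. \<kappa> p = \<nu> p + c) \<and> CARD('n) \<ge> 3"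
    \<comment> \<open>Schur's lemma is applied to h, whose Einstein scalar differs from \<nu> by a
      constant.\<close>
    then have "(\<lambda>p. \<nu> p + ?k) constant_on UNIV"
      using einstein_constant einstein_FM_iff by simp
    then show \<nu>: "\<nu> constant_on UNIV"
      by (simp only: shift)
    have "\<kappa> = (\<lambda>p. \<nu> p + c)"
      using n by (simp add: fun_eq_iff)
    then show "\<kappa> constant_on UNIV"
      using \<nu> shift by simp
  qed
qed

end
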